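(* Let $T>0$, $0\le\underline\sigma\le\overline\sigma$, let $\Phi:\mathbb{R}\to\mathbb{R}$ be Lipschitz continuous, and set $G_*(a)=\frac12\inf_{\underline\sigma\le\sigma\le\overline\sigma}\{\sigma^2a\}$. Then $$u_*(t,x)=\inf_{\underline\sigma\le\alpha_\cdot\le\overline\sigma}E\Big[\Phi\Big(x+\int_0^{T-t}\alpha_rdW_r\Big)\Big],\qquad(t,x)\in[0,T]\times\mathbb{R},$$ solves the $G$-heat equation $$\partial_tu(t,x)+G_*(\partial^2_{xx}u)=0,\qquad u(T,x)=\Phi(x).$$
   Context: $W$ is a standard one-dimensional Brownian motion on a classical probability space with (linear) expectation $E$ and augmented Brownian filtration; the infimum is over all adapted control processes $(\alpha_r)$ with values in $[\underline\sigma,\overline\sigma]$. "Solves" is in the viscosity sense: for $\partial_tu+F(D^2u)=0$, $u(T,\cdot)=\Phi$, a continuous $u$ with this terminal value such that for every $\varphi\in C_b^{1,3}$: $\partial_t\varphi+F(D^2\varphi)\ge0$ at points $(t,x)$, $t<T$, where $u-\varphi$ has a local maximum, and $\le0$ where $u-\varphi$ has a local minimum. *)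

theory Defs
  imports "HOL-Probability.Probability"
begin

section \<open>Brownian motion, its augmented filtration and the Ito integral\<close>

definition natural_filtration :: "'a measure \<Rightarrow> (real \<Rightarrow> 'a \<Rightarrow> real) \<Rightarrow> real \<Rightarrow> 'a measure" where
  "natural_filtration M W t =
     sigma (space M) {W s -` A \<inter> space M | s A. s \<in> {0..t} \<and> A \<in> sets borel}"

text \<open>The null sets of \<^term>\<open>completion M\<close> are all subsets of null sets of \<^term>\<open>M\<close>.  The
  augmented sigma-algebras therefore live on \<^term>\<open>completion M\<close> rather than on \<^term>\<open>M\<close>,
  which is not assumed to be complete; below, expectations are taken with respect to
  \<^term>\<open>completion M\<close>.\<close>

definition augmented_filtration :: "'a measure \<Rightarrow> (real \<Rightarrow> 'a \<Rightarrow> real) \<Rightarrow> real \<Rightarrow> 'a measure" where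
  "augmented_filtration M W t =
     sigma (space M) (sets (natural_filtration M W t) \<union> null_sets (completion M))"

text \<open>Only the times \<open>t \<ge> 0\<close> matter.\<close>

locale brownian_motion = prob_space M for M :: "'a measure" +
  fixes W :: "real \<Rightarrow> 'a \<Rightarrow> real"
  assumes random_variable_W: "0 \<le> t \<Longrightarrow> W t \<in> borel_measurable M"
    and W_start: "AE \<omega> in M. W 0 \<omega> = 0"
    and W_continuous: "AE \<omega> in M. continuous_on {0..} (\<lambda>t. W t \<omega>)"
    and W_increment_normal: "0 \<le> s \<Longrightarrow> s < t \<Longrightarrow>
      distributed M lborel (\<lambda>\<omega>. W t \<omega> - W s \<omega>) (normal_density 0 (sqrt (t - s)))"
    and W_increment_indep: "0 \<le> s \<Longrightarrow> s < t \<Longrightarrow>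
      indep_set (sets (natural_filtration M W s))
        (sets (vimage_algebra (space M) (\<lambda>\<omega>. W t \<omega> - W s \<omega>) borel))"

text \<open>The simple process given by \<open>(n, s, \<xi>)\<close> is
  \<open>\<xi> i\<close> on \<open>{s i <.. s (Suc i)}\<close> for \<open>i < n\<close>, where \<open>0 = s 0 < \<dots> < s n = b\<close>.\<close>

definition simple_process ::
    "'a measure \<Rightarrow> (real \<Rightarrow> 'a \<Rightarrow> real) \<Rightarrow> real \<Rightarrow> nat \<Rightarrow> (nat \<Rightarrow> real) \<Rightarrow> (nat \<Rightarrow> 'a \<Rightarrow> real) \<Rightarrow> bool" where
  "simple_process M W b n s \<xi> \<longleftrightarrow>
     s 0 = 0 \<and> s n = b \<and> (\<forall>i<n. s i < s (Suc i)) \<and>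
     (\<forall>i<n. \<xi> i \<in> borel_measurable (augmented_filtration M W (s i))) \<and>
     (\<exists>C. \<forall>i<n. \<forall>\<omega>\<in>space M. \<bar>\<xi> i \<omega>\<bar> \<le> C)"

definition simple_value :: "nat \<Rightarrow> (nat \<Rightarrow> real) \<Rightarrow> (nat \<Rightarrow> 'a \<Rightarrow> real) \<Rightarrow> real \<Rightarrow> 'a \<Rightarrow> real" where
  "simple_value n s \<xi> r \<omega> = (\<Sum>i<n. \<xi> i \<omega> * indicator {s i<..s (Suc i)} r)"

definition simple_integral ::
    "(real \<Rightarrow> 'a \<Rightarrow> real) \<Rightarrow> nat \<Rightarrow> (nat \<Rightarrow> real) \<Rightarrow> (nat \<Rightarrow> 'a \<Rightarrow> real) \<Rightarrow> 'a \<Rightarrow> real" where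
  "simple_integral W n s \<xi> \<omega> = (\<Sum>i<n. \<xi> i \<omega> * (W (s (Suc i)) \<omega> - W (s i) \<omega>))"

text \<open>\<open>I\<close> is a version of \<open>\<integral>\<^sub>0\<^sup>b \<alpha>\<^sub>r dW\<^sub>r\<close>: it is the mean-square limit of the
  integrals of simple processes that converge to \<open>\<alpha>\<close> in \<open>L\<^sup>2(dr \<otimes> dP)\<close> on \<open>[0,b]\<close>.\<close>

definition has_ito_integral ::
    "'a measure \<Rightarrow> (real \<Rightarrow> 'a \<Rightarrow> real) \<Rightarrow> real \<Rightarrow> (real \<Rightarrow> 'a \<Rightarrow> real) \<Rightarrow> ('a \<Rightarrow> real) \<Rightarrow> bool" where
  "has_ito_integral M W b \<alpha> I \<longleftrightarrow>
     I \<in> borel_measurable (completion M) \<and>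
     (\<exists>n s \<xi>. (\<forall>k. simple_process M W b (n k) (s k) (\<xi> k)) \<and>
        (\<lambda>k. \<integral>\<^sup>+\<omega>. (\<integral>\<^sup>+r\<in>{0..b}. ennreal ((\<alpha> r \<omega> - simple_value (n k) (s k) (\<xi> k) r \<omega>)\<^sup>2) \<partial>lborel)
              \<partial>completion M) \<longlonglongrightarrow> 0 \<and>
        (\<lambda>k. \<integral>\<^sup>+\<omega>. ennreal ((I \<omega> - simple_integral W (n k) (s k) (\<xi> k) \<omega>)\<^sup>2)
              \<partial>completion M) \<longlonglongrightarrow> 0)"

text \<open>The Ito integral is determined almost everywhere only; this picks a version.\<close>

definition ito_integral ::
    "'a measure \<Rightarrow> (real \<Rightarrow> 'a \<Rightarrow> real) \<Rightarrow> real \<Rightarrow> (real \<Rightarrow> 'a \<Rightarrow> real) \<Rightarrow> 'a \<Rightarrow> real" where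
  "ito_integral M W b \<alpha> = (SOME I. has_ito_integral M W b \<alpha> I)"


section \<open>The control problem\<close>

definition controls ::
    "'a measure \<Rightarrow> (real \<Rightarrow> 'a \<Rightarrow> real) \<Rightarrow> real \<Rightarrow> real \<Rightarrow> (real \<Rightarrow> 'a \<Rightarrow> real) set" where
  "controls M W \<sigma>\<^sub>l \<sigma>\<^sub>u = {\<alpha>.
     (\<lambda>(r, \<omega>). \<alpha> r \<omega>) \<in> borel_measurable (restrict_space borel {0..} \<Otimes>\<^sub>M completion M) \<and>
     (\<forall>r\<ge>0. \<alpha> r \<in> borel_measurable (augmented_filtration M W r)) \<and>
     (\<forall>r\<ge>0. \<forall>\<omega>\<in>space M. \<alpha> r \<omega> \<in> {\<sigma>\<^sub>l..\<sigma>\<^sub>u})}"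

definition u_lower ::
    "'a measure \<Rightarrow> (real \<Rightarrow> 'a \<Rightarrow> real) \<Rightarrow> real \<Rightarrow> real \<Rightarrow> (real \<Rightarrow> real) \<Rightarrow> real \<Rightarrow> real \<Rightarrow> real \<Rightarrow> real" where
  "u_lower M W \<sigma>\<^sub>l \<sigma>\<^sub>u \<Phi> T t x =
     (INF \<alpha>\<in>controls M W \<sigma>\<^sub>l \<sigma>\<^sub>u. \<integral>\<omega>. \<Phi> (x + ito_integral M W (T - t) \<alpha> \<omega>) \<partial>completion M)"

definition G_lower :: "real \<Rightarrow> real \<Rightarrow> real \<Rightarrow> real" where
  "G_lower \<sigma>\<^sub>l \<sigma>\<^sub>u a = 1 / 2 * (INF \<sigma>\<in>{\<sigma>\<^sub>l..\<sigma>\<^sub>u}. \<sigma>\<^sup>2 * a)"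


section \<open>Viscosity solutions of \<open>\<partial>\<^sub>t u + F(D\<^sup>2 u) = 0\<close>, \<open>u(T, \<cdot>) = \<Phi>\<close>\<close>

text \<open>\<open>\<phi>\<close> is of class \<open>C\<^sub>b\<^sup>1\<^sup>,\<^sup>3\<close> on \<open>[0,T] \<times> \<real>\<close>, with the derivatives
  \<open>\<partial>\<^sub>t \<phi>\<close>, \<open>\<partial>\<^sub>x \<phi>\<close>, \<open>\<partial>\<^sub>x\<^sub>x \<phi>\<close>, \<open>\<partial>\<^sub>x\<^sub>x\<^sub>x \<phi>\<close> given by the
  remaining arguments; the time derivative is one-sided at \<open>0\<close> and \<open>T\<close>.\<close>

definition Cb_1_3 ::
    "real \<Rightarrow> (real \<Rightarrow> real \<Rightarrow> real) \<Rightarrow> (real \<Rightarrow> real \<Rightarrow> real) \<Rightarrow> (real \<Rightarrow> real \<Rightarrow> real) \<Rightarrow>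
      (real \<Rightarrow> real \<Rightarrow> real) \<Rightarrow> (real \<Rightarrow> real \<Rightarrow> real) \<Rightarrow> bool" where
  "Cb_1_3 T \<phi> \<phi>t \<phi>x \<phi>xx \<phi>xxx \<longleftrightarrow>
     (\<forall>t\<in>{0..T}. \<forall>x.
        ((\<lambda>s. \<phi> s x) has_real_derivative \<phi>t t x) (at t within {0..T}) \<and>
        (\<phi> t has_real_derivative \<phi>x t x) (at x) \<and>
        (\<phi>x t has_real_derivative \<phi>xx t x) (at x) \<and>
        (\<phi>xx t has_real_derivative \<phi>xxx t x) (at x)) \<and>
     (\<forall>f\<in>{\<phi>, \<phi>t, \<phi>x, \<phi>xx, \<phi>xxx}.
        continuous_on ({0..T} \<times> UNIV) (\<lambda>(t, x). f t x) \<and>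
        bounded ((\<lambda>(t, x). f t x) ` ({0..T} \<times> UNIV)))"

definition local_max_on :: "'a::topological_space set \<Rightarrow> ('a \<Rightarrow> real) \<Rightarrow> 'a \<Rightarrow> bool" where
  "local_max_on S f p \<longleftrightarrow> p \<in> S \<and> (\<forall>\<^sub>F q in at p within S. f q \<le> f p)"

definition local_min_on :: "'a::topological_space set \<Rightarrow> ('a \<Rightarrow> real) \<Rightarrow> 'a \<Rightarrow> bool" where
  "local_min_on S f p \<longleftrightarrow> p \<in> S \<and> (\<forall>\<^sub>F q in at p within S. f p \<le> f q)"

definition viscosity_solution ::
    "real \<Rightarrow> (real \<Rightarrow> real) \<Rightarrow> (real \<Rightarrow> real) \<Rightarrow> (real \<Rightarrow> real \<Rightarrow> real) \<Rightarrow> bool" where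
  "viscosity_solution T F \<Phi> u \<longleftrightarrow>
     continuous_on ({0..T} \<times> UNIV) (\<lambda>(t, x). u t x) \<and>
     (\<forall>x. u T x = \<Phi> x) \<and>
     (\<forall>\<phi> \<phi>t \<phi>x \<phi>xx \<phi>xxx. Cb_1_3 T \<phi> \<phi>t \<phi>x \<phi>xx \<phi>xxx \<longrightarrow>
        (\<forall>t\<in>{0..<T}. \<forall>x.
          (local_max_on ({0..T} \<times> UNIV) (\<lambda>(s, y). u s y - \<phi> s y) (t, x) \<longrightarrow>
             \<phi>t t x + F (\<phi>xx t x) \<ge> 0) \<and>
          (local_min_on ({0..T} \<times> UNIV) (\<lambda>(s, y). u s y - \<phi> s y) (t, x) \<longrightarrow>
             \<phi>t t x + F (\<phi>xx t x) \<le> 0)))"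

end

theory Submission
  imports Defs
begin

text \<open>
  Let \<open>S\<^sub>h f (x)\<close> be the infimum over \<open>\<sigma> \<in> [\<sigma>\<^sub>l, \<sigma>\<^sub>u]\<close> of the mean of \<open>f (x + \<sigma> \<surd>h Z)\<close>, \<open>Z\<close> standard normal.
  Composing these operators along a partition of \<open>[0,\<tau>]\<close> decreases under refinement, because a volatility
  may be kept constant; so the infimum over all partitions is a semigroup, the Nisio semigroup.
  It equals \<open>u\<^sub>*\<close> at time \<open>T - \<tau>\<close>: a control is approximated in mean square by simple processes with values
  in \<open>[\<sigma>\<^sub>l, \<sigma>\<^sub>u]\<close>, and conversely a partition is followed by nearly optimal feedback controls.  The viscosity
  inequalities only use the semigroup.  Near a point where \<open>u\<^sub>* - \<phi>\<close> is extremal, \<open>u\<^sub>*\<close> is bounded on one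
  side, globally in space, by the second-order Taylor polynomial of \<open>\<phi>\<close> up to \<open>\<delta> z\<^sup>2 + K z\<^sup>4\<close>.  The
  semigroup acts on such polynomials explicitly, and the quartic term only contributes \<open>O(h\<^sup>2)\<close>.
\<close>

section \<open>Gaussian averages\<close>

text \<open>Dynamic programming directly on \<open>u_lower\<close> would call for conditioning on
  the past and for pasting general controls. For piecewise constant volatilities it reduces to the
  independence of one Gaussian increment from the past, so it is carried out there. The price is
  that \<open>nisio\<close>, an infimum over partitions, has to be pulled through Gaussian averages:
  common refinements make near optimality simultaneous at finitely many points, and the Lipschitz
  constant, preserved by every operator, extends it to the whole line. The two viscosity
  inequalities use opposite halves of the semigroup property. At a maximum it is enough to hold one
  volatility fixed over a short time \<open>h\<close>. At a minimum the bound must hold for all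
  partitions of that time at once, with an error independent of the number of intervals. Polynomials
  \<open>a + b z + c z^2 + d z^4\<close> serve this purpose because Gaussian averaging preserves
  their form.\<close>

definition gauss :: "real measure" where
  "gauss = density lborel (\<lambda>z. ennreal (std_normal_density z))"

lemma sets_gauss [simp, measurable_cong]: "sets gauss = sets borel"
  by (simp add: gauss_def)

lemma space_gauss [simp]: "space gauss = UNIV"
  by (simp add: gauss_def)

interpretation gauss: prob_space gauss
  unfolding gauss_def by (rule prob_space_normal_density) simp

lemma measure_gauss_UNIV [simp]: "measure gauss UNIV = 1"
  using gauss.prob_space by simp

lemma has_bochner_integral_gauss:
  assumes "f \<in> borel_measurable borel"
    and "has_bochner_integral lborel (\<lambda>z. std_normal_density z * f z) c"
  shows "has_bochner_integral gauss f (c::real)"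
  unfolding gauss_def
  using assms by (intro has_bochner_integral_density) (auto simp: normal_density_nonneg)

lemma has_bochner_integral_gauss_quartic:
  "has_bochner_integral gauss (\<lambda>z. a0 + a1 * z + a2 * z\<^sup>2 + a3 * z ^ 3 + a4 * z ^ 4) (a0 + a2 + 3 * a4)"
proof -
  have 0: "has_bochner_integral gauss (\<lambda>z. a0) a0"
    by (simp add: has_bochner_integral_iff)
  have 1: "has_bochner_integral gauss (\<lambda>z. z) 0"
    using std_normal_moment_odd[of 0] by (intro has_bochner_integral_gauss) auto
  have 2: "has_bochner_integral gauss (\<lambda>z. z\<^sup>2) 1"
    using std_normal_moment_even[of 1] by (intro has_bochner_integral_gauss) auto
  have 3: "has_bochner_integral gauss (\<lambda>z. z ^ 3) 0"
    using std_normal_moment_odd[of 1] by (intro has_bochner_integral_gauss) (auto simp: numeral_eq_Suc)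
  have 4: "has_bochner_integral gauss (\<lambda>z. z ^ 4) 3"
    using std_normal_moment_even[of 2] by (intro has_bochner_integral_gauss) (auto simp: fact_numeral)
  have "has_bochner_integral gauss (\<lambda>z. a0 + a1 * z + a2 * z\<^sup>2 + a3 * z ^ 3 + a4 * z ^ 4)
      (a0 + a1 * 0 + a2 * 1 + a3 * 0 + a4 * 3)"
    by (intro has_bochner_integral_add has_bochner_integral_mult_right 0 1 2 3 4)
  then show ?thesis by (simp add: mult.commute)
qed

text \<open>The odd moments vanish, so the result has no cubic term in \<open>y\<close>: this family
  of polynomials is stable under Gaussian averaging, which lets a bound be iterated along a
  partition.\<close>

lemma has_bochner_integral_gauss_shifted_quartic:
  "has_bochner_integral gauss (\<lambda>z. a + b * (y + s * z) + c * (y + s * z)\<^sup>2 + d * (y + s * z) ^ 4)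
     (a + b * y + c * (y\<^sup>2 + s\<^sup>2) + d * (y ^ 4 + 6 * s\<^sup>2 * y\<^sup>2 + 3 * s ^ 4))"
proof -
  have "has_bochner_integral gauss
     (\<lambda>z. (a + b * y + c * y\<^sup>2 + d * y ^ 4) + (b * s + 2 * c * y * s + 4 * d * y ^ 3 * s) * z +
        (c * s\<^sup>2 + 6 * d * y\<^sup>2 * s\<^sup>2) * z\<^sup>2 + (4 * d * y * s ^ 3) * z ^ 3 + (d * s ^ 4) * z ^ 4)
     ((a + b * y + c * y\<^sup>2 + d * y ^ 4) + (c * s\<^sup>2 + 6 * d * y\<^sup>2 * s\<^sup>2) + 3 * (d * s ^ 4))"
    by (rule has_bochner_integral_gauss_quartic)
  moreover have "(a + b * y + c * y\<^sup>2 + d * y ^ 4) + (b * s + 2 * c * y * s + 4 * d * y ^ 3 * s) * z +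
        (c * s\<^sup>2 + 6 * d * y\<^sup>2 * s\<^sup>2) * z\<^sup>2 + (4 * d * y * s ^ 3) * z ^ 3 + (d * s ^ 4) * z ^ 4 =
      a + b * (y + s * z) + c * (y + s * z)\<^sup>2 + d * (y + s * z) ^ 4" for z
    by (simp add: power2_eq_square power3_eq_cube power4_eq_xxxx algebra_simps)
  ultimately show ?thesis
    by (simp add: algebra_simps)
qed

lemma lipschitz_on_real_D:
  fixes f :: "real \<Rightarrow> real"
  shows "L-lipschitz_on UNIV f \<Longrightarrow> \<bar>f x - f y\<bar> \<le> L * \<bar>x - y\<bar>"
  using lipschitz_onD[of L UNIV f x y] by (simp add: dist_real_def)

lemma borel_measurable_lipschitz:
  fixes f :: "real \<Rightarrow> real"
  shows "L-lipschitz_on UNIV f \<Longrightarrow> f \<in> borel_measurable borel"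
  by (intro borel_measurable_continuous_onI lipschitz_on_continuous_on)

lemma lipschitz_linear_growth:
  fixes f :: "real \<Rightarrow> real"
  shows "L-lipschitz_on UNIV f \<Longrightarrow> \<bar>f x\<bar> \<le> \<bar>f 0\<bar> + L * \<bar>x\<bar>"
  using lipschitz_on_real_D[of L f x 0] by simp

lemma (in prob_space) integrable_lipschitz:
  assumes f: "L-lipschitz_on UNIV (f :: real \<Rightarrow> real)" and X: "integrable M X"
  shows "integrable M (\<lambda>w. f (X w))"
proof (rule Bochner_Integration.integrable_bound)
  note [measurable] = borel_measurable_lipschitz[OF f] borel_measurable_integrable[OF X]
  show "integrable M (\<lambda>w. \<bar>f 0\<bar> + L * \<bar>X w\<bar>)" using X by simp
  show "(\<lambda>w. f (X w)) \<in> borel_measurable M" by measurable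
  show "AE w in M. norm (f (X w)) \<le> norm (\<bar>f 0\<bar> + L * \<bar>X w\<bar>)"
  proof (rule AE_I2)
    fix w
    show "norm (f (X w)) \<le> norm (\<bar>f 0\<bar> + L * \<bar>X w\<bar>)"
      using lipschitz_linear_growth[OF f, of "X w"] by simp
  qed
qed

lemma integrable_gauss_lipschitz:
  assumes "L-lipschitz_on UNIV (f :: real \<Rightarrow> real)"
  shows "integrable gauss (\<lambda>z. f (x + s * z))"
  using has_bochner_integral_gauss_quartic[of x s 0 0 0]
  by (intro gauss.integrable_lipschitz[OF assms]) (simp add: has_bochner_integral_iff)

definition heat :: "real \<Rightarrow> (real \<Rightarrow> real) \<Rightarrow> real \<Rightarrow> real" where
  "heat s f x = (\<integral>z. f (x + s * z) \<partial>gauss)"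

lemma heat_zero [simp]: "heat 0 f = f"
  by (rule ext) (simp add: heat_def)

lemma heat_mono:
  assumes "L-lipschitz_on UNIV f" "L'-lipschitz_on UNIV g" "\<And>x. f x \<le> g x"
  shows "heat s f x \<le> heat s g x"
  unfolding heat_def using assms by (intro integral_mono integrable_gauss_lipschitz) auto

lemma heat_lipschitz:
  assumes f: "L-lipschitz_on UNIV f"
  shows "L-lipschitz_on UNIV (heat s f)"
proof (rule lipschitz_onI)
  fix x y
  have "heat s f x - heat s f y = (\<integral>z. f (x + s * z) - f (y + s * z) \<partial>gauss)"
    unfolding heat_def using integrable_gauss_lipschitz[OF f] by simp
  also have "\<bar>\<dots>\<bar> \<le> (\<integral>z. \<bar>f (x + s * z) - f (y + s * z)\<bar> \<partial>gauss)"
    by (rule integral_abs_bound)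
  also have "\<dots> \<le> (\<integral>z. L * \<bar>x - y\<bar> \<partial>gauss)"
    using integrable_gauss_lipschitz[OF f] lipschitz_on_real_D[OF f]
    by (intro integral_mono) (auto, metis add_diff_cancel_right)
  finally show "dist (heat s f x) (heat s f y) \<le> L * dist x y"
    by (simp add: dist_real_def)
qed (use f in \<open>rule lipschitz_on_nonneg\<close>)

text \<open>The polynomial is centred at \<open>x\<close> while the average is taken at
  \<open>x + y\<close>, so the bound is again a polynomial in the displacement \<open>y\<close> and
  can be the hypothesis of the next step.\<close>

lemma heat_ge_quartic:
  assumes f: "L-lipschitz_on UNIV f"
    and le: "\<And>z. a + b * z + c * z\<^sup>2 + d * z ^ 4 \<le> f (x + z)"
  shows "a + b * y + c * (y\<^sup>2 + s\<^sup>2) + d * (y ^ 4 + 6 * s\<^sup>2 * y\<^sup>2 + 3 * s ^ 4) \<le> heat s f (x + y)"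
proof -
  note q = has_bochner_integral_gauss_shifted_quartic[of a b y s c d]
  have "(\<integral>z. a + b * (y + s * z) + c * (y + s * z)\<^sup>2 + d * (y + s * z) ^ 4 \<partial>gauss) \<le> heat s f (x + y)"
    unfolding heat_def
    using q integrable_gauss_lipschitz[OF f, of "x + y" s] le[of "y + s * z" for z]
    by (intro integral_mono) (auto simp: has_bochner_integral_iff algebra_simps)
  then show ?thesis
    using q by (simp add: has_bochner_integral_iff)
qed

lemma heat_le_quartic:
  assumes f: "L-lipschitz_on UNIV f"
    and le: "\<And>z. f (x + z) \<le> a + b * z + c * z\<^sup>2 + d * z ^ 4"
  shows "heat s f x \<le> a + c * s\<^sup>2 + d * (3 * s ^ 4)"
proof -
  \<comment> \<open>The lower bound for \<open>- f\<close>, with all coefficients negated and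
    \<open>y = 0\<close>.\<close>
  have "-a + (-b) * 0 + (-c) * (0\<^sup>2 + s\<^sup>2) + (-d) * (0 ^ 4 + 6 * s\<^sup>2 * 0\<^sup>2 + 3 * s ^ 4) \<le> heat s (\<lambda>y. - f y) (x + 0)"
    using f le by (intro heat_ge_quartic) (auto simp: algebra_simps minus_le_iff)
  then show ?thesis
    by (simp add: heat_def)
qed

lemma (in prob_space) distr_normal_standardized:
  assumes D: "distributed M lborel X (normal_density 0 s)" and "0 < s"
  shows "distr M lborel (\<lambda>w. X w / s) = gauss" and "(\<lambda>w. X w / s) \<in> M \<rightarrow>\<^sub>M lborel"
  using normal_standard_normal_convert[OF \<open>0 < s\<close>, of X 0] D
  by (simp_all add: distributed_def gauss_def)

lemma (in prob_space)
  assumes D: "distributed M lborel X (normal_density 0 s)" and s: "0 < s"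
    and [measurable]: "(f :: real \<Rightarrow> real) \<in> borel_measurable borel"
  shows expectation_normal_increment: "expectation (\<lambda>w. f (x + c * X w)) = heat (c * s) f x"
    and integrable_normal_increment: "integrable M (\<lambda>w. f (X w)) \<longleftrightarrow> integrable gauss (\<lambda>z. f (s * z))"
  using integral_distr[OF distr_normal_standardized(2)[OF D s], of "\<lambda>z. f (x + c * s * z)"]
    integrable_distr_eq[OF distr_normal_standardized(2)[OF D s], of "\<lambda>z. f (s * z)"] s
  by (simp_all add: heat_def distr_normal_standardized(1)[OF D s])

text \<open>Variances of independent normal variables add. The coordinates of the product of two
  copies of \<open>gauss\<close> are such variables, and Fubini turns the mean over the pair into an
  iterated average.\<close>

lemma heat_heat:
  assumes f: "L-lipschitz_on UNIV f" and "0 \<le> s" "0 \<le> t"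
  shows "heat s (heat t f) x = heat (sqrt (s\<^sup>2 + t\<^sup>2)) f x"
proof (cases "s = 0 \<or> t = 0")
  \<comment> \<open>\<open>normal_density 0 0\<close> is not a probability density, so a vanishing
    deviation is treated apart.\<close>
  case True
  then show ?thesis using assms by auto
next
  case False
  then have pos: "0 < s" "0 < t" using assms by auto
  have [measurable]: "f \<in> borel_measurable borel"
    using f by (rule borel_measurable_lipschitz)
  let ?P = "gauss \<Otimes>\<^sub>M gauss"
  interpret Q: pair_prob_space gauss gauss ..
  have dfst: "distr ?P borel fst = gauss"
    using gauss.distr_pair_fst[of gauss] by (simp cong: distr_cong)
  have dsnd: "distr ?P borel snd = gauss"
  proof (rule measure_eqI)
    fix A assume "A \<in> sets (distr ?P borel snd)"
    then have "A \<in> sets gauss" by simp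
    have "emeasure (distr ?P borel snd) A = emeasure ?P (UNIV \<times> A)"
      using \<open>A \<in> sets gauss\<close>
      by (subst emeasure_distr) (auto simp: space_pair_measure intro!: arg_cong2[where f = emeasure])
    also have "\<dots> = emeasure gauss UNIV * emeasure gauss A"
      using \<open>A \<in> sets gauss\<close> by (intro gauss.emeasure_pair_measure_Times) auto
    finally show "emeasure (distr ?P borel snd) A = emeasure gauss A"
      using gauss.emeasure_space_1 by simp
  qed simp
  have "distr ?P (borel \<Otimes>\<^sub>M borel) (\<lambda>p. (fst p, snd p)) = ?P"
    using distr_id2[OF sets_pair_measure_cong[OF sets_gauss[symmetric] sets_gauss[symmetric]]] by simp
  then have "Q.P.indep_var borel fst borel snd"
    unfolding Q.P.indep_var_distribution_eq dfst dsnd by simp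
  then have "Q.P.indep_var borel (\<lambda>p. s * fst p) borel (\<lambda>p. t * snd p)"
    using Q.P.indep_var_compose[of borel fst borel snd "\<lambda>x. s * x" borel "\<lambda>x. t * x" borel]
    by (simp add: comp_def)
  moreover have "distributed ?P lborel fst std_normal_density" "distributed ?P lborel snd std_normal_density"
    using dfst dsnd distr_cong[OF refl sets_lborel refl, of ?P fst] distr_cong[OF refl sets_lborel refl, of ?P snd]
    by (simp_all add: distributed_def gauss_def[symmetric])
  then have "distributed ?P lborel (\<lambda>p. s * fst p) (normal_density 0 s)"
      "distributed ?P lborel (\<lambda>p. t * snd p) (normal_density 0 t)"
    using Q.P.normal_density_affine[of fst 0 1 s 0] Q.P.normal_density_affine[of snd 0 1 t 0] pos by auto
  ultimately have "distributed ?P lborel (\<lambda>p. s * fst p + t * snd p) (normal_density 0 (sqrt (s\<^sup>2 + t\<^sup>2)))"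
    using Q.P.add_indep_normal[of "\<lambda>p. s * fst p" "\<lambda>p. t * snd p" s t 0 0] pos by simp
  from Q.P.expectation_normal_increment[OF this _ \<open>f \<in> borel_measurable borel\<close>, of x 1] pos
  have "heat (sqrt (s\<^sup>2 + t\<^sup>2)) f x = (\<integral>p. f (x + (s * fst p + t * snd p)) \<partial>?P)"
    by (simp add: add_pos_pos)
  also have "\<dots> = (\<integral>z. \<integral>w. f (x + (s * z + t * w)) \<partial>gauss \<partial>gauss)"
  proof -
    have "integrable ?P fst" "integrable ?P snd"
      using has_bochner_integral_gauss_quartic[of 0 1 0 0 0] dfst dsnd
        integrable_distr[of fst ?P borel "\<lambda>z. z"] integrable_distr[of snd ?P borel "\<lambda>z. z"]
      by (auto simp: has_bochner_integral_iff)
    then have "integrable ?P (\<lambda>p. f (x + (s * fst p + t * snd p)))"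
      by (intro Q.P.integrable_lipschitz[OF f]) simp
    from Q.integral_fst'[OF this] show ?thesis by simp
  qed
  finally show ?thesis
    by (simp add: heat_def add.assoc)
qed

text \<open>Joint measurability matters because later both the starting point and the volatility are
  random.\<close>

lemma heat_measurable [measurable]:
  assumes [measurable]: "f \<in> borel_measurable borel"
  shows "(\<lambda>p. heat (snd p * c) f (fst p)) \<in> borel_measurable (borel \<Otimes>\<^sub>M borel)"
  unfolding heat_def by (intro gauss.borel_measurable_lebesgue_integral) measurable

section \<open>Mean-square distance and convergence\<close>

abbreviation sq_dist :: "'a measure \<Rightarrow> ('a \<Rightarrow> real) \<Rightarrow> ('a \<Rightarrow> real) \<Rightarrow> ennreal" where
  "sq_dist M f g \<equiv> \<integral>\<^sup>+w. ennreal ((f w - g w)\<^sup>2) \<partial>M"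

lemma nn_integral_square_triangle:
  fixes f g h :: "'b \<Rightarrow> real"
  assumes [measurable]: "f \<in> borel_measurable K" "g \<in> borel_measurable K" "h \<in> borel_measurable K"
    and "A \<in> sets K"
  shows "(\<integral>\<^sup>+x\<in>A. ennreal ((f x - h x)\<^sup>2) \<partial>K) \<le> 2 * (\<integral>\<^sup>+x\<in>A. ennreal ((f x - g x)\<^sup>2) \<partial>K) + 2 * (\<integral>\<^sup>+x\<in>A. ennreal ((g x - h x)\<^sup>2) \<partial>K)"
proof -
  have [measurable]: "A \<in> sets K" by fact
  have le: "ennreal ((a - c)\<^sup>2) \<le> 2 * ennreal ((a - b)\<^sup>2) + 2 * ennreal ((b - c)\<^sup>2)" for a b c :: real
  proof -
    have "0 \<le> ((a - b) - (b - c))\<^sup>2" by simp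
    then have "(a - c)\<^sup>2 \<le> 2 * (a - b)\<^sup>2 + 2 * (b - c)\<^sup>2" by (simp add: power2_eq_square algebra_simps)
    then have "ennreal ((a - c)\<^sup>2) \<le> ennreal (2 * (a - b)\<^sup>2 + 2 * (b - c)\<^sup>2)" by (rule ennreal_leI)
    then show ?thesis by (simp add: ennreal_mult)
  qed
  have "(\<integral>\<^sup>+x\<in>A. ennreal ((f x - h x)\<^sup>2) \<partial>K) \<le>
      (\<integral>\<^sup>+x. 2 * (ennreal ((f x - g x)\<^sup>2) * indicator A x) + 2 * (ennreal ((g x - h x)\<^sup>2) * indicator A x) \<partial>K)"
    using le by (intro nn_integral_mono) (auto split: split_indicator)
  then show ?thesis by (simp add: nn_integral_add nn_integral_cmult)
qed

text \<open>A pointwise replacement of Cauchy-Schwarz: integrate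
  \<open>\<bar>x\<bar> \<le> \<delta> + x\<^sup>2 / \<delta>\<close>, at the price of the factor
  2.\<close>

lemma (in prob_space) L1_le_of_L2_le:
  assumes [measurable]: "d \<in> borel_measurable M" and "0 < \<delta>"
    and le: "(\<integral>\<^sup>+w. ennreal ((d w)\<^sup>2) \<partial>M) \<le> ennreal (\<delta>\<^sup>2)"
  shows "(\<integral>\<^sup>+w. ennreal \<bar>d w\<bar> \<partial>M) \<le> ennreal (2 * \<delta>)" (is ?nn)
    and "integrable M d" and "(\<integral>w. \<bar>d w\<bar> \<partial>M) \<le> 2 * \<delta>"
proof -
  have "\<bar>x\<bar> \<le> \<delta> + x\<^sup>2 / \<delta>" for x :: real
  proof -
    have "0 \<le> (\<bar>x\<bar> - \<delta>)\<^sup>2 + \<delta> * \<bar>x\<bar>" using \<open>0 < \<delta>\<close> by simp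
    then have "\<delta> * \<bar>x\<bar> \<le> \<delta>\<^sup>2 + x\<^sup>2" by (simp add: power2_eq_square algebra_simps)
    then show ?thesis using \<open>0 < \<delta>\<close> by (simp add: field_simps power2_eq_square)
  qed
  then have "(\<integral>\<^sup>+w. ennreal \<bar>d w\<bar> \<partial>M) \<le> (\<integral>\<^sup>+w. ennreal \<delta> + ennreal (1 / \<delta>) * ennreal ((d w)\<^sup>2) \<partial>M)"
    using \<open>0 < \<delta>\<close>
    by (intro nn_integral_mono) (simp add: ennreal_mult[symmetric] ennreal_plus[symmetric] ennreal_leI del: ennreal_plus)
  also have "\<dots> = ennreal \<delta> + ennreal (1 / \<delta>) * (\<integral>\<^sup>+w. ennreal ((d w)\<^sup>2) \<partial>M)"
    by (subst nn_integral_add) (auto simp: nn_integral_cmult emeasure_space_1)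
  also have "\<dots> \<le> ennreal \<delta> + ennreal (1 / \<delta>) * ennreal (\<delta>\<^sup>2)"
    using le by (intro add_left_mono mult_left_mono) auto
  also have "\<dots> = ennreal (2 * \<delta>)"
    using \<open>0 < \<delta>\<close> by (simp add: ennreal_mult[symmetric] ennreal_plus[symmetric] power2_eq_square del: ennreal_plus)
  finally show nn: ?nn .
  show i: "integrable M d"
    using nn by (intro integrableI_bounded) (auto simp: order.strict_trans1[OF _ ennreal_less_top])
  have "ennreal (\<integral>w. \<bar>d w\<bar> \<partial>M) \<le> ennreal (2 * \<delta>)"
    using nn i by (subst nn_integral_eq_integral[symmetric]) auto
  then show "(\<integral>w. \<bar>d w\<bar> \<partial>M) \<le> 2 * \<delta>"
    using \<open>0 < \<delta>\<close> by (simp add: ennreal_le_iff)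
qed

text \<open>Riesz-Fischer for a geometric rate: the L1 norms of the increments are summable, so the
  whole sequence converges almost surely, and Fatou's lemma carries the mean-square bounds over to
  the limit.\<close>

lemma (in prob_space) L2_limit_of_fast_Cauchy:
  fixes Y :: "nat \<Rightarrow> 'a \<Rightarrow> real"
  assumes Y [measurable]: "\<And>k. Y k \<in> borel_measurable M" and "0 < C"
    and cauchy: "\<And>k m. k \<le> m \<Longrightarrow> sq_dist M (Y m) (Y k) \<le> ennreal ((C * (1 / 2) ^ k)\<^sup>2)"
  shows "\<exists>I\<in>borel_measurable M. (\<lambda>k. sq_dist M I (Y k)) \<longlonglongrightarrow> 0"
proof -
  let ?d = "\<lambda>k w. Y (Suc k) w - Y k w"
  have step: "(\<integral>\<^sup>+w. ennreal \<bar>?d k w\<bar> \<partial>M) \<le> ennreal (2 * (C * (1 / 2) ^ k))" for k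
    using \<open>0 < C\<close> cauchy[of k "Suc k"] by (intro L1_le_of_L2_le(1)) auto
  have "(\<integral>\<^sup>+w. (\<Sum>k. ennreal \<bar>?d k w\<bar>) \<partial>M) = (\<Sum>k. \<integral>\<^sup>+w. ennreal \<bar>?d k w\<bar> \<partial>M)"
    by (intro nn_integral_suminf) measurable
  also have "\<dots> \<le> (\<Sum>k. ennreal (2 * (C * (1 / 2) ^ k)))"
    using step by (intro suminf_le) auto
  also have "\<dots> = ennreal (\<Sum>k. 2 * (C * (1 / 2) ^ k))"
    using \<open>0 < C\<close> by (intro suminf_ennreal_eq sums_ennreal[THEN iffD2] summable_sums summable_mult summable_geometric) auto
  finally have "(\<integral>\<^sup>+w. (\<Sum>k. ennreal \<bar>?d k w\<bar>) \<partial>M) \<noteq> \<infinity>"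
    by (auto simp: top_unique)
  then have fin: "AE w in M. (\<Sum>k. ennreal \<bar>?d k w\<bar>) \<noteq> \<infinity>"
    by (intro nn_integral_PInf_AE) auto
  \<comment> \<open>Where the sequence diverges, on a null set, \<open>lim\<close> is an unspecified
    value; \<open>I\<close> is measurable all the same.\<close>
  define I where "I w = lim (\<lambda>k. Y k w)" for w
  have I [measurable]: "I \<in> borel_measurable M"
    unfolding I_def by measurable
  have lim: "AE w in M. (\<lambda>k. Y k w) \<longlonglongrightarrow> I w"
    using fin
  proof eventually_elim
    case (elim w)
    then have "summable (\<lambda>k. \<bar>?d k w\<bar>)"
      by (intro summable_suminf_not_top) auto
    then have "summable (\<lambda>k. ?d k w)"
      by (rule summable_rabs_cancel)
    then have "convergent (\<lambda>n. \<Sum>k<n. ?d k w)"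
      by (simp add: summable_iff_convergent)
    then have "convergent (\<lambda>n. Y n w - Y 0 w)"
      by (simp add: sum_lessThan_telescope[of "\<lambda>k. Y k w"])
    then have "convergent (\<lambda>n. (Y n w - Y 0 w) + Y 0 w)"
      by (intro convergent_add convergent_const)
    then show ?case
      by (simp add: I_def convergent_LIMSEQ_iff)
  qed
  have bound: "sq_dist M I (Y k) \<le> ennreal ((C * (1 / 2) ^ k)\<^sup>2)" for k
  proof -
    have "sq_dist M I (Y k) = (\<integral>\<^sup>+w. liminf (\<lambda>m. ennreal ((Y m w - Y k w)\<^sup>2)) \<partial>M)"
      using lim
    proof (intro nn_integral_cong_AE, eventually_elim)
      case (elim w)
      then have "(\<lambda>m. ennreal ((Y m w - Y k w)\<^sup>2)) \<longlonglongrightarrow> ennreal ((I w - Y k w)\<^sup>2)"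
        by (intro tendsto_ennrealI tendsto_intros)
      then show ?case
        by (intro lim_imp_Liminf[symmetric]) auto
    qed
    also have "\<dots> \<le> liminf (\<lambda>m. sq_dist M (Y m) (Y k))"
      by (intro nn_integral_liminf) measurable
    also have "\<dots> \<le> limsup (\<lambda>m. sq_dist M (Y m) (Y k))"
      by (rule Liminf_le_Limsup) simp
    also have "\<dots> \<le> ennreal ((C * (1 / 2) ^ k)\<^sup>2)"
      using cauchy by (intro Limsup_bounded eventually_sequentiallyI[of k]) auto
    finally show ?thesis .
  qed
  have "(\<lambda>k. ennreal ((C * (1 / 2) ^ k)\<^sup>2)) \<longlonglongrightarrow> ennreal ((C * 0)\<^sup>2)"
    by (intro tendsto_ennrealI tendsto_intros LIMSEQ_realpow_zero) auto
  then have geometric: "(\<lambda>k. ennreal ((C * (1 / 2) ^ k)\<^sup>2)) \<longlonglongrightarrow> 0" by simp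
  have "(\<lambda>k. sq_dist M I (Y k)) \<longlonglongrightarrow> 0"
    by (rule tendsto_sandwich[OF always_eventually[OF allI[OF zero_le]] always_eventually[OF allI[OF bound]] tendsto_const geometric])
  then show ?thesis using I by blast
qed

section \<open>The semigroup generated by the one-step minimisation\<close>

locale volatility_band =
  fixes l u :: real
  assumes l_nonneg: "0 \<le> l" and l_le_u: "l \<le> u"
begin

lemma square_le_upper: "\<sigma> \<in> {l..u} \<Longrightarrow> \<sigma>\<^sup>2 \<le> u\<^sup>2"
  using l_nonneg by (intro power_mono) auto

lemma G_lower_le:
  assumes "\<sigma> \<in> {l..u}"
  shows "G_lower l u c \<le> \<sigma>\<^sup>2 * c / 2"
proof -
  have "bdd_below ((\<lambda>\<sigma>. \<sigma>\<^sup>2 * c) ` {l..u})"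
    by (intro bounded_imp_bdd_below compact_imp_bounded compact_continuous_image continuous_intros) simp
  then have "(INF \<sigma>\<in>{l..u}. \<sigma>\<^sup>2 * c) \<le> \<sigma>\<^sup>2 * c"
    using assms by (rule cINF_lower)
  then show ?thesis by (simp add: G_lower_def)
qed

lemma G_lower_ge:
  assumes "\<And>\<sigma>. \<sigma> \<in> {l..u} \<Longrightarrow> b \<le> \<sigma>\<^sup>2 * c / 2"
  shows "b \<le> G_lower l u c"
proof -
  have "2 * b \<le> (INF \<sigma>\<in>{l..u}. \<sigma>\<^sup>2 * c)"
    using assms l_le_u by (intro cINF_greatest) (auto simp: field_simps)
  then show ?thesis by (simp add: G_lower_def)
qed

definition step :: "real \<Rightarrow> (real \<Rightarrow> real) \<Rightarrow> real \<Rightarrow> real" where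
  "step h f x = (INF \<sigma>\<in>{l..u}. heat (\<sigma> * sqrt h) f x)"

text \<open>Young's inequality \<open>\<bar>z\<bar> \<le> e / 2 + z\<^sup>2 / (2 * e)\<close>. The
  zero coefficients bring the bound into the form of the quartic estimates, and \<open>e\<close>
  stays free to be matched to the time step.\<close>

lemma lipschitz_ge_quadratic:
  assumes f: "L-lipschitz_on UNIV f" and "0 < e"
  shows "f x - L * e / 2 + 0 * z + (- L / (2 * e)) * z\<^sup>2 + 0 * z ^ 4 \<le> f (x + (z::real))"
proof -
  have "\<bar>z\<bar> \<le> e / 2 + z\<^sup>2 / (2 * e)"
  proof -
    have "0 \<le> (\<bar>z\<bar> - e)\<^sup>2" by simp
    then have "2 * e * \<bar>z\<bar> \<le> e\<^sup>2 + z\<^sup>2"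
      by (simp add: power2_eq_square algebra_simps)
    then show ?thesis
      using \<open>0 < e\<close> by (simp add: field_simps power2_eq_square)
  qed
  then have "L * \<bar>z\<bar> \<le> L * (e / 2 + z\<^sup>2 / (2 * e))"
    using lipschitz_on_nonneg[OF f] by (rule mult_left_mono)
  moreover have "f x - f (x + z) \<le> L * \<bar>z\<bar>"
    using lipschitz_on_real_D[OF f, of x "x + z"] by simp
  ultimately show ?thesis
    by (simp add: algebra_simps)
qed

text \<open>The infimum in \<open>step\<close> is one of reals, so it carries information only with
  a lower bound uniform in the volatility. The loss is largest at
  \<open>\<sigma> = u\<close>.\<close>

lemma bdd_below_heat:
  assumes f: "L-lipschitz_on UNIV f"
  shows "bdd_below ((\<lambda>\<sigma>. heat (\<sigma> * sqrt h) f x) ` {l..u})"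
proof (rule bdd_belowI2)
  fix \<sigma> assume \<sigma>: "\<sigma> \<in> {l..u}"
  have "L * (\<sigma> * sqrt h)\<^sup>2 \<le> L * (u * sqrt h)\<^sup>2"
    unfolding power_mult_distrib using square_le_upper[OF \<sigma>] lipschitz_on_nonneg[OF f]
    by (intro mult_left_mono mult_right_mono) auto
  then show "f x - L / 2 - L / 2 * (u * sqrt h)\<^sup>2 \<le> heat (\<sigma> * sqrt h) f x"
    using heat_ge_quartic[OF f lipschitz_ge_quadratic[OF f, of 1 x], where y = 0 and s = "\<sigma> * sqrt h"]
    by simp
qed

lemma step_le_heat:
  assumes "L-lipschitz_on UNIV f" "\<sigma> \<in> {l..u}"
  shows "step h f x \<le> heat (\<sigma> * sqrt h) f x"
  unfolding step_def using bdd_below_heat[OF assms(1)] assms(2) by (rule cINF_lower)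

lemma le_step:
  assumes "\<And>\<sigma>. \<sigma> \<in> {l..u} \<Longrightarrow> c \<le> heat (\<sigma> * sqrt h) f x"
  shows "c \<le> step h f x"
  unfolding step_def using assms l_le_u by (intro cINF_greatest) auto

lemma step_mono:
  assumes "L-lipschitz_on UNIV f" "L'-lipschitz_on UNIV g" "\<And>x. f x \<le> g x"
  shows "step h f x \<le> step h g x"
  using step_le_heat[OF assms(1)] heat_mono[OF assms] by (intro le_step) (meson order.trans)

lemma lipschitz_on_realI:
  fixes f :: "real \<Rightarrow> real"
  assumes "0 \<le> L" and le: "\<And>x y. f x \<le> f y + L * \<bar>x - y\<bar>"
  shows "L-lipschitz_on UNIV f"
proof (rule lipschitz_onI)
  fix x y
  show "dist (f x) (f y) \<le> L * dist x y"
    using le[of x y] le[of y x] by (simp add: dist_real_def abs_minus_commute abs_le_iff)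
qed fact

lemma step_lipschitz:
  assumes f: "L-lipschitz_on UNIV f"
  shows "L-lipschitz_on UNIV (step h f)"
proof (rule lipschitz_on_realI)
  fix x y
  have "step h f x - L * \<bar>x - y\<bar> \<le> step h f y"
  proof (rule le_step)
    fix \<sigma> assume "\<sigma> \<in> {l..u}"
    then have "step h f x \<le> heat (\<sigma> * sqrt h) f x"
      by (rule step_le_heat[OF f])
    then show "step h f x - L * \<bar>x - y\<bar> \<le> heat (\<sigma> * sqrt h) f y"
      using lipschitz_on_real_D[OF heat_lipschitz[OF f], of "\<sigma> * sqrt h" x y] by simp
  qed
  then show "step h f x \<le> step h f y + L * \<bar>x - y\<bar>" by simp
qed (use f in \<open>rule lipschitz_on_nonneg\<close>)

lemma step_step_le:
  assumes f: "L-lipschitz_on UNIV f" and "0 \<le> a" "0 \<le> b"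
  shows "step a (step b f) x \<le> step (a + b) f x"
proof (rule le_step)
  fix \<sigma> assume \<sigma>: "\<sigma> \<in> {l..u}"
  then have "0 \<le> \<sigma>" using l_nonneg by simp
  have "step a (step b f) x \<le> heat (\<sigma> * sqrt a) (step b f) x"
    using step_lipschitz[OF f] \<sigma> by (rule step_le_heat)
  also have "\<dots> \<le> heat (\<sigma> * sqrt a) (heat (\<sigma> * sqrt b) f) x"
    using step_le_heat[OF f \<sigma>] by (intro heat_mono[OF step_lipschitz[OF f] heat_lipschitz[OF f]])
  also have "\<dots> = heat (sqrt ((\<sigma> * sqrt a)\<^sup>2 + (\<sigma> * sqrt b)\<^sup>2)) f x"
    using f \<open>0 \<le> \<sigma>\<close> assms by (intro heat_heat) auto
  also have "(\<sigma> * sqrt a)\<^sup>2 + (\<sigma> * sqrt b)\<^sup>2 = \<sigma>\<^sup>2 * (a + b)"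
    using assms by (simp add: power_mult_distrib algebra_simps)
  also have "sqrt \<dots> = \<sigma> * sqrt (a + b)"
    using \<open>0 \<le> \<sigma>\<close> by (simp add: real_sqrt_mult)
  finally show "step a (step b f) x \<le> heat (\<sigma> * sqrt (a + b)) f x" .
qed

text \<open>A measurable choice made by hand: both sides are Lipschitz in \<open>y\<close>, so a
  near minimiser at the grid point below \<open>y\<close> is still near optimal at \<open>y\<close>.
  The selector is constant on the cells of a countable grid, hence Borel.\<close>

lemma step_selector:
  assumes g: "L-lipschitz_on UNIV g" and "0 < \<delta>"
  obtains sel where "sel \<in> borel_measurable borel" "\<And>y. sel y \<in> {l..u}"
    "\<And>y. heat (sel y * sqrt h) g y \<le> step h g y + \<delta>"
proof -
  have "\<exists>\<sigma>\<in>{l..u}. heat (\<sigma> * sqrt h) g y \<le> step h g y + \<delta> / 2" for y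
    using le_step[of "step h g y + \<delta> / 2" h g y] \<open>0 < \<delta>\<close> by force
  then obtain \<sigma> where \<sigma>: "\<And>y. \<sigma> y \<in> {l..u}" "\<And>y. heat (\<sigma> y * sqrt h) g y \<le> step h g y + \<delta> / 2"
    by metis
  have "0 \<le> L" using g by (rule lipschitz_on_nonneg)
  \<comment> \<open>Moving to the grid point costs at most
    \<open>L * \<rho> \<le> \<delta> / 4\<close> on each side, which together with the slack
    \<open>\<delta> / 2\<close> at the grid points makes \<delta>. The summand 1 covers
    \<open>L = 0\<close>.\<close>
  define \<rho> where "\<rho> = \<delta> / (4 * (L + 1))"
  have "0 < \<rho>" using \<open>0 < \<delta>\<close> \<open>0 \<le> L\<close> by (simp add: \<rho>_def)
  have L\<rho>: "L * \<rho> \<le> \<delta> / 4"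
  proof -
    have "L * \<rho> \<le> (L + 1) * \<rho>" using \<open>0 < \<rho>\<close> by (intro mult_right_mono) auto
    also have "\<dots> = \<delta> / 4" using \<open>0 \<le> L\<close> by (simp add: \<rho>_def field_simps)
    finally show ?thesis .
  qed
  define c where "c y = \<rho> * of_int \<lfloor>y / \<rho>\<rfloor>" for y
  have c: "\<bar>y - c y\<bar> \<le> \<rho>" for y
  proof -
    have "\<rho> * of_int \<lfloor>y / \<rho>\<rfloor> \<le> \<rho> * (y / \<rho>)" "\<rho> * (y / \<rho>) \<le> \<rho> * (of_int \<lfloor>y / \<rho>\<rfloor> + 1)"
      using \<open>0 < \<rho>\<close> by (intro mult_left_mono; linarith)+
    then show ?thesis
      using \<open>0 < \<rho>\<close> by (simp add: c_def distrib_left)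
  qed
  show thesis
  proof (rule that[of "\<lambda>y. \<sigma> (c y)"])
    have "(\<lambda>y. \<lfloor>y / \<rho>\<rfloor>) \<in> borel \<rightarrow>\<^sub>M count_space UNIV" by measurable
    moreover have "(\<lambda>i. \<sigma> (\<rho> * of_int i)) \<in> count_space UNIV \<rightarrow>\<^sub>M borel" by simp
    ultimately show "(\<lambda>y. \<sigma> (c y)) \<in> borel_measurable borel"
      unfolding c_def by (rule measurable_compose)
    show "\<sigma> (c y) \<in> {l..u}" for y by (rule \<sigma>(1))
    fix y
    have "L * \<bar>y - c y\<bar> \<le> \<delta> / 4"
      using mult_left_mono[OF c \<open>0 \<le> L\<close>, of y] L\<rho> by simp
    then show "heat (\<sigma> (c y) * sqrt h) g y \<le> step h g y + \<delta>"
      using \<sigma>(2)[of "c y"] lipschitz_on_real_D[OF heat_lipschitz[OF g], of "\<sigma> (c y) * sqrt h" y "c y"]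
        lipschitz_on_real_D[OF step_lipschitz[OF g], of h y "c y"]
      by linarith
  qed
qed

text \<open>The head of the list is the first interval in time and its operator is outermost, since
  the terminal function is propagated backwards.\<close>

definition steps :: "real list \<Rightarrow> (real \<Rightarrow> real) \<Rightarrow> real \<Rightarrow> real" where
  "steps hs f = foldr step hs f"

lemma steps_simps [simp]:
  "steps [] f = f" "steps (h # hs) f = step h (steps hs f)" "steps (hs @ ks) f = steps hs (steps ks f)"
  by (simp_all add: steps_def)

lemma steps_lipschitz: "L-lipschitz_on UNIV f \<Longrightarrow> L-lipschitz_on UNIV (steps hs f)"
  by (induction hs) (auto intro: step_lipschitz)

lemma steps_mono:
  assumes "L-lipschitz_on UNIV f" "L'-lipschitz_on UNIV g" "\<And>x. f x \<le> g x"
  shows "steps hs f x \<le> steps hs g x"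
  using assms by (induction hs arbitrary: x) (auto intro!: step_mono steps_lipschitz)

text \<open>The error terms are those of the fourth moment of the martingale with maximal volatility,
  which makes the bound stable under composition.\<close>

lemma steps_ge_quartic:
  assumes f: "L-lipschitz_on UNIV f" and "0 \<le> K" and "\<forall>h\<in>set hs. 0 < h"
    and le: "\<And>z. a + b * z + c * z\<^sup>2 + (- K) * z ^ 4 \<le> f (x + z)"
  shows "a + b * z + c * z\<^sup>2 + sum_list hs * G_lower l u (2 * c)
      - K * (z ^ 4 + 6 * u\<^sup>2 * sum_list hs * z\<^sup>2 + 3 * u ^ 4 * (sum_list hs)\<^sup>2) \<le> steps hs f (x + z)"
  using assms(3)
proof (induction hs arbitrary: z)
  case Nil
  then show ?case using le[of z] by simp
next
  case (Cons h hs)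
  let ?s = "sum_list hs" and ?G = "G_lower l u (2 * c)"
  have h: "0 < h" and "0 \<le> ?s"
    using Cons.prems by (auto intro: sum_list_nonneg less_imp_le)
  have IH: "(a + ?s * ?G - K * (3 * u ^ 4 * ?s\<^sup>2)) + b * w + (c - K * (6 * u\<^sup>2 * ?s)) * w\<^sup>2 + (- K) * w ^ 4
      \<le> steps hs f (x + w)" for w
    using Cons.IH[of w] Cons.prems by (simp add: algebra_simps)
  have "a + b * z + c * z\<^sup>2 + (h + ?s) * ?G
      - K * (z ^ 4 + 6 * u\<^sup>2 * (h + ?s) * z\<^sup>2 + 3 * u ^ 4 * (h + ?s)\<^sup>2) \<le> step h (steps hs f) (x + z)"
  proof (rule le_step)
    fix \<sigma> assume \<sigma>: "\<sigma> \<in> {l..u}"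
    define U S where "U = u\<^sup>2" and "S = \<sigma>\<^sup>2"
    have "0 \<le> S" "S \<le> U" "0 \<le> U" using square_le_upper[OF \<sigma>] by (auto simp: U_def S_def)
    have u4: "u ^ 4 = U\<^sup>2" by (simp add: U_def)
    have s2: "(\<sigma> * sqrt h)\<^sup>2 = S * h" and s4: "(\<sigma> * sqrt h) ^ 4 = S\<^sup>2 * h\<^sup>2"
      using h by (simp_all add: S_def power_mult_distrib power4_eq_xxxx power2_eq_square)
    \<comment> \<open>Four sources of slack: \<open>G_lower\<close> is an infimum over volatilities,
      and the variance \<open>S\<close> is at most \<open>U\<close> in the second-moment, the
      fourth-moment and the mixed term.\<close>
    have d: "0 \<le> h * (c * S - ?G)" "0 \<le> K * (6 * (U - S) * h * z\<^sup>2)" "0 \<le> K * (3 * (U\<^sup>2 - S\<^sup>2) * h\<^sup>2)"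
        "0 \<le> K * (6 * ?s * h * U * (U - S))"
      using G_lower_le[OF \<sigma>, of "2 * c"] \<open>0 \<le> S\<close> \<open>0 \<le> U\<close> \<open>S \<le> U\<close> h \<open>0 \<le> ?s\<close> \<open>0 \<le> K\<close> power_mono[of S U 2]
      by (auto intro!: mult_nonneg_nonneg simp: S_def mult.commute)
    \<comment> \<open>The single-step value exceeds the claimed bound by exactly these four terms;
      the last one comes from the cross term of \<open>(h + s)\<^sup>2\<close>.\<close>
    have identity: "(a + s * G - K * (3 * U\<^sup>2 * s\<^sup>2)) + b * z + (c - K * (6 * U * s)) * (z\<^sup>2 + S * h)
        + (- K) * (z ^ 4 + 6 * (S * h) * z\<^sup>2 + 3 * (S\<^sup>2 * h\<^sup>2)) =
        (a + b * z + c * z\<^sup>2 + (h + s) * G - K * (z ^ 4 + 6 * U * (h + s) * z\<^sup>2 + 3 * U\<^sup>2 * (h + s)\<^sup>2)) +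
        (h * (c * S - G) + K * (6 * (U - S) * h * z\<^sup>2) + K * (3 * (U\<^sup>2 - S\<^sup>2) * h\<^sup>2) + K * (6 * s * h * U * (U - S)))" for s G
      by (simp add: power2_eq_square algebra_simps)
    have "a + b * z + c * z\<^sup>2 + (h + ?s) * ?G - K * (z ^ 4 + 6 * U * (h + ?s) * z\<^sup>2 + 3 * U\<^sup>2 * (h + ?s)\<^sup>2) \<le>
        (a + ?s * ?G - K * (3 * U\<^sup>2 * ?s\<^sup>2)) + b * z + (c - K * (6 * U * ?s)) * (z\<^sup>2 + S * h)
        + (- K) * (z ^ 4 + 6 * (S * h) * z\<^sup>2 + 3 * (S\<^sup>2 * h\<^sup>2))"
      unfolding identity using add_nonneg_nonneg[OF add_nonneg_nonneg[OF add_nonneg_nonneg[OF d(1,2)] d(3)] d(4)]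
      by (rule add_increasing2) (rule order_refl)
    also have "\<dots> \<le> heat (\<sigma> * sqrt h) (steps hs f) (x + z)"
      using heat_ge_quartic[OF steps_lipschitz[OF f] IH, of z "\<sigma> * sqrt h"] unfolding s2 s4 u4 U_def[symmetric] .
    finally show "a + b * z + c * z\<^sup>2 + (h + ?s) * ?G
      - K * (z ^ 4 + 6 * u\<^sup>2 * (h + ?s) * z\<^sup>2 + 3 * u ^ 4 * (h + ?s)\<^sup>2) \<le> heat (\<sigma> * sqrt h) (steps hs f) (x + z)"
      unfolding u4 U_def[symmetric] .
  qed
  then show ?case by simp
qed

section \<open>Partitions and refinement\<close>

definition partitions :: "real \<Rightarrow> real list set" where
  "partitions \<tau> = {hs. (\<forall>h\<in>set hs. 0 < h) \<and> sum_list hs = \<tau>}"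

lemma partitions_Nil_iff [simp]: "[] \<in> partitions \<tau> \<longleftrightarrow> \<tau> = 0"
  by (auto simp: partitions_def)

text \<open>Listing interval lengths instead of break points makes the tail of a partition a
  partition of the remaining time; this drives the inductions on partitions.\<close>

lemma partitions_Cons_iff [simp]: "h # hs \<in> partitions \<tau> \<longleftrightarrow> 0 < h \<and> hs \<in> partitions (\<tau> - h)"
  by (auto simp: partitions_def)

lemma partitions_nonneg: "hs \<in> partitions \<tau> \<Longrightarrow> 0 \<le> \<tau>"
  unfolding partitions_def using sum_list_nonneg[of hs] by (auto simp: less_imp_le)

lemma partitions_zero [simp]: "partitions 0 = {[]}"
proof -
  have "hs = []" if "hs \<in> partitions 0" for hs
    using that partitions_nonneg[of "tl hs" "- hd hs"] by (cases hs) auto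
  then show ?thesis by auto
qed

lemma partitions_nonempty: "0 \<le> \<tau> \<Longrightarrow> partitions \<tau> \<noteq> {}"
proof (cases "\<tau> = 0")
  case False
  then show "0 \<le> \<tau> \<Longrightarrow> partitions \<tau> \<noteq> {}" by (auto intro: exI[of _ "[\<tau>]"] simp: ex_in_conv[symmetric])
qed simp

text \<open>Refinement is read off from the operators: smaller values for every Lipschitz function
  are what an infimum over partitions sees. Instances come from splitting intervals.\<close>

definition finer :: "real list \<Rightarrow> real list \<Rightarrow> bool" where
  "finer rs hs \<longleftrightarrow> (\<forall>f L x. L-lipschitz_on UNIV f \<longrightarrow> steps rs f x \<le> steps hs f x)"

lemma finer_refl [simp]: "finer hs hs"
  by (simp add: finer_def)

lemma finer_trans: "finer rs hs \<Longrightarrow> finer hs ks \<Longrightarrow> finer rs ks"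
  unfolding finer_def by (meson order.trans)

lemma finer_Cons: "finer rs hs \<Longrightarrow> finer (h # rs) (h # hs)"
  unfolding finer_def by (auto intro!: step_mono steps_lipschitz)

lemma finer_split: "0 < a \<Longrightarrow> a < b \<Longrightarrow> finer (a # (b - a) # hs) (b # hs)"
  unfolding finer_def using step_step_le[OF steps_lipschitz, of _ _ a "b - a" hs] by auto

text \<open>Merge the partitions: the shorter of the two first intervals is taken off both lists,
  and what remains of the longer one is put back. The total number of intervals drops each
  time.\<close>

lemma common_refinement:
  assumes "hs \<in> partitions \<tau>" "ks \<in> partitions \<tau>"
  shows "\<exists>rs\<in>partitions \<tau>. finer rs hs \<and> finer rs ks"
  using assms
proof (induction "length hs + length ks" arbitrary: hs ks \<tau> rule: less_induct)
  case less
  have ordered: "\<exists>rs\<in>partitions \<tau>. finer rs (a # hs') \<and> finer rs (b # ks')"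
    if IH: "\<And>hs ks \<tau>. length hs + length ks < length (a # hs') + length (b # ks') \<Longrightarrow> hs \<in> partitions \<tau> \<Longrightarrow>
          ks \<in> partitions \<tau> \<Longrightarrow> \<exists>rs\<in>partitions \<tau>. finer rs hs \<and> finer rs ks"
      and a: "a # hs' \<in> partitions \<tau>" and b: "b # ks' \<in> partitions \<tau>" and "a \<le> b" for a b hs' ks'
  proof (cases "a = b")
    case True
    then obtain rs where "rs \<in> partitions (\<tau> - a)" "finer rs hs'" "finer rs ks'"
      using IH[of hs' ks' "\<tau> - a"] a b by auto
    then show ?thesis
      using True a by (intro bexI[of _ "a # rs"]) (auto intro: finer_Cons)
  next
    case False
    with \<open>a \<le> b\<close> have "a < b" by simp
    then obtain rs where "rs \<in> partitions (\<tau> - a)" "finer rs hs'" "finer rs ((b - a) # ks')"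
      using IH[of hs' "(b - a) # ks'" "\<tau> - a"] a b by auto
    then show ?thesis
      using a \<open>a < b\<close> by (intro bexI[of _ "a # rs"]) (auto intro: finer_Cons finer_trans finer_split)
  qed
  show ?case
  proof (cases "hs = [] \<or> ks = []")
    case True
    then have "\<tau> = 0" using less.prems by auto
    then show ?thesis using less.prems by simp
  next
    case False
    then obtain a hs' b ks' where [simp]: "hs = a # hs'" "ks = b # ks'"
      by (auto simp: neq_Nil_conv)
    show ?thesis
      using ordered[of a hs' b ks'] ordered[of b ks' a hs'] less by (cases "a \<le> b") (auto simp: add.commute)
  qed
qed

text \<open>The interval of \<open>ks\<close> that straddles time \<open>h\<close> is cut there,
  which only lowers the value. Hence a break point at \<open>h\<close> can be forced when bounding
  \<open>steps\<close> from below.\<close>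

lemma split_partition:
  assumes "ks \<in> partitions (h + \<tau>)" "0 \<le> h" "0 \<le> \<tau>"
  shows "\<exists>hs\<in>partitions h. \<exists>rs\<in>partitions \<tau>. finer (hs @ rs) ks"
  using assms
proof (induction ks arbitrary: h)
  case Nil
  then have "h = 0" "\<tau> = 0" by auto
  then show ?case by simp
next
  case (Cons b ks)
  consider "h = 0" | "b \<le> h" "0 < h" | "0 < h" "h < b" using Cons.prems by linarith
  then show ?case
  proof cases
    case 1
    then show ?thesis using Cons.prems by (auto intro!: bexI[of _ "b # ks"])
  next
    case 2
    then obtain hs rs where "hs \<in> partitions (h - b)" "rs \<in> partitions \<tau>" "finer (hs @ rs) ks"
      using Cons.IH[of "h - b"] Cons.prems by (auto simp: algebra_simps)
    then show ?thesis
      using Cons.prems by (intro bexI[of _ "b # hs"] bexI[of _ rs]) (auto intro: finer_Cons)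
  next
    case 3
    then show ?thesis
      using Cons.prems finer_split[of h b ks]
      by (intro bexI[of _ "[h]"] bexI[of _ "(b - h) # ks"]) (auto simp: algebra_simps)
  qed
qed

section \<open>The Nisio semigroup\<close>

definition nisio :: "(real \<Rightarrow> real) \<Rightarrow> real \<Rightarrow> real \<Rightarrow> real" where
  "nisio f \<tau> x = (INF hs\<in>partitions \<tau>. steps hs f x)"

text \<open>The left side sees the partition only through its total length \<tau>, so the infimum in
  \<open>nisio\<close> is over a set that is bounded below.\<close>

lemma steps_ge_partition:
  assumes f: "L-lipschitz_on UNIV f" and "hs \<in> partitions \<tau>" and "0 < e"
  shows "f x - L * e / 2 + \<tau> * G_lower l u (- L / e) \<le> steps hs f x"
  using steps_ge_quartic[OF f _ _ , where K = 0 and z = 0 and x = x, simplified]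
    lipschitz_ge_quadratic[OF f \<open>0 < e\<close>, of x] assms(2)
    steps_ge_quartic[OF f, of 0 hs "f x - L * e / 2" 0 "- L / (2 * e)" x 0]
  by (simp add: partitions_def)

lemma nisio_le:
  assumes f: "L-lipschitz_on UNIV f" and "hs \<in> partitions \<tau>"
  shows "nisio f \<tau> x \<le> steps hs f x"
  unfolding nisio_def using steps_ge_partition[OF f _ zero_less_one] assms(2)
  by (intro cINF_lower bdd_belowI2)

lemma le_nisio:
  assumes "0 \<le> \<tau>" "\<And>hs. hs \<in> partitions \<tau> \<Longrightarrow> c \<le> steps hs f x"
  shows "c \<le> nisio f \<tau> x"
  unfolding nisio_def using assms partitions_nonempty by (intro cINF_greatest)

lemma nisio_zero [simp]: "nisio f 0 = f"
  by (rule ext) (simp add: nisio_def)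

lemma nisio_lipschitz:
  assumes f: "L-lipschitz_on UNIV f" and "0 \<le> \<tau>"
  shows "L-lipschitz_on UNIV (nisio f \<tau>)"
proof (rule lipschitz_on_realI)
  fix x y
  have "nisio f \<tau> x - L * \<bar>x - y\<bar> \<le> nisio f \<tau> y"
    using \<open>0 \<le> \<tau>\<close>
  proof (rule le_nisio)
    fix hs assume "hs \<in> partitions \<tau>"
    then have "nisio f \<tau> x \<le> steps hs f x" by (rule nisio_le[OF f])
    then show "nisio f \<tau> x - L * \<bar>x - y\<bar> \<le> steps hs f y"
      using lipschitz_on_real_D[OF steps_lipschitz[OF f], of hs x y] by simp
  qed
  then show "nisio f \<tau> x \<le> nisio f \<tau> y + L * \<bar>x - y\<bar>" by simp
qed (use f in \<open>rule lipschitz_on_nonneg\<close>)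

text \<open>Partitions are directed: a common refinement is nearly optimal wherever one of the
  refined partitions is.\<close>

lemma nisio_approx_finite:
  assumes f: "L-lipschitz_on UNIV f" and "0 \<le> \<tau>" "finite X" "0 < e"
  shows "\<exists>hs\<in>partitions \<tau>. \<forall>x\<in>X. steps hs f x \<le> nisio f \<tau> x + e"
  using \<open>finite X\<close>
proof (induction X rule: finite_induct)
  case empty
  then show ?case using partitions_nonempty[OF \<open>0 \<le> \<tau>\<close>] by auto
next
  case (insert x X)
  then obtain hs where hs: "hs \<in> partitions \<tau>" "\<forall>x\<in>X. steps hs f x \<le> nisio f \<tau> x + e" by auto
  obtain ks where ks: "ks \<in> partitions \<tau>" "steps ks f x \<le> nisio f \<tau> x + e"
    using le_nisio[OF \<open>0 \<le> \<tau>\<close>, of "nisio f \<tau> x + e" f x] \<open>0 < e\<close> by force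
  obtain rs where "rs \<in> partitions \<tau>" "finer rs hs" "finer rs ks"
    using common_refinement[OF hs(1) ks(1)] by auto
  with hs ks f show ?case
    unfolding finer_def by (intro bexI[of _ rs]) (auto, (meson order.trans)+)
qed

text \<open>The \<open>n\<close>-th partition is nearly optimal at \<open>0\<close> and at
  \<open>q 0, ..., q n\<close>, where \<open>q\<close> enumerates the rationals; the common
  Lipschitz constant carries the convergence to all points. The point \<open>0\<close> yields the
  linear bound, uniform in \<open>n\<close>, for dominated convergence.\<close>

lemma nisio_approx_sequence:
  assumes f: "L-lipschitz_on UNIV f" and "0 \<le> \<tau>"
  obtains hs where "\<And>n. hs n \<in> partitions \<tau>"
    and "\<And>x. (\<lambda>n. steps (hs n) f x) \<longlonglongrightarrow> nisio f \<tau> x"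
    and "\<And>n x. \<bar>steps (hs n) f x\<bar> \<le> \<bar>nisio f \<tau> 0\<bar> + 1 + L * \<bar>x\<bar>"
proof -
  note L = lipschitz_on_nonneg[OF f]
  define q :: "nat \<Rightarrow> real" where "q n = of_rat (from_nat n)" for n
  have "\<exists>hs\<in>partitions \<tau>. \<forall>x\<in>insert 0 (q ` {..n}). steps hs f x \<le> nisio f \<tau> x + 1 / Suc n" for n
    using f \<open>0 \<le> \<tau>\<close> by (intro nisio_approx_finite) auto
  then obtain hs where hs: "\<And>n. hs n \<in> partitions \<tau>"
    and le: "\<And>n x. x \<in> insert 0 (q ` {..n}) \<Longrightarrow> steps (hs n) f x \<le> nisio f \<tau> x + 1 / Suc n"
    by metis
  have close: "\<bar>steps (hs n) f x - steps (hs n) f y\<bar> \<le> L * \<bar>x - y\<bar>" "\<bar>nisio f \<tau> x - nisio f \<tau> y\<bar> \<le> L * \<bar>x - y\<bar>" for n x y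
    using steps_lipschitz[OF f] nisio_lipschitz[OF f \<open>0 \<le> \<tau>\<close>] by (auto intro: lipschitz_on_real_D)
  have ge: "nisio f \<tau> x \<le> steps (hs n) f x" for n x
    using nisio_le[OF f hs] .
  show thesis
  proof (rule that[OF hs])
    fix x
    show "(\<lambda>n. steps (hs n) f x) \<longlonglongrightarrow> nisio f \<tau> x"
    proof (rule LIMSEQ_I)
      fix e :: real assume "0 < e"
      define d where "d = e / (4 * (L + 1))"
      have "0 < d" using \<open>0 < e\<close> L by (simp add: d_def)
      then obtain r where r: "r \<in> \<rat>" "x < r" "r < x + d"
        using Rats_dense_in_real[of x "x + d"] by auto
      then obtain p where "r = of_rat p" by (auto elim: Rats_cases)
      then have "q (to_nat p) = r" by (simp add: q_def)
      then obtain m where m: "q m = r" by auto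
      have "L * \<bar>x - r\<bar> \<le> (L + 1) * d"
        using r L by (intro mult_mono) auto
      also have "\<dots> = e / 4" using L by (simp add: d_def field_simps)
      finally have Lr: "L * \<bar>x - r\<bar> \<le> e / 4" .
      obtain N where N: "1 / real (Suc N) < e / 4"
        using nat_approx_posE[of "e / 4"] \<open>0 < e\<close> by auto
      show "\<exists>N. \<forall>n\<ge>N. norm (steps (hs n) f x - nisio f \<tau> x) < e"
      proof (intro exI allI impI)
        fix n assume n: "max m N \<le> n"
        then have "steps (hs n) f r \<le> nisio f \<tau> r + 1 / Suc n"
          using m by (intro le) auto
        moreover have "1 / real (Suc n) \<le> 1 / real (Suc N)"
          using n by (intro divide_left_mono) auto
        ultimately have "steps (hs n) f x - nisio f \<tau> x < e"
          using close(1)[of n x r] close(2)[of x r] Lr N \<open>0 < e\<close> by linarith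
        then show "norm (steps (hs n) f x - nisio f \<tau> x) < e"
          using ge[of x n] by simp
      qed
    qed
  next
    fix n x
    have "1 / real (Suc n) \<le> 1" by simp
    then have "steps (hs n) f 0 \<le> nisio f \<tau> 0 + 1"
      using le[of 0 n] by (metis add_left_mono insertI1 order.trans)
    then show "\<bar>steps (hs n) f x\<bar> \<le> \<bar>nisio f \<tau> 0\<bar> + 1 + L * \<bar>x\<bar>"
      using ge[of 0 n] close(1)[of n x 0] by simp
  qed
qed

text \<open>One half of dynamic programming: a fixed volatility is an admissible first step. The
  infimum over the later partitions is brought inside the Gaussian average by dominated convergence
  along the sequence of \<open>nisio_approx_sequence\<close>.\<close>

lemma nisio_le_heat_nisio:
  assumes f: "L-lipschitz_on UNIV f" and \<sigma>: "\<sigma> \<in> {l..u}" and "0 \<le> h" "0 \<le> \<tau>"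
  shows "nisio f (h + \<tau>) x \<le> heat (\<sigma> * sqrt h) (nisio f \<tau>) x"
proof (cases "h = 0")
  case False
  obtain hs where hs: "\<And>n. hs n \<in> partitions \<tau>"
    and lim: "\<And>x. (\<lambda>n. steps (hs n) f x) \<longlonglongrightarrow> nisio f \<tau> x"
    and bound: "\<And>n x. \<bar>steps (hs n) f x\<bar> \<le> \<bar>nisio f \<tau> 0\<bar> + 1 + L * \<bar>x\<bar>"
    using nisio_approx_sequence[OF f \<open>0 \<le> \<tau>\<close>] by blast
  let ?s = "\<sigma> * sqrt h"
  have "(\<lambda>n. heat ?s (steps (hs n) f) x) \<longlonglongrightarrow> heat ?s (nisio f \<tau>) x"
    unfolding heat_def
  proof (rule integral_dominated_convergence)
    show "(\<lambda>z. nisio f \<tau> (x + ?s * z)) \<in> borel_measurable gauss"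
      using integrable_gauss_lipschitz[OF nisio_lipschitz[OF f \<open>0 \<le> \<tau>\<close>]] by auto
    show "(\<lambda>z. steps (hs n) f (x + ?s * z)) \<in> borel_measurable gauss" for n
      using integrable_gauss_lipschitz[OF steps_lipschitz[OF f]] by auto
    show "integrable gauss (\<lambda>z. \<bar>nisio f \<tau> 0\<bar> + 1 + L * (\<bar>x\<bar> + \<bar>?s\<bar> * \<bar>z\<bar>))"
      using has_bochner_integral_gauss_quartic[of 0 1 0 0 0] by (simp add: has_bochner_integral_iff)
    show "AE z in gauss. norm (steps (hs n) f (x + ?s * z)) \<le> \<bar>nisio f \<tau> 0\<bar> + 1 + L * (\<bar>x\<bar> + \<bar>?s\<bar> * \<bar>z\<bar>)" for n
    proof (intro AE_I2)
      fix z
      have "\<bar>x + ?s * z\<bar> \<le> \<bar>x\<bar> + \<bar>?s\<bar> * \<bar>z\<bar>"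
        by (metis abs_mult abs_triangle_ineq)
      then show "norm (steps (hs n) f (x + ?s * z)) \<le> \<bar>nisio f \<tau> 0\<bar> + 1 + L * (\<bar>x\<bar> + \<bar>?s\<bar> * \<bar>z\<bar>)"
        using bound[of n "x + ?s * z"] mult_left_mono[OF _ lipschitz_on_nonneg[OF f]] by fastforce
    qed
  qed (use lim in auto)
  moreover have "nisio f (h + \<tau>) x \<le> heat ?s (steps (hs n) f) x" for n
  proof -
    have "nisio f (h + \<tau>) x \<le> steps (h # hs n) f x"
      using hs[of n] False \<open>0 \<le> h\<close> by (intro nisio_le[OF f]) auto
    also have "\<dots> \<le> heat ?s (steps (hs n) f) x"
      using step_le_heat[OF steps_lipschitz[OF f] \<sigma>] by simp
    finally show ?thesis .
  qed
  ultimately show ?thesis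
    by (intro LIMSEQ_le_const) auto
qed simp

text \<open>The other half: a partition of the time \<open>h + \<tau>\<close> may be cut at
  \<open>h\<close>. Its tail lies above \<open>nisio f \<tau>\<close>, and the quartic bound for the
  front part does not depend on how the time \<open>h\<close> is divided.\<close>

lemma nisio_ge_quartic:
  assumes f: "L-lipschitz_on UNIV f" and "0 \<le> h" "0 \<le> \<tau>" "0 \<le> K"
    and le: "\<And>z. a + b * z + c * z\<^sup>2 - K * z ^ 4 \<le> nisio f \<tau> (x + z)"
  shows "a + h * G_lower l u (2 * c) - K * (3 * u ^ 4 * h\<^sup>2) \<le> nisio f (h + \<tau>) x"
proof (rule le_nisio)
  fix ks assume "ks \<in> partitions (h + \<tau>)"
  then obtain hs rs where hs: "hs \<in> partitions h" and rs: "rs \<in> partitions \<tau>" and "finer (hs @ rs) ks"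
    using split_partition assms(2,3) by blast
  have "a + h * G_lower l u (2 * c) - K * (3 * u ^ 4 * h\<^sup>2) \<le> steps hs (nisio f \<tau>) x"
    using steps_ge_quartic[OF nisio_lipschitz[OF f \<open>0 \<le> \<tau>\<close>] \<open>0 \<le> K\<close>, of hs a b c x 0] hs le
    by (simp add: partitions_def)
  also have "\<dots> \<le> steps hs (steps rs f) x"
    using nisio_le[OF f rs] by (intro steps_mono[OF nisio_lipschitz[OF f \<open>0 \<le> \<tau>\<close>] steps_lipschitz[OF f]])
  also have "\<dots> \<le> steps ks f x"
    using \<open>finer (hs @ rs) ks\<close> f by (auto simp: finer_def)
  finally show "a + h * G_lower l u (2 * c) - K * (3 * u ^ 4 * h\<^sup>2) \<le> steps ks f x" .
qed (use assms in simp)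

end

section \<open>The viscosity property\<close>

text \<open>Turns a local minimum of \<open>v - \<phi>\<close> into a local maximum for
  \<open>- v\<close> and \<open>- \<phi>\<close>, so that the quartic bound is proved for maxima
  only.\<close>

lemma Cb_1_3_uminus:
  assumes "Cb_1_3 T \<phi> \<phi>t \<phi>x \<phi>xx \<phi>xxx"
  shows "Cb_1_3 T (\<lambda>t x. - \<phi> t x) (\<lambda>t x. - \<phi>t t x) (\<lambda>t x. - \<phi>x t x) (\<lambda>t x. - \<phi>xx t x) (\<lambda>t x. - \<phi>xxx t x)"
proof -
  have "continuous_on ({0..T} \<times> UNIV) (\<lambda>(t, x). - f t x) \<and>
      bounded ((\<lambda>(t, x). - f t x) ` ({0..T} \<times> UNIV))"
    if "f \<in> {\<phi>, \<phi>t, \<phi>x, \<phi>xx, \<phi>xxx}" for f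
  proof -
    have "continuous_on ({0..T} \<times> UNIV) (\<lambda>(t, x). f t x)" "bounded ((\<lambda>(t, x). f t x) ` ({0..T} \<times> UNIV))"
      using assms that unfolding Cb_1_3_def by blast+
    then show ?thesis
      using continuous_on_minus[of "{0..T} \<times> UNIV" "\<lambda>(t, x). f t x"]
        bounded_uminus[of "(\<lambda>(t, x). f t x) ` ({0..T} \<times> UNIV)"]
      by (simp add: image_image split_beta)
  qed
  then show ?thesis
    using assms unfolding Cb_1_3_def by (auto intro!: DERIV_minus)
qed

lemma Cb_1_3_bound:
  assumes "Cb_1_3 T \<phi> \<phi>t \<phi>x \<phi>xx \<phi>xxx"
  obtains C where "0 \<le> C" "\<And>s y. s \<in> {0..T} \<Longrightarrow> \<bar>\<phi> s y\<bar> \<le> C \<and> \<bar>\<phi>x s y\<bar> \<le> C \<and> \<bar>\<phi>xx s y\<bar> \<le> C \<and> \<bar>\<phi>xxx s y\<bar> \<le> C"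
proof -
  have "\<exists>C. \<forall>s\<in>{0..T}. \<forall>y. \<bar>f s y\<bar> \<le> C" if "f \<in> {\<phi>, \<phi>t, \<phi>x, \<phi>xx, \<phi>xxx}" for f
  proof -
    have "bounded ((\<lambda>(t, x). f t x) ` ({0..T} \<times> UNIV))"
      using assms that unfolding Cb_1_3_def by blast
    then obtain B where "\<forall>p\<in>(\<lambda>(t, x). f t x) ` ({0..T} \<times> UNIV). norm p \<le> B"
      unfolding bounded_iff by auto
    then show ?thesis by (intro exI[of _ B]) force
  qed
  then obtain C where C: "\<And>f s y. f \<in> {\<phi>, \<phi>t, \<phi>x, \<phi>xx, \<phi>xxx} \<Longrightarrow> s \<in> {0..T} \<Longrightarrow> \<bar>f s y\<bar> \<le> C f"
    by metis
  show thesis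
    using C[of \<phi>] C[of \<phi>x] C[of \<phi>xx] C[of \<phi>xxx]
    by (intro that[of "max 0 (max (max (C \<phi>) (C \<phi>x)) (max (C \<phi>xx) (C \<phi>xxx)))"]) (auto simp: le_max_iff_disj)
qed

lemma Cb_1_3_Taylor:
  assumes \<phi>: "Cb_1_3 T \<phi> \<phi>t \<phi>x \<phi>xx \<phi>xxx" and "s \<in> {0..T}"
    and C: "\<And>y. \<bar>\<phi>xxx s y\<bar> \<le> C"
  shows "\<phi> s (x + z) \<le> \<phi> s x + \<phi>x s x * z + \<phi>xx s x / 2 * z\<^sup>2 + C * \<bar>z\<bar> ^ 3"
proof -
  define D where "D m = (if m = 0 then \<phi> s else if m = 1 then \<phi>x s else if m = 2 then \<phi>xx s else \<phi>xxx s)" for m :: nat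
  have der: "(D m has_real_derivative D (Suc m) y) (at y)" if m: "m < 3" for m y
  proof -
    consider "m = 0" | "m = 1" | "m = 2" using m by (auto simp: less_Suc_eq numeral_2_eq_2 numeral_3_eq_3)
    then show ?thesis
      using \<phi> \<open>s \<in> {0..T}\<close> by cases (auto simp: D_def Cb_1_3_def numeral_2_eq_2)
  qed
  have "\<exists>t. \<bar>t\<bar> \<le> \<bar>z\<bar> \<and> \<phi> s (x + z) = (\<Sum>m<3. D m (x + 0) / fact m * z ^ m) + D 3 (x + t) / fact 3 * z ^ 3"
  proof (rule Maclaurin_bi_le[where diff = "\<lambda>m t. D m (x + t)" and f = "\<lambda>t. \<phi> s (x + t)"])
    show "(\<lambda>t. D 0 (x + t)) = (\<lambda>t. \<phi> s (x + t))" by (simp add: D_def)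
    show "\<forall>m t. m < 3 \<and> \<bar>t\<bar> \<le> \<bar>z\<bar> \<longrightarrow> ((\<lambda>t. D m (x + t)) has_real_derivative D (Suc m) (x + t)) (at t)"
      using der by (auto simp: add.commute[of x] DERIV_shift[symmetric])
  qed
  then obtain t where "\<phi> s (x + z) = \<phi> s x + \<phi>x s x * z + \<phi>xx s x / 2 * z\<^sup>2 + \<phi>xxx s (x + t) / 6 * z ^ 3"
    by (auto simp: D_def numeral_eq_Suc)
  moreover have "\<phi>xxx s (x + t) / 6 * z ^ 3 \<le> \<bar>\<phi>xxx s (x + t) / 6\<bar> * \<bar>z\<bar> ^ 3"
    by (metis abs_ge_self abs_mult power_abs)
  moreover have "\<dots> \<le> C * \<bar>z\<bar> ^ 3"
    using C[of "x + t"] by (intro mult_right_mono) auto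
  ultimately show ?thesis by linarith
qed

text \<open>Near the maximum the Taylor remainder is absorbed by \<open>\<delta> z\<^sup>2 + K z\<^sup>4\<close>; far from it
  the linear growth of \<open>v\<close> is dominated by \<open>K z\<^sup>4\<close>.\<close>

lemma local_max_quartic_bound:
  assumes \<phi>: "Cb_1_3 T \<phi> \<phi>t \<phi>x \<phi>xx \<phi>xxx" and t: "t \<in> {0..<T}"
    and max: "local_max_on ({0..T} \<times> UNIV) (\<lambda>(s, y). v s y - \<phi> s y) (t, x)"
    and growth: "\<And>s y. s \<in> {0..T} \<Longrightarrow> v s y \<le> A + B * \<bar>y\<bar>" and "0 < \<delta>"
  shows "\<exists>K\<ge>0. \<exists>\<eta>>0. \<forall>h. 0 \<le> h \<and> h < \<eta> \<longrightarrow> t + h \<le> T \<and> (\<forall>z.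
    v (t + h) (x + z) \<le> (v t x - \<phi> t x + \<phi> (t + h) x) + \<phi>x (t + h) x * z + (\<phi>xx (t + h) x / 2 + \<delta>) * z\<^sup>2 + K * z ^ 4)"
proof -
  obtain C where "0 \<le> C" and C: "\<And>s y. s \<in> {0..T} \<Longrightarrow> \<bar>\<phi> s y\<bar> \<le> C \<and> \<bar>\<phi>x s y\<bar> \<le> C \<and> \<bar>\<phi>xx s y\<bar> \<le> C \<and> \<bar>\<phi>xxx s y\<bar> \<le> C"
    using Cb_1_3_bound[OF \<phi>] by metis
  obtain d where "0 < d" and d: "\<And>q. q \<in> {0..T} \<times> UNIV \<Longrightarrow> q \<noteq> (t, x) \<Longrightarrow> dist q (t, x) < d \<Longrightarrow>
      (\<lambda>(s, y). v s y - \<phi> s y) q \<le> v t x - \<phi> t x"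
    using max unfolding local_max_on_def eventually_at by auto
  \<comment> \<open>The bound \<open>2 * r \<le> d\<close> keeps \<open>(t + h, x + z)\<close> in
    the neighbourhood of the maximum as long as \<open>h\<close> and \<open>\<bar>z\<bar>\<close>
    are below \<open>r\<close>; \<open>r \<le> 1\<close> gives
    \<open>\<bar>z\<bar> \<le> \<bar>z\<bar> / r\<close>.\<close>
  define r where "r = min 1 (d / 2)"
  define R where "R = (1 / r) ^ 4"
  \<comment> \<open>For \<open>\<bar>z\<bar> \<ge> r\<close> the term
    \<open>R * z ^ 4 = (\<bar>z\<bar> / r) ^ 4\<close> dominates \<open>1\<close>,
    \<open>\<bar>z\<bar>\<close> and \<open>z\<^sup>2\<close>. \<open>E\<close> adds up the
    coefficients to be absorbed there: growth of \<open>v\<close>, constant terms, and the bounds on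
    the two spatial derivatives.\<close>
  define E where "E = \<bar>A\<bar> + \<bar>B\<bar> * \<bar>x\<bar> + \<bar>B\<bar> + \<bar>v t x\<bar> + 2 * C + C + C"
  \<comment> \<open>The first summand completes the square that absorbs
    \<open>C * \<bar>z\<bar> ^ 3\<close> near the maximum; the second is for the far region.\<close>
  define K where "K = C\<^sup>2 / (4 * \<delta>) + R * E"
  have "0 < r" using \<open>0 < d\<close> by (simp add: r_def)
  have "0 \<le> R" "0 \<le> E" using \<open>0 < r\<close> \<open>0 \<le> C\<close> by (simp_all add: R_def E_def)
  have "0 \<le> K" using \<open>0 \<le> R\<close> \<open>0 \<le> E\<close> \<open>0 < \<delta>\<close> by (simp add: K_def)
  show ?thesis
  proof (rule exI[of _ K], rule conjI[OF \<open>0 \<le> K\<close>], rule exI[of _ "min r (T - t)"], intro conjI allI impI)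
    show "t + h \<le> T" if "0 \<le> h \<and> h < min r (T - t)" for h
      using that by simp
    fix h z assume h: "0 \<le> h \<and> h < min r (T - t)"
    have th: "t + h \<in> {0..T}" using h t by auto
    note C' = C[OF th]
    \<comment> \<open>The Taylor polynomial is taken at time \<open>t + h\<close>: the expansion is
      in space only, and the time increment of \<phi> is kept exactly for the difference
      quotient.\<close>
    let ?q = "(v t x - \<phi> t x + \<phi> (t + h) x) + \<phi>x (t + h) x * z + (\<phi>xx (t + h) x / 2 + \<delta>) * z\<^sup>2 + K * z ^ 4"
    show "v (t + h) (x + z) \<le> ?q"
    proof (cases "\<bar>z\<bar> < r")
      case True
      have "dist (t + h, x + z) (t, x) \<le> \<bar>h\<bar> + \<bar>z\<bar>"
        by (simp add: dist_Pair_Pair dist_real_def sqrt_sum_squares_le_sum_abs)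
      also have "\<dots> < d" using True h by (simp add: r_def)
      finally have "v (t + h) (x + z) - \<phi> (t + h) (x + z) \<le> v t x - \<phi> t x"
        using d[of "(t + h, x + z)"] th by (cases "h = 0 \<and> z = 0") auto
      moreover have "\<phi> (t + h) (x + z) \<le> \<phi> (t + h) x + \<phi>x (t + h) x * z + \<phi>xx (t + h) x / 2 * z\<^sup>2 + C * \<bar>z\<bar> ^ 3"
        using Cb_1_3_Taylor[OF \<phi> th] C' by blast
      moreover have "C * \<bar>z\<bar> ^ 3 \<le> \<delta> * z\<^sup>2 + C\<^sup>2 / (4 * \<delta>) * z ^ 4"
      proof -
        have "0 \<le> (C * \<bar>z\<bar> - 2 * \<delta>)\<^sup>2" by simp
        then have "C * \<bar>z\<bar> * (4 * \<delta>) \<le> 4 * \<delta>\<^sup>2 + C\<^sup>2 * z\<^sup>2"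
          by (simp add: power2_eq_square algebra_simps)
        then have "C * \<bar>z\<bar> \<le> \<delta> + C\<^sup>2 / (4 * \<delta>) * z\<^sup>2"
          using \<open>0 < \<delta>\<close> by (simp add: field_simps power2_eq_square)
        then have "z\<^sup>2 * (C * \<bar>z\<bar>) \<le> z\<^sup>2 * (\<delta> + C\<^sup>2 / (4 * \<delta>) * z\<^sup>2)"
          by (intro mult_left_mono) auto
        moreover have "z\<^sup>2 * (C * \<bar>z\<bar>) = C * \<bar>z\<bar> ^ 3"
          by (simp add: power3_eq_cube power2_eq_square)
        moreover have "z\<^sup>2 * (\<delta> + C\<^sup>2 / (4 * \<delta>) * z\<^sup>2) = \<delta> * z\<^sup>2 + C\<^sup>2 / (4 * \<delta>) * z ^ 4"
          by (simp add: power4_eq_xxxx power2_eq_square algebra_simps)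
        ultimately show ?thesis by simp
      qed
      moreover have "0 \<le> R * E * z ^ 4"
        using \<open>0 \<le> R\<close> \<open>0 \<le> E\<close> by simp
      ultimately show ?thesis
        unfolding K_def by (simp add: algebra_simps)
    next
      case False
      define w where "w = \<bar>z\<bar> / r"
      have "1 \<le> w" using False \<open>0 < r\<close> by (simp add: w_def)
      have z: "\<bar>z\<bar> = w * r" using \<open>0 < r\<close> by (simp add: w_def)
      have "w \<le> w ^ 4" "w\<^sup>2 \<le> w ^ 4" "1 \<le> w ^ 4"
        using \<open>1 \<le> w\<close> power_increasing[of 1 4 w] power_increasing[of 2 4 w] by auto
      moreover have "R * z ^ 4 = w ^ 4"
        using \<open>0 < r\<close> by (simp add: R_def w_def power_divide)
      moreover have "\<bar>z\<bar> \<le> w" "\<bar>z\<bar>\<^sup>2 \<le> w\<^sup>2"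
        using \<open>0 < r\<close> \<open>1 \<le> w\<close> unfolding z by (auto simp: r_def intro!: power_mono mult_left_le)
      ultimately have le: "1 \<le> R * z ^ 4" "\<bar>z\<bar> \<le> R * z ^ 4" "z\<^sup>2 \<le> R * z ^ 4"
        by simp_all
      have "v (t + h) (x + z) \<le> A + B * \<bar>x + z\<bar>" using growth[OF th] .
      also have "\<dots> \<le> \<bar>A\<bar> + \<bar>B\<bar> * (\<bar>x\<bar> + \<bar>z\<bar>)"
        by (intro add_mono order.trans[OF mult_right_mono mult_left_mono]) auto
      finally have 1: "v (t + h) (x + z) \<le> \<bar>A\<bar> + \<bar>B\<bar> * \<bar>x\<bar> + \<bar>B\<bar> * \<bar>z\<bar>"
        by (simp add: algebra_simps)
      have "\<bar>\<phi>x (t + h) x * z\<bar> \<le> C * \<bar>z\<bar>"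
        unfolding abs_mult using C' by (intro mult_right_mono) auto
      moreover have "\<bar>\<phi>xx (t + h) x / 2 * z\<^sup>2\<bar> \<le> C * z\<^sup>2"
        unfolding abs_mult using C'[of x] \<open>0 \<le> C\<close> by (intro mult_mono) auto
      moreover have "\<bar>\<phi> t x\<bar> \<le> C" "\<bar>\<phi> (t + h) x\<bar> \<le> C"
        using C[of t] t C' by auto
      ultimately have 2: "- (\<bar>v t x\<bar> + 2 * C) - C * \<bar>z\<bar> - C * z\<^sup>2
          \<le> (v t x - \<phi> t x + \<phi> (t + h) x) + \<phi>x (t + h) x * z + \<phi>xx (t + h) x / 2 * z\<^sup>2"
        by linarith
      have "(\<bar>A\<bar> + \<bar>B\<bar> * \<bar>x\<bar> + \<bar>v t x\<bar> + 2 * C) * 1 \<le> (\<bar>A\<bar> + \<bar>B\<bar> * \<bar>x\<bar> + \<bar>v t x\<bar> + 2 * C) * (R * z ^ 4)"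
        "(\<bar>B\<bar> + C) * \<bar>z\<bar> \<le> (\<bar>B\<bar> + C) * (R * z ^ 4)" "C * z\<^sup>2 \<le> C * (R * z ^ 4)"
        using le \<open>0 \<le> C\<close> by (intro mult_left_mono; simp)+
      then have 3: "\<bar>A\<bar> + \<bar>B\<bar> * \<bar>x\<bar> + \<bar>v t x\<bar> + 2 * C + (\<bar>B\<bar> + C) * \<bar>z\<bar> + C * z\<^sup>2 \<le> R * E * z ^ 4"
        unfolding E_def by (simp add: algebra_simps)
      have 4: "0 \<le> \<delta> * z\<^sup>2" "0 \<le> C\<^sup>2 / (4 * \<delta>) * z ^ 4"
        using \<open>0 < \<delta>\<close> by auto
      show ?thesis
        using 1 2 3 4 unfolding K_def by (simp add: algebra_simps)
    qed
  qed (use \<open>0 < r\<close> t in auto)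
qed

lemma le_zero_of_small_multiple:
  fixes a c :: real
  assumes "\<And>\<delta>. 0 < \<delta> \<Longrightarrow> a \<le> \<delta> * c"
  shows "a \<le> 0"
proof (rule field_le_epsilon)
  fix e :: real assume "0 < e"
  have "a \<le> e / (\<bar>c\<bar> + 1) * c"
    using assms[of "e / (\<bar>c\<bar> + 1)"] \<open>0 < e\<close> by simp
  also have "\<dots> \<le> e / (\<bar>c\<bar> + 1) * (\<bar>c\<bar> + 1)"
    using \<open>0 < e\<close> by (intro mult_left_mono) auto
  also have "\<dots> = e" by (simp add: add_nonneg_eq_0_iff)
  finally show "a \<le> 0 + e" by simp
qed

text \<open>Only times after \<open>t\<close> are compared, so limits from the right suffice; this
  includes \<open>t = 0\<close>, where the time derivative of a test function is one-sided.\<close>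

lemma filterlim_shift_within:
  assumes "t \<in> {0..<T}"
  shows "filterlim (\<lambda>h. t + h) (at t within {0..T}) (at_right (0::real))"
  unfolding filterlim_at
proof
  show "\<forall>\<^sub>F h in at_right 0. t + h \<in> {0..T} \<and> t + h \<noteq> t"
    using eventually_at_right_less[of 0] eventually_at_right[of 0 "T - t" "\<lambda>h. h < T - t"] assms
    by (auto elim!: eventually_elim2 intro: exI[of _ "T - t"])
  show "((\<lambda>h. t + h) \<longlongrightarrow> t) (at_right 0)"
    by (auto intro!: tendsto_eq_intros)
qed

lemma Cb_1_3_difference_quotient:
  assumes \<phi>: "Cb_1_3 T \<phi> \<phi>t \<phi>x \<phi>xx \<phi>xxx" and t: "t \<in> {0..<T}"
  shows "((\<lambda>h. (\<phi> (t + h) x - \<phi> t x) / h) \<longlongrightarrow> \<phi>t t x) (at_right 0)"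
proof -
  have "((\<lambda>s. \<phi> s x) has_real_derivative \<phi>t t x) (at t within {0..T})"
    using \<phi> t by (auto simp: Cb_1_3_def)
  then have "((\<lambda>s. (\<phi> s x - \<phi> t x) / (s - t)) \<longlongrightarrow> \<phi>t t x) (at t within {0..T})"
    by (simp add: has_field_derivative_iff)
  from filterlim_compose[OF this filterlim_shift_within[OF t]] show ?thesis by simp
qed

lemma Cb_1_3_second_derivative_tendsto:
  assumes \<phi>: "Cb_1_3 T \<phi> \<phi>t \<phi>x \<phi>xx \<phi>xxx" and t: "t \<in> {0..<T}"
  shows "((\<lambda>h. \<phi>xx (t + h) x) \<longlongrightarrow> \<phi>xx t x) (at_right 0)"
proof -
  have "continuous_on ({0..T} \<times> UNIV) (\<lambda>(s, y). \<phi>xx s y)"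
    using \<phi> by (simp add: Cb_1_3_def)
  then have "continuous_on {0..T} (\<lambda>s. \<phi>xx s x)"
    using continuous_on_compose2[of "{0..T} \<times> UNIV" "\<lambda>(s, y). \<phi>xx s y" "{0..T}" "\<lambda>s. (s, x)"]
    by (simp add: image_subset_iff continuous_on_Pair)
  then have "((\<lambda>s. \<phi>xx s x) \<longlongrightarrow> \<phi>xx t x) (at t within {0..T})"
    using t by (auto simp: continuous_on_def)
  from filterlim_compose[OF this filterlim_shift_within[OF t]] show ?thesis .
qed

section \<open>Time regularity and the two viscosity inequalities\<close>

context volatility_band
begin

text \<open>An infimum of functions that are \<open>u\<^sup>2 / 2\<close>-Lipschitz. The estimate
  serves at minima, where the curvature is taken at time \<open>t + h\<close> and lowered by
  \<open>2 * \<delta>\<close>.\<close>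

lemma G_lower_lipschitz: "G_lower l u c' - u\<^sup>2 / 2 * \<bar>c - c'\<bar> \<le> G_lower l u c"
proof (rule G_lower_ge)
  fix \<sigma> assume \<sigma>: "\<sigma> \<in> {l..u}"
  have "\<sigma>\<^sup>2 / 2 * (c' - c) \<le> \<sigma>\<^sup>2 / 2 * \<bar>c - c'\<bar>"
    by (intro mult_left_mono) auto
  also have "\<dots> \<le> u\<^sup>2 / 2 * \<bar>c - c'\<bar>"
    using square_le_upper[OF \<sigma>] by (intro mult_right_mono) auto
  finally have "\<sigma>\<^sup>2 / 2 * (c' - c) \<le> u\<^sup>2 / 2 * \<bar>c - c'\<bar>" .
  then show "G_lower l u c' - u\<^sup>2 / 2 * \<bar>c - c'\<bar> \<le> \<sigma>\<^sup>2 * c / 2"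
    using G_lower_le[OF \<sigma>, of c'] by (simp add: algebra_simps)
qed

text \<open>An \<open>L\<close>-Lipschitz function deviates from its value at \<open>x\<close> by at
  most \<open>L * e / 2 + L / (2 * e) * z\<^sup>2\<close>. Over a time \<open>h\<close> the square
  contributes at most \<open>u\<^sup>2 * h\<close>, and \<open>e = sqrt h\<close> gives both terms
  the same order.\<close>

lemma nisio_time_modulus:
  assumes f: "L-lipschitz_on UNIV f" and "0 \<le> h" "0 \<le> \<tau>"
  shows "\<bar>nisio f (h + \<tau>) x - nisio f \<tau> x\<bar> \<le> L / 2 * (1 + u\<^sup>2) * sqrt h"
proof (cases "h = 0")
  case False
  then have "0 < h" using assms by simp
  let ?e = "sqrt h"
  have e: "0 < ?e" "h / ?e = ?e" using \<open>0 < h\<close> by (auto simp: real_div_sqrt)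
  note g = nisio_lipschitz[OF f \<open>0 \<le> \<tau>\<close>]
  have u: "u \<in> {l..u}" using l_le_u by simp
  have "-(u\<^sup>2 / 2 * (L / ?e)) \<le> G_lower l u (- L / ?e)"
  proof (rule G_lower_ge)
    fix \<sigma> assume "\<sigma> \<in> {l..u}"
    from mult_right_mono[OF square_le_upper[OF this], of "L / ?e"]
    show "-(u\<^sup>2 / 2 * (L / ?e)) \<le> \<sigma>\<^sup>2 * (- L / ?e) / 2"
      using lipschitz_on_nonneg[OF f] e by (simp add: field_simps)
  qed
  then have "h * -(u\<^sup>2 / 2 * (L / ?e)) \<le> h * G_lower l u (- L / ?e)"
    using \<open>0 < h\<close> by (intro mult_left_mono) auto
  moreover have "h * -(u\<^sup>2 / 2 * (L / ?e)) = - (L / 2 * u\<^sup>2 * (h / ?e))" by simp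
  moreover have "nisio f \<tau> x - L * ?e / 2 + h * G_lower l u (2 * (- L / (2 * ?e))) - 0 * (3 * u ^ 4 * h\<^sup>2)
      \<le> nisio f (h + \<tau>) x"
    using lipschitz_ge_quadratic[OF g e(1)] assms
    by (intro nisio_ge_quartic[OF f, where b = 0]) auto
  ultimately have "nisio f \<tau> x - L / 2 * (1 + u\<^sup>2) * ?e \<le> nisio f (h + \<tau>) x"
    unfolding e(2) by (simp add: algebra_simps)
  moreover have "nisio f (h + \<tau>) x \<le> heat (u * ?e) (nisio f \<tau>) x"
    using assms u by (intro nisio_le_heat_nisio) auto
  moreover have "heat (u * ?e) (nisio f \<tau>) x \<le> (nisio f \<tau> x + L * ?e / 2) + L / (2 * ?e) * (u * ?e)\<^sup>2 + 0 * (3 * (u * ?e) ^ 4)"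
  proof (rule heat_le_quartic[OF g, where b = 0])
    fix z
    show "nisio f \<tau> (x + z) \<le> nisio f \<tau> x + L * ?e / 2 + 0 * z + L / (2 * ?e) * z\<^sup>2 + 0 * z ^ 4"
      using lipschitz_ge_quadratic[of L "\<lambda>y. - nisio f \<tau> y" ?e x z] g e(1) by simp
  qed
  moreover have "L / (2 * ?e) * (u * ?e)\<^sup>2 = L / 2 * u\<^sup>2 * ?e"
    using e(1) by (simp add: field_simps power2_eq_square)
  ultimately show ?thesis
    by (simp add: algebra_simps abs_le_iff)
qed simp

lemma nisio_continuous:
  assumes f: "L-lipschitz_on UNIV f"
  shows "continuous_on ({0..T} \<times> UNIV) (\<lambda>(t, x). nisio f (T - t) x)"
proof -
  let ?C = "L / 2 * (1 + u\<^sup>2)" and ?v = "\<lambda>q. nisio f (T - fst q) (snd q)"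
  have ordered: "\<bar>nisio f (T - s) y - nisio f (T - t) x\<bar> \<le> L * \<bar>y - x\<bar> + ?C * sqrt \<bar>s - t\<bar>"
    if "s \<le> t" "t \<le> T" for s t x y
  proof -
    have "\<bar>nisio f (T - s) y - nisio f (T - t) y\<bar> \<le> ?C * sqrt \<bar>s - t\<bar>"
      using nisio_time_modulus[OF f, of "t - s" "T - t" y] that by simp
    moreover have "\<bar>nisio f (T - t) y - nisio f (T - t) x\<bar> \<le> L * \<bar>y - x\<bar>"
      using that by (intro lipschitz_on_real_D nisio_lipschitz[OF f]) auto
    ultimately show ?thesis by linarith
  qed
  have bound: "\<bar>?v q - ?v p\<bar>
      \<le> L * \<bar>snd q - snd p\<bar> + ?C * sqrt \<bar>fst q - fst p\<bar>" if "fst p \<le> T" "fst q \<le> T" for p q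
    using ordered[of "fst p" "fst q" "snd p" "snd q"] ordered[of "fst q" "fst p" "snd q" "snd p"] that
    by (cases "fst p \<le> fst q") (auto simp: abs_minus_commute)
  show ?thesis
    unfolding continuous_on_def split_beta
  proof
    fix p :: "real \<times> real" assume p: "p \<in> {0..T} \<times> UNIV"
    have "((\<lambda>q. ?v q - ?v p) \<longlongrightarrow> 0) (at p within {0..T} \<times> UNIV)"
    proof (rule Lim_null_comparison)
      show "\<forall>\<^sub>F q in at p within {0..T} \<times> UNIV. norm (?v q - ?v p)
          \<le> L * \<bar>snd q - snd p\<bar> + ?C * sqrt \<bar>fst q - fst p\<bar>"
        unfolding eventually_at_filter using bound p by (auto intro!: always_eventually)
      show "((\<lambda>q. L * \<bar>snd q - snd p\<bar> + ?C * sqrt \<bar>fst q - fst p\<bar>) \<longlongrightarrow> 0) (at p within {0..T} \<times> UNIV)"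
        by (auto intro!: tendsto_eq_intros)
    qed
    then show "((\<lambda>q. ?v q) \<longlongrightarrow> ?v p) (at p within {0..T} \<times> UNIV)"
      by (simp add: Lim_null[symmetric])
  qed
qed

lemma nisio_growth:
  assumes f: "L-lipschitz_on UNIV f" and "s \<in> {0..T}"
  shows "\<bar>nisio f (T - s) y\<bar> \<le> (\<bar>f 0\<bar> + L / 2 * (1 + u\<^sup>2) * sqrt T) + L * \<bar>y\<bar>"
proof -
  have "sqrt (T - s) \<le> sqrt T" using assms by simp
  then have "L / 2 * (1 + u\<^sup>2) * sqrt (T - s) \<le> L / 2 * (1 + u\<^sup>2) * sqrt T"
    using lipschitz_on_nonneg[OF f] by (intro mult_left_mono) auto
  moreover have "\<bar>nisio f (T - s) y - f y\<bar> \<le> L / 2 * (1 + u\<^sup>2) * sqrt (T - s)"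
    using nisio_time_modulus[OF f, of "T - s" 0 y] assms by simp
  ultimately show ?thesis
    using lipschitz_linear_growth[OF f, of y] by linarith
qed

text \<open>Agreement with \<open>nisio\<close> is asked for on \<open>[0, T]\<close> only, the
  times at which the semigroup represents the value function.\<close>

theorem viscosity_solution_nisio:
  assumes f: "L-lipschitz_on UNIV f" and v: "\<And>t x. t \<in> {0..T} \<Longrightarrow> v t x = nisio f (T - t) x" and "0 < T"
  shows "viscosity_solution T (G_lower l u) f v"
proof -
  have growth: "v s y \<le> (\<bar>f 0\<bar> + L / 2 * (1 + u\<^sup>2) * sqrt T) + L * \<bar>y\<bar>"
      "- v s y \<le> (\<bar>f 0\<bar> + L / 2 * (1 + u\<^sup>2) * sqrt T) + L * \<bar>y\<bar>" if "s \<in> {0..T}" for s y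
    using nisio_growth[OF f that, of y] v[OF that, of y] by linarith+
  show ?thesis
    unfolding viscosity_solution_def
  proof (intro conjI allI impI ballI)
    show "continuous_on ({0..T} \<times> UNIV) (\<lambda>(t, x). v t x)"
      using nisio_continuous[OF f, of T] v by (subst continuous_on_cong[OF refl, where g = "\<lambda>(t, x). nisio f (T - t) x"]) auto
    show "v T x = f x" for x using v \<open>0 < T\<close> by simp
  next
    fix \<phi> \<phi>t \<phi>x \<phi>xx \<phi>xxx t x
    assume \<phi>: "Cb_1_3 T \<phi> \<phi>t \<phi>x \<phi>xx \<phi>xxx" and t: "t \<in> {0..<T}"
      and max: "local_max_on ({0..T} \<times> UNIV) (\<lambda>(s, y). v s y - \<phi> s y) (t, x)"
    have "- \<phi>t t x \<le> G_lower l u (\<phi>xx t x)"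
    proof (rule G_lower_ge)
      \<comment> \<open>At a maximum every constant volatility gives an inequality of its own; the
        infimum over volatilities is taken last.\<close>
      fix \<sigma> assume \<sigma>: "\<sigma> \<in> {l..u}"
      have *: "0 \<le> \<phi>t t x + (\<phi>xx t x / 2 + \<delta>) * \<sigma>\<^sup>2" if "0 < \<delta>" for \<delta>
      proof -
        obtain K \<eta> where "0 \<le> K" "0 < \<eta>" and K: "\<And>h. 0 \<le> h \<Longrightarrow> h < \<eta> \<Longrightarrow> t + h \<le> T \<and> (\<forall>z.
            v (t + h) (x + z) \<le> (v t x - \<phi> t x + \<phi> (t + h) x) + \<phi>x (t + h) x * z + (\<phi>xx (t + h) x / 2 + \<delta>) * z\<^sup>2 + K * z ^ 4)"
          using local_max_quartic_bound[OF \<phi> t max growth(1) \<open>0 < \<delta>\<close>] by blast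
        \<comment> \<open>The inequality over a time \<open>h\<close>, divided by \<open>h\<close>:
          the quartic term has order \<open>h\<^sup>2\<close> and leaves
          \<open>K * (3 * \<sigma> ^ 4) * h\<close>.\<close>
        let ?q = "\<lambda>h. (\<phi> (t + h) x - \<phi> t x) / h + (\<phi>xx (t + h) x / 2 + \<delta>) * \<sigma>\<^sup>2 + K * (3 * \<sigma> ^ 4) * h"
        have "(?q
            \<longlongrightarrow> \<phi>t t x + (\<phi>xx t x / 2 + \<delta>) * \<sigma>\<^sup>2 + K * (3 * \<sigma> ^ 4) * 0) (at_right 0)"
          by (intro tendsto_intros Cb_1_3_difference_quotient[OF \<phi> t] Cb_1_3_second_derivative_tendsto[OF \<phi> t]) auto
        moreover have "\<forall>\<^sub>F h in at_right 0. 0 \<le> ?q h"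
          unfolding eventually_at_right_field
        proof (intro exI[of _ \<eta>] conjI allI impI)
          fix h assume h: "0 < h" "h < \<eta>"
          let ?a = "v t x - \<phi> t x + \<phi> (t + h) x"
          define D where "D = (\<phi> (t + h) x - \<phi> t x) / h"
          have D: "\<phi> (t + h) x = \<phi> t x + D * h" using h by (simp add: D_def)
          have th: "t + h \<in> {0..T}" "t \<in> {0..T}" using K[of h] h t by auto
          have "v t x \<le> heat (\<sigma> * sqrt h) (nisio f (T - (t + h))) x"
            using nisio_le_heat_nisio[OF f \<sigma>, of h "T - (t + h)" x] h th v[of t x] by simp
          also have "\<dots> \<le> ?a + (\<phi>xx (t + h) x / 2 + \<delta>) * (\<sigma> * sqrt h)\<^sup>2 + K * (3 * (\<sigma> * sqrt h) ^ 4)"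
          proof (rule heat_le_quartic)
            show "L-lipschitz_on UNIV (nisio f (T - (t + h)))"
              using th by (intro nisio_lipschitz[OF f]) auto
            show "nisio f (T - (t + h)) (x + z) \<le> ?a + \<phi>x (t + h) x * z + (\<phi>xx (t + h) x / 2 + \<delta>) * z\<^sup>2 + K * z ^ 4" for z
              using spec[OF conjunct2[OF K[of h]], of z] h v[OF th(1), of "x + z"] by simp
          qed
          also have "(\<sigma> * sqrt h)\<^sup>2 = \<sigma>\<^sup>2 * h" using h by (simp add: power_mult_distrib)
          also have "(\<sigma> * sqrt h) ^ 4 = \<sigma> ^ 4 * h * h" using h by (simp add: power_mult_distrib power4_eq_xxxx)
          finally have "0 \<le> (D + (\<phi>xx (t + h) x / 2 + \<delta>) * \<sigma>\<^sup>2 + K * (3 * \<sigma> ^ 4) * h) * h"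
            unfolding D by (simp add: algebra_simps)
          then show "0 \<le> ?q h"
            using h unfolding D_def by (simp add: zero_le_mult_iff)
        qed (use \<open>0 < \<eta>\<close> in simp)
        ultimately have "0 \<le> \<phi>t t x + (\<phi>xx t x / 2 + \<delta>) * \<sigma>\<^sup>2 + K * (3 * \<sigma> ^ 4) * 0"
          by (rule tendsto_lowerbound) simp
        then show ?thesis by simp
      qed
      \<comment> \<open>\<open>K\<close> and \<eta> depend on \<delta>, so \<open>h\<close> has to
        tend to 0 before \<delta> does.\<close>
      have "- \<phi>t t x - \<sigma>\<^sup>2 * \<phi>xx t x / 2 \<le> 0"
      proof (rule le_zero_of_small_multiple)
        fix \<delta> :: real assume "0 < \<delta>"
        from *[OF this] show "- \<phi>t t x - \<sigma>\<^sup>2 * \<phi>xx t x / 2 \<le> \<delta> * \<sigma>\<^sup>2" by (simp add: algebra_simps)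
      qed
      then show "- \<phi>t t x \<le> \<sigma>\<^sup>2 * \<phi>xx t x / 2" by simp
    qed
    then show "0 \<le> \<phi>t t x + G_lower l u (\<phi>xx t x)" by simp
  next
    fix \<phi> \<phi>t \<phi>x \<phi>xx \<phi>xxx t x
    assume \<phi>: "Cb_1_3 T \<phi> \<phi>t \<phi>x \<phi>xx \<phi>xxx" and t: "t \<in> {0..<T}"
      and min: "local_min_on ({0..T} \<times> UNIV) (\<lambda>(s, y). v s y - \<phi> s y) (t, x)"
    let ?G = "G_lower l u (\<phi>xx t x)"
    have max: "local_max_on ({0..T} \<times> UNIV) (\<lambda>(s, y). - v s y - - \<phi> s y) (t, x)"
      using min by (auto simp: local_min_on_def local_max_on_def split_beta elim!: eventually_mono)
    \<comment> \<open>For \<phi> itself the quadratic coefficient is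
      \<open>\<phi>xx / 2 - \<delta>\<close>, which puts \<open>\<phi>xx - 2 * \<delta>\<close> into
      \<open>G_lower\<close>; hence the \<open>2 * \<delta>\<close>.\<close>
    have *: "\<phi>t t x + ?G - u\<^sup>2 / 2 * (2 * \<delta>) \<le> 0" if "0 < \<delta>" for \<delta>
    proof -
      obtain K \<eta> where "0 \<le> K" "0 < \<eta>" and K: "\<And>h. 0 \<le> h \<Longrightarrow> h < \<eta> \<Longrightarrow> t + h \<le> T \<and> (\<forall>z.
          - v (t + h) (x + z) \<le> (- v t x - - \<phi> t x + - \<phi> (t + h) x) + - \<phi>x (t + h) x * z + (- \<phi>xx (t + h) x / 2 + \<delta>) * z\<^sup>2 + K * z ^ 4)"
        using local_max_quartic_bound[OF Cb_1_3_uminus[OF \<phi>] t max growth(2) \<open>0 < \<delta>\<close>] by blast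
      \<comment> \<open>\<open>G_lower\<close> is evaluated at the curvature at time
        \<open>t\<close>; the absolute value pays, through \<open>G_lower_lipschitz\<close>, for the
        change of its argument.\<close>
      let ?q = "\<lambda>h. (\<phi> (t + h) x - \<phi> t x) / h + ?G - u\<^sup>2 / 2 * (\<bar>\<phi>xx (t + h) x - \<phi>xx t x\<bar> + 2 * \<delta>) - K * (3 * u ^ 4) * h"
      have "(?q \<longlongrightarrow> \<phi>t t x + ?G - u\<^sup>2 / 2 * (\<bar>\<phi>xx t x - \<phi>xx t x\<bar> + 2 * \<delta>) - K * (3 * u ^ 4) * 0) (at_right 0)"
        by (intro tendsto_intros Cb_1_3_difference_quotient[OF \<phi> t] Cb_1_3_second_derivative_tendsto[OF \<phi> t]) auto
      moreover have "\<forall>\<^sub>F h in at_right 0. ?q h \<le> 0"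
        unfolding eventually_at_right_field
      proof (intro exI[of _ \<eta>] conjI allI impI)
        fix h assume h: "0 < h" "h < \<eta>"
        have half: "2 * (r / 2) = r" for r :: real by simp
        let ?a = "v t x - \<phi> t x + \<phi> (t + h) x" and ?c = "\<phi>xx (t + h) x - 2 * \<delta>"
        define D where "D = (\<phi> (t + h) x - \<phi> t x) / h"
        have D: "\<phi> (t + h) x = \<phi> t x + D * h" using h by (simp add: D_def)
        have th: "t + h \<in> {0..T}" "t \<in> {0..T}" using K[of h] h t by auto
        have "?G - u\<^sup>2 / 2 * \<bar>?c - \<phi>xx t x\<bar> \<le> G_lower l u ?c"
          by (rule G_lower_lipschitz)
        moreover have "u\<^sup>2 / 2 * \<bar>?c - \<phi>xx t x\<bar> \<le> u\<^sup>2 / 2 * (\<bar>\<phi>xx (t + h) x - \<phi>xx t x\<bar> + 2 * \<delta>)"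
          using \<open>0 < \<delta>\<close> by (intro mult_left_mono) auto
        ultimately have "h * (?G - u\<^sup>2 / 2 * (\<bar>\<phi>xx (t + h) x - \<phi>xx t x\<bar> + 2 * \<delta>)) \<le> h * G_lower l u ?c"
          using h by (intro mult_left_mono) auto
        moreover have "?a + h * G_lower l u ?c - K * (3 * u ^ 4 * h\<^sup>2) \<le> nisio f (h + (T - (t + h))) x"
        proof (rule nisio_ge_quartic[OF f, where c = "?c / 2", unfolded half])
          fix z
          show "?a + \<phi>x (t + h) x * z + ?c / 2 * z\<^sup>2 - K * z ^ 4 \<le> nisio f (T - (t + h)) (x + z)"
            using spec[OF conjunct2[OF K[of h]], of z] h v[OF th(1), of "x + z"] by (simp add: algebra_simps diff_divide_distrib)
        qed (use h th \<open>0 \<le> K\<close> in auto)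
        moreover have "nisio f (h + (T - (t + h))) x = v t x"
          using v[OF th(2)] by simp
        ultimately have "?q h * h \<le> 0"
          unfolding D_def[symmetric] unfolding D by (simp add: algebra_simps power2_eq_square)
        then show "?q h \<le> 0"
          using h by (simp add: mult_le_0_iff)
      qed (use \<open>0 < \<eta>\<close> in simp)
      ultimately have "\<phi>t t x + ?G - u\<^sup>2 / 2 * (\<bar>\<phi>xx t x - \<phi>xx t x\<bar> + 2 * \<delta>) - K * (3 * u ^ 4) * 0 \<le> 0"
        by (rule tendsto_upperbound) simp
      then show ?thesis by simp
    qed
    show "\<phi>t t x + ?G \<le> 0"
      using * by (intro le_zero_of_small_multiple[where c = "u\<^sup>2"]) (simp add: mult.commute)
  qed
qed

end

section \<open>Continuity of translations\<close>

abbreviation shift_dist :: "(real \<Rightarrow> real) \<Rightarrow> real \<Rightarrow> real" where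
  "shift_dist f h \<equiv> \<integral>x. \<bar>f (x + h) - f x\<bar> \<partial>lborel"

lemma integrable_translate:
  "integrable lborel f \<Longrightarrow> integrable lborel (\<lambda>x. f (x + h :: real) :: real)"
  using lborel_integrable_real_affine[of f 1 h] by (simp add: add.commute)

lemma integral_translate:
  fixes f :: "real \<Rightarrow> real"
  shows "(\<integral>x. f (x + h) \<partial>lborel) = (\<integral>x. f x \<partial>lborel)"
  using lborel_integral_real_affine[of 1 f h] by (simp add: add.commute)

text \<open>Translation invariance of Lebesgue measure makes the two approximation errors equal,
  hence the factor 2.\<close>

lemma translation_integral_le:
  fixes f g :: "real \<Rightarrow> real"
  assumes f: "integrable lborel f" and g: "integrable lborel g"
  shows "shift_dist f h \<le> shift_dist g h + 2 * (\<integral>x. \<bar>f x - g x\<bar> \<partial>lborel)"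
proof -
  have "(\<integral>x. \<bar>f x - g x\<bar> \<partial>lborel) = (\<integral>x. \<bar>f (x + h) - g (x + h)\<bar> \<partial>lborel)"
    using integral_translate[of "\<lambda>x. \<bar>f x - g x\<bar>" h] by simp
  moreover have "shift_dist f h \<le>
      (\<integral>x. \<bar>g (x + h) - g x\<bar> + (\<bar>f (x + h) - g (x + h)\<bar> + \<bar>f x - g x\<bar>) \<partial>lborel)"
    using f g integrable_translate by (intro integral_mono) auto
  ultimately show ?thesis
    using f g integrable_translate[OF f] integrable_translate[OF g] by simp
qed

text \<open>For indicator values \<open>\<bar>a - b\<bar> = a + b - 2 * (b * a)\<close>, which
  reduces the claim to the integral of the product. There openness gives pointwise convergence: a
  point of \<open>U\<close> stays in \<open>U\<close> under small shifts.\<close>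

lemma translation_open_tendsto:
  fixes U :: "real set"
  assumes U: "open U" "emeasure lborel U < \<infinity>" and h: "h \<longlonglongrightarrow> 0"
  shows "(\<lambda>n. \<integral>x. \<bar>indicator U (x + h n) - indicator U x\<bar> \<partial>lborel) \<longlonglongrightarrow> (0::real)"
proof -
  let ?i = "\<lambda>x. indicator U x :: real"
  have [measurable]: "U \<in> sets borel" using U by simp
  have int: "integrable lborel ?i" using U by auto
  have sh: "integrable lborel (\<lambda>x. ?i (x + c))" "(\<integral>x. ?i (x + c) \<partial>lborel) = (\<integral>x. ?i x \<partial>lborel)" for c
    using integrable_translate[OF int] integral_translate[of ?i c] by simp_all
  have prod: "integrable lborel (\<lambda>x. ?i x * ?i (x + c))" for c
    by (rule Bochner_Integration.integrable_bound[OF int]) (auto split: split_indicator)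
  have "(\<integral>x. \<bar>?i (x + c) - ?i x\<bar> \<partial>lborel) = (\<integral>x. ?i (x + c) + ?i x - 2 * (?i x * ?i (x + c)) \<partial>lborel)" for c
    by (intro Bochner_Integration.integral_cong) (auto split: split_indicator)
  then have eq: "(\<integral>x. \<bar>?i (x + c) - ?i x\<bar> \<partial>lborel) = 2 * (\<integral>x. ?i x \<partial>lborel) - 2 * (\<integral>x. ?i x * ?i (x + c) \<partial>lborel)" for c
    using int sh[of c] prod[of c] by simp
  have "(\<lambda>n. \<integral>x. ?i x * ?i (x + h n) \<partial>lborel) \<longlonglongrightarrow> (\<integral>x. ?i x \<partial>lborel)"
  proof (rule integral_dominated_convergence[OF _ _ int])
    show "AE x in lborel. (\<lambda>n. ?i x * ?i (x + h n)) \<longlonglongrightarrow> ?i x"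
    proof (rule AE_I2)
      fix x
      show "(\<lambda>n. ?i x * ?i (x + h n)) \<longlonglongrightarrow> ?i x"
      proof (cases "x \<in> U")
        case True
        have "(\<lambda>n. x + h n) \<longlonglongrightarrow> x + 0" using h by (intro tendsto_intros)
        then have "\<forall>\<^sub>F n in sequentially. x + h n \<in> U"
          using U(1) True by (auto dest: topological_tendstoD)
        then have "\<forall>\<^sub>F n in sequentially. ?i x * ?i (x + h n) = ?i x"
          by eventually_elim (use True in simp)
        then show ?thesis by (rule tendsto_eventually)
      qed simp
    qed
  qed (auto split: split_indicator)
  then have "(\<lambda>n. 2 * (\<integral>x. ?i x \<partial>lborel) - 2 * (\<integral>x. ?i x * ?i (x + h n) \<partial>lborel))
      \<longlonglongrightarrow> 2 * (\<integral>x. ?i x \<partial>lborel) - 2 * (\<integral>x. ?i x \<partial>lborel)"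
    by (intro tendsto_intros)
  then show ?thesis unfolding eq by simp
qed

text \<open>Functions with continuous translations form a closed set in L1. This passes the property
  from open sets to Borel sets, and again through the limit case of the induction on integrable
  functions.\<close>

lemma translation_approx_tendsto:
  fixes f :: "real \<Rightarrow> real"
  assumes f: "integrable lborel f"
    and approx: "\<And>e. 0 < e \<Longrightarrow> \<exists>g. integrable lborel g \<and> (\<integral>x. \<bar>f x - g x\<bar> \<partial>lborel) < e \<and>
      (\<lambda>n. shift_dist g (h n)) \<longlonglongrightarrow> (0::real)"
  shows "(\<lambda>n. shift_dist f (h n)) \<longlonglongrightarrow> 0"
proof (rule LIMSEQ_I)
  fix e :: real assume "0 < e"
  then obtain g where g: "integrable lborel g" "(\<integral>x. \<bar>f x - g x\<bar> \<partial>lborel) < e / 4"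
      and lim: "(\<lambda>n. shift_dist g (h n)) \<longlonglongrightarrow> 0"
    using approx[of "e / 4"] by auto
  obtain n0 where n0: "\<And>n. n \<ge> n0 \<Longrightarrow> norm (shift_dist g (h n) - 0) < e / 2"
    using LIMSEQ_D[OF lim, of "e / 2"] \<open>0 < e\<close> by auto
  show "\<exists>n0. \<forall>n\<ge>n0. norm (shift_dist f (h n) - 0) < e"
  proof (intro exI[of _ n0] allI impI)
    fix n assume "n0 \<le> n"
    moreover have "0 \<le> shift_dist f (h n)" by simp
    ultimately show "norm (shift_dist f (h n) - 0) < e"
      using n0[of n] translation_integral_le[OF f g(1), of "h n"] g(2) by simp
  qed
qed

text \<open>Outer regularity of Lebesgue measure reduces the case of an indicator to open sets; sums
  and dominated limits are then handled by induction on integrable functions.\<close>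

lemma translation_tendsto_L1:
  fixes f :: "real \<Rightarrow> real"
  assumes "integrable lborel f" and h: "h \<longlonglongrightarrow> 0"
  shows "(\<lambda>n. shift_dist f (h n)) \<longlonglongrightarrow> 0"
  using assms(1)
proof (induction rule: integrable_induct)
  case (base A c)
  have lim: "(\<lambda>n. \<integral>x. \<bar>indicator A (x + h n) - indicator A x\<bar> \<partial>lborel) \<longlonglongrightarrow> (0::real)"
  proof (rule translation_approx_tendsto)
    show "integrable lborel (indicat_real A)" using base by auto
    fix e :: real assume "0 < e"
    have "A \<in> sets lebesgue" using base by auto
    then obtain U where U: "open U" "A \<subseteq> U" and e: "emeasure lebesgue (U - A) < ennreal e"
      using sets_lebesgue_outer_open[OF _ \<open>0 < e\<close>] by metis
    have [measurable]: "A \<in> sets borel" "U \<in> sets borel" using base U by auto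
    have e: "emeasure lborel (U - A) < ennreal e" using e by simp
    have "emeasure lborel U \<le> emeasure lborel A + emeasure lborel (U - A)"
      using U(2) by (intro order.trans[OF _ emeasure_subadditive]) (auto simp: Un_absorb1)
    also have "\<dots> < \<infinity>" using base e by (auto simp: less_top[symmetric] top_unique)
    finally have fin: "emeasure lborel U < \<infinity>" .
    have "(\<integral>x. \<bar>indicat_real A x - indicat_real U x\<bar> \<partial>lborel) = (\<integral>x. indicat_real (U - A) x \<partial>lborel)"
      using U(2) by (intro Bochner_Integration.integral_cong) (auto split: split_indicator)
    also have "\<dots> < e"
      using e \<open>0 < e\<close> by (cases "emeasure lborel (U - A)") (auto simp: measure_def ennreal_less_iff)
    finally show "\<exists>g. integrable lborel g \<and> (\<integral>x. \<bar>indicat_real A x - g x\<bar> \<partial>lborel) < e \<and>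
        (\<lambda>n. shift_dist g (h n)) \<longlonglongrightarrow> 0"
      using fin translation_open_tendsto[OF U(1) fin h] by (intro exI[of _ "indicat_real U"]) auto
  qed
  have "\<bar>indicat_real A (x + h n) * c - indicat_real A x * c\<bar> = \<bar>indicat_real A (x + h n) - indicat_real A x\<bar> * \<bar>c\<bar>" for x n
    by (simp add: abs_mult[symmetric] left_diff_distrib)
  then show ?case
    using tendsto_mult_left_zero[OF lim, of "\<bar>c\<bar>"] by simp
next
  case (add f g)
  have "(\<lambda>n. shift_dist f (h n) + shift_dist g (h n)) \<longlonglongrightarrow> 0 + 0"
    using add by (intro tendsto_add)
  then have lim: "(\<lambda>n. shift_dist f (h n) + shift_dist g (h n)) \<longlonglongrightarrow> 0"
    by simp
  have "norm (\<integral>x. \<bar>f (x + h n) + g (x + h n) - (f x + g x)\<bar> \<partial>lborel) \<le>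
      shift_dist f (h n) + shift_dist g (h n)" for n
  proof -
    have "(\<integral>x. \<bar>f (x + h n) + g (x + h n) - (f x + g x)\<bar> \<partial>lborel) \<le>
        (\<integral>x. \<bar>f (x + h n) - f x\<bar> + \<bar>g (x + h n) - g x\<bar> \<partial>lborel)"
      using add(1,2)[THEN integrable_translate] add(1,2) by (intro integral_mono) auto
    also have "\<dots> = shift_dist f (h n) + shift_dist g (h n)"
      using add(1,2)[THEN integrable_translate] add(1,2) by simp
    finally show ?thesis by simp
  qed
  then show ?case
    by (intro Lim_null_comparison[OF _ lim] always_eventually) auto
next
  case (lim f s)
  show ?case
  proof (rule translation_approx_tendsto)
    show "integrable lborel f" by fact
    fix e :: real assume "0 < e"
    have "(\<lambda>i. \<integral>x. \<bar>f x - s i x\<bar> \<partial>lborel) \<longlonglongrightarrow> (\<integral>x. 0 \<partial>(lborel :: real measure))"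
    proof (rule integral_dominated_convergence)
      show "integrable lborel (\<lambda>x. 3 * \<bar>f x\<bar>)" using lim by simp
      show "AE x in lborel. (\<lambda>i. \<bar>f x - s i x\<bar>) \<longlonglongrightarrow> 0"
      proof (rule AE_I2)
        fix x assume "x \<in> space (lborel :: real measure)"
        then have "(\<lambda>i. \<bar>f x - s i x\<bar>) \<longlonglongrightarrow> \<bar>f x - f x\<bar>"
          using lim by (intro tendsto_intros) auto
        then show "(\<lambda>i. \<bar>f x - s i x\<bar>) \<longlonglongrightarrow> 0" by simp
      qed
      show "AE x in lborel. norm \<bar>f x - s i x\<bar> \<le> 3 * \<bar>f x\<bar>" for i
      proof (rule AE_I2)
        fix x :: real
        have "\<bar>s i x\<bar> \<le> 2 * \<bar>f x\<bar>" using lim by simp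
        then show "norm \<bar>f x - s i x\<bar> \<le> 3 * \<bar>f x\<bar>" by simp
      qed
    qed (use lim in auto)
    then obtain i where "norm ((\<integral>x. \<bar>f x - s i x\<bar> \<partial>lborel) - 0) < e"
      using LIMSEQ_D[OF _ \<open>0 < e\<close>] by fastforce
    then show "\<exists>g. integrable lborel g \<and> (\<integral>x. \<bar>f x - g x\<bar> \<partial>lborel) < e \<and>
        (\<lambda>n. shift_dist g (h n)) \<longlonglongrightarrow> 0"
      using lim by (intro exI[of _ "s i"]) auto
  qed
qed

text \<open>As the offset \<open>s\<close> runs through \<open>(0, h)\<close>, the grid points
  \<open>s + j * h\<close> sweep disjoint intervals. A bound on the integral of \<open>B\<close>
  therefore bounds its grid sum on average over the offsets.\<close>

lemma nn_integral_grid_le: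
  fixes B :: "real \<Rightarrow> ennreal"
  assumes [measurable]: "B \<in> borel_measurable borel" and "0 < h"
  shows "(\<integral>\<^sup>+s. (\<Sum>j<n. B (s + real j * h)) * indicator {0<..<h} s \<partial>lborel) \<le> (\<integral>\<^sup>+p. B p \<partial>lborel)"
proof -
  let ?J = "\<lambda>j::nat. {real j * h<..<real j * h + h}"
  have "disjoint_family_on ?J {..<n}"
  proof -
    have "i = j" if "p \<in> ?J i" "p \<in> ?J j" for i j p
    proof -
      have "real i * h < (real j + 1) * h" "real j * h < (real i + 1) * h"
        using that by (auto simp: algebra_simps)
      then have "real i < real j + 1" "real j < real i + 1"
        using \<open>0 < h\<close> by simp_all
      then show "i = j" by linarith
    qed
    then show ?thesis unfolding disjoint_family_on_def by blast
  qed
  then have le1: "(\<Sum>j<n. indicator (?J j) p) \<le> (1 :: ennreal)" for p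
    by (subst indicator_UN_disjoint[symmetric]) (auto split: split_indicator)
  have sh: "(\<integral>\<^sup>+s. B (s + real j * h) * indicator {0<..<h} s \<partial>lborel) = (\<integral>\<^sup>+p. B p * indicator (?J j) p \<partial>lborel)" for j
  proof -
    have "(\<integral>\<^sup>+p. B p * indicator (?J j) p \<partial>lborel) =
        (\<integral>\<^sup>+s. B (real j * h + 1 * s) * indicator (?J j) (real j * h + 1 * s) \<partial>lborel)"
      by (subst nn_integral_real_affine[of _ 1 "real j * h"]) auto
    also have "\<dots> = (\<integral>\<^sup>+s. B (s + real j * h) * indicator {0<..<h} s \<partial>lborel)"
      by (intro nn_integral_cong) (auto split: split_indicator simp: add.commute)
    finally show ?thesis by simp
  qed
  have "(\<integral>\<^sup>+s. (\<Sum>j<n. B (s + real j * h)) * indicator {0<..<h} s \<partial>lborel) =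
      (\<Sum>j<n. \<integral>\<^sup>+s. B (s + real j * h) * indicator {0<..<h} s \<partial>lborel)"
    unfolding sum_distrib_right by (intro nn_integral_sum) measurable
  also have "\<dots> = (\<integral>\<^sup>+p. (\<Sum>j<n. B p * indicator (?J j) p) \<partial>lborel)"
    unfolding sh by (intro nn_integral_sum[symmetric]) measurable
  also have "\<dots> \<le> (\<integral>\<^sup>+p. B p \<partial>lborel)"
    unfolding sum_distrib_left[symmetric] using mult_left_mono[OF le1] by (intro nn_integral_mono) fastforce
  finally show ?thesis .
qed

section \<open>Simple processes\<close>

abbreviation sq_error ::
    "real \<Rightarrow> (real \<Rightarrow> 'a \<Rightarrow> real) \<Rightarrow> nat \<Rightarrow> (nat \<Rightarrow> real) \<Rightarrow> (nat \<Rightarrow> 'a \<Rightarrow> real) \<Rightarrow> 'a \<Rightarrow> ennreal" where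
  "sq_error b \<alpha> n s \<xi> w \<equiv>
     \<integral>\<^sup>+r\<in>{0..b}. ennreal ((\<alpha> r w - simple_value n s \<xi> r w)\<^sup>2) \<partial>lborel"

lemma simple_process_strict_mono:
  assumes "simple_process M W b n s \<xi>" "i < j" "j \<le> n"
  shows "s i < s j"
  using assms(2,3)
proof (induction j)
  case (Suc j)
  have "s j < s (Suc j)" using assms(1) Suc.prems by (auto simp: simple_process_def)
  then show ?case using Suc by (cases "i = j") auto
qed simp

lemma simple_process_mono:
  assumes "simple_process M W b n s \<xi>" "i \<le> j" "j \<le> n"
  shows "s i \<le> s j"
  using simple_process_strict_mono[OF assms(1), of i j] assms by (cases "i = j") auto

lemma simple_process_nonneg: "simple_process M W b n s \<xi> \<Longrightarrow> i \<le> n \<Longrightarrow> 0 \<le> s i"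
  using simple_process_mono[of M W b n s \<xi> 0 i] by (auto simp: simple_process_def)

lemma simple_process_le: "simple_process M W b n s \<xi> \<Longrightarrow> i \<le> n \<Longrightarrow> s i \<le> b"
  using simple_process_mono[of M W b n s \<xi> i n] by (auto simp: simple_process_def)

lemma simple_value_eq:
  assumes "simple_process M W b n s \<xi>" "i < n" "r \<in> {s i<..s (Suc i)}"
  shows "simple_value n s \<xi> r w = \<xi> i w"
proof -
  have "r \<notin> {s j<..s (Suc j)}" if "j < n" "j \<noteq> i" for j
    using simple_process_mono[OF assms(1), of "Suc i" j] simple_process_mono[OF assms(1), of "Suc j" i] assms that
    by (cases i j rule: linorder_cases) auto
  then have "simple_value n s \<xi> r w = (\<Sum>j<n. if j = i then \<xi> i w else 0)"
    unfolding simple_value_def using assms(3) by (intro sum.cong) auto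
  then show ?thesis using assms(2) by simp
qed

lemma simple_process_cover:
  assumes "simple_process M W b n s \<xi>" "r \<in> {0<..b}"
  obtains i where "i < n" "r \<in> {s i<..s (Suc i)}"
proof -
  have "\<exists>i<m. r \<in> {s i<..s (Suc i)}" if "m \<le> n" "r \<in> {0<..s m}" for m
    using that
  proof (induction m)
    case 0
    then show ?case using assms(1) by (auto simp: simple_process_def)
  next
    case (Suc m)
    then show ?case by (cases "r \<le> s m") (auto simp: less_Suc_eq)
  qed
  then show thesis using that assms by (auto simp: simple_process_def)
qed

lemma simple_value_outside:
  assumes "simple_process M W b n s \<xi>" "r \<notin> {0<..b}"
  shows "simple_value n s \<xi> r w = 0"
  unfolding simple_value_def
proof (intro sum.neutral ballI)
  fix i assume "i \<in> {..<n}"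
  then have "r \<notin> {s i<..s (Suc i)}"
    using simple_process_nonneg[OF assms(1), of i] simple_process_le[OF assms(1), of "Suc i"] assms(2) by auto
  then show "\<xi> i w * indicator {s i<..s (Suc i)} r = 0" by simp
qed

section \<open>Brownian increments on the completed probability space\<close>

context brownian_motion
begin

abbreviation "N \<equiv> completion M"
abbreviation "F \<equiv> augmented_filtration M W"

interpretation N: prob_space N
  by (rule prob_space_completion)

lemma space_F [simp]: "space (F t) = space M"
  by (simp add: augmented_filtration_def space_measure_of_conv)

lemma sets_natural_filtration:
  "sets (natural_filtration M W t) = sigma_sets (space M) {W s -` A \<inter> space M | s A. s \<in> {0..t} \<and> A \<in> sets borel}"
  unfolding natural_filtration_def by (rule sets_measure_of) auto

lemma sets_natural_filtration_subset: "sets (natural_filtration M W t) \<subseteq> sets M"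
  unfolding sets_natural_filtration
  by (intro sets.sigma_sets_subset) (auto intro!: measurable_sets[OF random_variable_W])

lemma space_natural_filtration [simp]: "space (natural_filtration M W t) = space M"
  by (simp add: natural_filtration_def space_measure_of_conv)

lemma null_sets_N_subset: "A \<in> null_sets N \<Longrightarrow> A \<subseteq> space M"
  using sets.sets_into_space[of A N] by auto

lemma sets_F:
  "sets (F t) = sigma_sets (space M) (sets (natural_filtration M W t) \<union> null_sets N)"
  unfolding augmented_filtration_def
  using sets.space_closed[of "natural_filtration M W t"] null_sets_N_subset
  by (intro sets_measure_of) auto

lemma sets_F_subset: "sets (F t) \<subseteq> sets N"
  using sets.sigma_sets_subset[of "sets (natural_filtration M W t) \<union> null_sets N" N]
    sets_natural_filtration_subset[of t]
  unfolding sets_F by auto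

lemma sets_F_mono: "s \<le> t \<Longrightarrow> sets (F s) \<subseteq> sets (F t)"
  unfolding sets_F sets_natural_filtration
  by (intro sigma_sets_mono' Un_mono subset_refl) (fastforce intro!: sigma_sets_mono')

lemma measurable_F_N: "f \<in> F t \<rightarrow>\<^sub>M S \<Longrightarrow> f \<in> N \<rightarrow>\<^sub>M S"
  using sets_F_subset[of t] by (auto simp: measurable_def)

lemma measurable_F_mono: "f \<in> F s \<rightarrow>\<^sub>M S \<Longrightarrow> s \<le> t \<Longrightarrow> f \<in> F t \<rightarrow>\<^sub>M S"
  using sets_F_mono[of s t] by (auto simp: measurable_def)

lemma W_measurable_F: "0 \<le> s \<Longrightarrow> s \<le> t \<Longrightarrow> W s \<in> borel_measurable (F t)"
proof (rule measurableI)
  fix A :: "real set" assume "0 \<le> s" "s \<le> t" "A \<in> sets borel"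
  then have "W s -` A \<inter> space M \<in> sets (natural_filtration M W t)"
    unfolding sets_natural_filtration by (intro sigma_sets.Basic) auto
  then show "W s -` A \<inter> space (F t) \<in> sets (F t)"
    unfolding sets_F by (auto intro: sigma_sets.Basic)
qed simp

text \<open>Sets that agree with a natural one up to a null set form a sigma-algebra. This transfers
  the independence of increments to the augmented filtration.\<close>

lemma F_eq_natural_upto_null:
  assumes "A \<in> sets (F t)"
  shows "\<exists>B\<in>sets (natural_filtration M W t). (A - B) \<union> (B - A) \<in> null_sets N"
  using assms unfolding sets_F
proof induction
  case (Basic A)
  then show ?case
  proof
    assume "A \<in> sets (natural_filtration M W t)"
    then show ?thesis by (intro bexI[of _ A]) auto
  next
    assume "A \<in> null_sets N"
    then show ?thesis by (intro bexI[of _ "{}"]) auto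
  qed
next
  case Empty
  show ?case by (intro bexI[of _ "{}"]) auto
next
  case (Compl A)
  then obtain B where B: "B \<in> sets (natural_filtration M W t)" "(A - B) \<union> (B - A) \<in> null_sets N" by auto
  have "A \<subseteq> space M" using Compl(1) sets.space_closed[of "F t"] by (auto simp: sets_F)
  moreover have "B \<subseteq> space M" using B sets.space_closed[of "natural_filtration M W t"] by auto
  ultimately have "((space M - A) - (space M - B)) \<union> ((space M - B) - (space M - A)) = (A - B) \<union> (B - A)" by auto
  then show ?case
    using B sets.compl_sets[OF B(1)] by (intro bexI[of _ "space M - B"]) auto
next
  case (Union A)
  then obtain B where B: "\<And>i. B i \<in> sets (natural_filtration M W t)" "\<And>i::nat. (A i - B i) \<union> (B i - A i) \<in> null_sets N"
    by metis
  have "(\<Union>i. (A i - B i) \<union> (B i - A i)) \<in> null_sets N"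
    using B(2) by (intro null_sets_UN) auto
  moreover have "((\<Union>i. A i) - (\<Union>i. B i)) \<union> ((\<Union>i. B i) - (\<Union>i. A i)) \<in> sets N"
  proof -
    have "A i \<in> sets N" "B i \<in> sets N" for i
      using Union(1)[of i] sets_F_subset[of t] B(1)[of i] sets_natural_filtration_subset[of t] by (auto simp: sets_F)
    then show ?thesis by auto
  qed
  ultimately have "((\<Union>i. A i) - (\<Union>i. B i)) \<union> ((\<Union>i. B i) - (\<Union>i. A i)) \<in> null_sets N"
    by (rule null_sets_subset) auto
  then show ?case
    using B(1) by (intro bexI[of _ "\<Union>i. B i"]) auto
qed

lemma increment_indep_F:
  assumes "0 \<le> s" "s < t"
  shows "N.indep_set (sets (F s)) (sets (vimage_algebra (space M) (\<lambda>w. W t w - W s w) borel))"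
  unfolding N.indep_sets2_eq
proof (intro conjI ballI)
  let ?V = "vimage_algebra (space M) (\<lambda>w. W t w - W s w) borel"
  note ind = W_increment_indep[OF assms, unfolded indep_sets2_eq]
  show "sets (F s) \<subseteq> sets N" by (rule sets_F_subset)
  show "sets ?V \<subseteq> sets N" using ind by auto
  fix A C assume A: "A \<in> sets (F s)" and C: "C \<in> sets ?V"
  then obtain B where B: "B \<in> sets (natural_filtration M W s)" and null: "(A - B) \<union> (B - A) \<in> null_sets N"
    using F_eq_natural_upto_null by blast
  have [measurable]: "A \<in> sets N" "B \<in> sets N" "C \<in> sets N" and M: "B \<in> sets M" "C \<in> sets M"
    using A B C ind sets_F_subset by auto
  have ae: "AE w in N. w \<in> A \<longleftrightarrow> w \<in> B"
    using AE_not_in[OF null] by eventually_elim auto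
  have "N.prob (A \<inter> C) = N.prob (B \<inter> C)" "N.prob A = N.prob B"
    using ae by (auto intro!: N.finite_measure_eq_AE)
  moreover have "prob (B \<inter> C) = prob B * prob C"
    using ind B C by blast
  ultimately show "N.prob (A \<inter> C) = N.prob A * N.prob C"
    using M by simp
qed

lemma increment_measurable [measurable]:
  "0 \<le> s \<Longrightarrow> 0 \<le> t \<Longrightarrow> (\<lambda>w. W t w - W s w) \<in> borel_measurable N"
  by (intro borel_measurable_diff measurable_completion random_variable_W)

text \<open>The target space is arbitrary so that a pair of \<open>F s\<close>-measurable variables,
  a state and a volatility, can be taken jointly independent of the increment.\<close>

lemma distr_pair_increment:
  assumes "0 \<le> s" "s < t" and X: "X \<in> F s \<rightarrow>\<^sub>M S"
  shows "distr N S X \<Otimes>\<^sub>M distr N borel (\<lambda>w. W t w - W s w) =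
    distr N (S \<Otimes>\<^sub>M borel) (\<lambda>w. (X w, W t w - W s w))"
proof -
  let ?D = "\<lambda>w. W t w - W s w"
  have D [measurable]: "?D \<in> borel_measurable N" using assms by (intro increment_measurable) auto
  have XN [measurable]: "X \<in> N \<rightarrow>\<^sub>M S" using X by (rule measurable_F_N)
  interpret P: prob_space "distr N S X" by (intro N.prob_space_distr XN)
  interpret Q: prob_space "distr N borel ?D" by (intro N.prob_space_distr D)
  show ?thesis
  proof (rule pair_measure_eqI)
    fix A B assume "A \<in> sets (distr N S X)" "B \<in> sets (distr N borel ?D)"
    then have A [measurable]: "A \<in> sets S" and B [measurable]: "B \<in> sets borel" by auto
    have "X -` A \<inter> space M \<in> sets (F s)" using measurable_sets[OF X A] by simp
    moreover have "?D -` B \<inter> space M \<in> sets (vimage_algebra (space M) ?D borel)"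
      using B by (rule in_vimage_algebra)
    ultimately have "N.prob ((X -` A \<inter> space M) \<inter> (?D -` B \<inter> space M)) =
        N.prob (X -` A \<inter> space M) * N.prob (?D -` B \<inter> space M)"
      using increment_indep_F[OF assms(1,2)] unfolding N.indep_sets2_eq by blast
    moreover have "(X -` A \<inter> space M) \<inter> (?D -` B \<inter> space M) = (\<lambda>w. (X w, ?D w)) -` (A \<times> B) \<inter> space M"
      by auto
    ultimately show "emeasure (distr N S X) A * emeasure (distr N borel ?D) B =
        emeasure (distr N (S \<Otimes>\<^sub>M borel) (\<lambda>w. (X w, ?D w))) (A \<times> B)"
      by (subst (1 2 3) emeasure_distr) (auto simp: N.emeasure_eq_measure ennreal_mult simp del: emeasure_completion)
  qed (auto intro: P.sigma_finite_measure_axioms Q.sigma_finite_measure_axioms)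
qed

lemma indep_var_increment:
  assumes "0 \<le> s" "s < t" and X: "X \<in> borel_measurable (F s)"
  shows "N.indep_var borel X borel (\<lambda>w. W t w - W s w)"
  unfolding N.indep_var_distribution_eq
  using distr_pair_increment[OF assms] measurable_F_N[OF X] assms by (auto intro!: increment_measurable)

lemma increment_normal:
  assumes "0 \<le> s" "s < t"
  shows "distributed N lborel (\<lambda>w. W t w - W s w) (normal_density 0 (sqrt (t - s)))"
  using W_increment_normal[OF assms] unfolding distributed_def
  by (auto simp: distr_completion measurable_completion)

lemma increment_moments:
  assumes "0 \<le> s" "s < t"
  shows "has_bochner_integral N (\<lambda>w. W t w - W s w) 0"
    and "has_bochner_integral N (\<lambda>w. (W t w - W s w)\<^sup>2) (t - s)"
    and "integrable N (\<lambda>w. \<bar>W t w - W s w\<bar>)"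
proof -
  have pos: "0 < sqrt (t - s)" using assms by simp
  note D = increment_normal[OF assms]
  note q = has_bochner_integral_gauss_shifted_quartic[of 0 _ 0 "sqrt (t - s)" _ 0]
  show 1: "has_bochner_integral N (\<lambda>w. W t w - W s w) 0"
    using N.integrable_normal_increment[OF D pos, of "\<lambda>x. x"] N.expectation_normal_increment[OF D pos, of "\<lambda>x. x" 0 1] q[of 1 0]
    by (simp add: has_bochner_integral_iff heat_def)
  show "has_bochner_integral N (\<lambda>w. (W t w - W s w)\<^sup>2) (t - s)"
    using N.integrable_normal_increment[OF D pos, of "\<lambda>x. x\<^sup>2"] N.expectation_normal_increment[OF D pos, of "\<lambda>x. x\<^sup>2" 0 1] q[of 0 1] assms
    by (simp add: has_bochner_integral_iff heat_def)
  show "integrable N (\<lambda>w. \<bar>W t w - W s w\<bar>)"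
    using 1 by (auto simp: has_bochner_integral_iff)
qed

lemma has_bochner_integral_times_increment:
  assumes "0 \<le> s" "s \<le> t" and Z: "Z \<in> borel_measurable (F s)" "integrable N Z"
  shows "has_bochner_integral N (\<lambda>w. Z w * (W t w - W s w)) 0"
proof (cases "s = t")
  case False
  then have st: "s < t" using assms by simp
  note m = increment_moments(1)[OF assms(1) st, unfolded has_bochner_integral_iff]
  show ?thesis
    using N.indep_var_lebesgue_integral[OF indep_var_increment[OF assms(1) st Z(1)] Z(2)]
      N.indep_var_integrable[OF indep_var_increment[OF assms(1) st Z(1)] Z(2)] m
    by (simp add: has_bochner_integral_iff)
qed (simp add: has_bochner_integral_zero)

lemma has_bochner_integral_times_increment_square:
  assumes "0 \<le> s" "s \<le> t" and Z: "Z \<in> borel_measurable (F s)" "integrable N Z"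
  shows "has_bochner_integral N (\<lambda>w. Z w * (W t w - W s w)\<^sup>2) ((\<integral>w. Z w \<partial>N) * (t - s))"
proof (cases "s = t")
  case False
  then have st: "s < t" using assms by simp
  note m = increment_moments(2)[OF assms(1) st, unfolded has_bochner_integral_iff]
  have "N.indep_var borel Z borel (\<lambda>w. (W t w - W s w)\<^sup>2)"
    using N.indep_var_compose[OF indep_var_increment[OF assms(1) st Z(1)], of "\<lambda>x. x" borel "\<lambda>x. x\<^sup>2" borel]
    by (simp add: comp_def)
  from N.indep_var_lebesgue_integral[OF this Z(2)] N.indep_var_integrable[OF this Z(2)] m
  show ?thesis by (simp add: has_bochner_integral_iff)
qed (simp add: has_bochner_integral_zero)

lemma integrable_bounded_times:
  assumes "\<xi> \<in> borel_measurable N" "\<And>w. w \<in> space M \<Longrightarrow> \<bar>\<xi> w\<bar> \<le> (C::real)" "integrable N X"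
  shows "integrable N (\<lambda>w. \<xi> w * X w)"
proof (rule Bochner_Integration.integrable_bound)
  show "integrable N (\<lambda>w. \<bar>C\<bar> * \<bar>X w\<bar>)" using assms(3) by simp
  show "(\<lambda>w. \<xi> w * X w) \<in> borel_measurable N" using assms(1,3) by auto
  show "AE w in N. norm (\<xi> w * X w) \<le> norm (\<bar>C\<bar> * \<bar>X w\<bar>)"
  proof (rule AE_I2)
    fix w assume "w \<in> space N"
    then have "\<bar>\<xi> w\<bar> \<le> \<bar>C\<bar>" using assms(2)[of w] by simp
    then show "norm (\<xi> w * X w) \<le> norm (\<bar>C\<bar> * \<bar>X w\<bar>)"
      by (simp add: abs_mult mult_right_mono)
  qed
qed

text \<open>The freezing principle, in the role of a conditional expectation:
  \<open>(X, \<xi>)\<close> is independent of the increment, so Fubini on the joint law holds both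
  fixed, and the inner integral over the increment is a Gaussian average.\<close>

lemma expectation_lipschitz_step:
  assumes f: "L-lipschitz_on UNIV f" and "0 \<le> s" "s < t"
    and X [measurable]: "X \<in> borel_measurable (F s)" and iX: "integrable N X"
    and \<xi> [measurable]: "\<xi> \<in> borel_measurable (F s)" and C: "\<And>w. w \<in> space M \<Longrightarrow> \<bar>\<xi> w\<bar> \<le> C"
  shows "integrable N (\<lambda>w. X w + \<xi> w * (W t w - W s w))"
    and "(\<integral>w. f (X w + \<xi> w * (W t w - W s w)) \<partial>N) = (\<integral>w. heat (\<xi> w * sqrt (t - s)) f (X w) \<partial>N)"
    and "integrable N (\<lambda>w. heat (\<xi> w * sqrt (t - s)) f (X w))"
proof -
  let ?D = "\<lambda>w. W t w - W s w" and ?X = "\<lambda>w. (X w, \<xi> w)" and ?g = "\<lambda>q. f (fst (fst q) + snd (fst q) * snd q)"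
  let ?P = "distr N (borel \<Otimes>\<^sub>M borel) ?X" and ?Q = "distr N borel ?D"
  note [measurable] = borel_measurable_lipschitz[OF f] measurable_F_N[OF X] measurable_F_N[OF \<xi>]
  have D [measurable]: "?D \<in> borel_measurable N" using assms by (intro increment_measurable) auto
  have i\<xi>: "integrable N (\<lambda>w. \<xi> w * ?D w)"
    using increment_moments(1)[OF assms(2,3)] C
    by (intro integrable_bounded_times[of _ C]) (auto simp: has_bochner_integral_iff)
  with iX show i: "integrable N (\<lambda>w. X w + \<xi> w * ?D w)" by simp
  have fi: "integrable N (\<lambda>w. f (X w + \<xi> w * ?D w))"
    using f i by (rule N.integrable_lipschitz)
  have "?X \<in> F s \<rightarrow>\<^sub>M borel \<Otimes>\<^sub>M borel" by measurable
  then have prod: "?P \<Otimes>\<^sub>M ?Q = distr N ((borel \<Otimes>\<^sub>M borel) \<Otimes>\<^sub>M borel) (\<lambda>w. (?X w, ?D w))"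
    by (rule distr_pair_increment[OF assms(2,3)])
  interpret P: prob_space ?P by (intro N.prob_space_distr) measurable
  interpret Q: prob_space ?Q by (intro N.prob_space_distr) measurable
  interpret PQ: pair_sigma_finite ?P ?Q ..
  have g: "?g \<in> borel_measurable ((borel \<Otimes>\<^sub>M borel) \<Otimes>\<^sub>M borel)" by measurable
  have ig: "integrable (?P \<Otimes>\<^sub>M ?Q) ?g"
    unfolding prod using fi g by (subst integrable_distr_eq) (auto simp: split_beta)
  have inner: "(\<integral>w. ?g (p, w) \<partial>?Q) = heat (snd p * sqrt (t - s)) f (fst p)" for p
    using N.expectation_normal_increment[OF increment_normal[OF assms(2,3)], of f "fst p" "snd p"] assms(3)
    by (subst integral_distr) (auto simp: split_beta)
  have "(\<integral>w. f (X w + \<xi> w * ?D w) \<partial>N) = (\<integral>q. ?g q \<partial>(?P \<Otimes>\<^sub>M ?Q))"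
    unfolding prod using g by (subst integral_distr) (auto simp: split_beta)
  also have "\<dots> = (\<integral>p. (\<integral>w. ?g (p, w) \<partial>?Q) \<partial>?P)"
    using PQ.integral_fst'[OF ig] by simp
  also have "\<dots> = (\<integral>p. heat (snd p * sqrt (t - s)) f (fst p) \<partial>?P)"
    unfolding inner ..
  also have "\<dots> = (\<integral>w. heat (\<xi> w * sqrt (t - s)) f (X w) \<partial>N)"
    by (subst integral_distr) (auto intro!: heat_measurable)
  finally show "(\<integral>w. f (X w + \<xi> w * ?D w) \<partial>N) = (\<integral>w. heat (\<xi> w * sqrt (t - s)) f (X w) \<partial>N)" .
  have "integrable ?P (\<lambda>p. heat (snd p * sqrt (t - s)) f (fst p))"
    using PQ.integrable_fst'[OF ig] unfolding inner .
  then show "integrable N (\<lambda>w. heat (\<xi> w * sqrt (t - s)) f (X w))"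
    by (subst (asm) integrable_distr_eq) (auto intro!: heat_measurable)
qed

section \<open>The Ito isometry for finite sums over arbitrary intervals\<close>

definition overlap :: "real \<Rightarrow> real \<Rightarrow> real \<Rightarrow> real \<Rightarrow> real" where
  "overlap a b c d = max 0 (min b d - max a c)"

text \<open>\<open>overlap\<close> is the length of the intersection of the two half-open intervals;
  the maximum with 0 takes care of disjoint ones.\<close>

lemma has_bochner_integral_overlap:
  "has_bochner_integral lborel (\<lambda>r. indicator {a<..b} r * indicator {c<..d} r) (overlap a b c d)"
proof -
  have "{a<..b} \<inter> {c<..d} = {max a c<..min b d}" by auto
  moreover have "measure lborel {max a c<..min b d} = overlap a b c d"
    by (cases "max a c \<le> min b d") (auto simp: overlap_def)
  moreover have "emeasure lborel {max a c<..min b d} < \<infinity>"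
    by (cases "max a c \<le> min b d") auto
  ultimately show ?thesis
    using has_bochner_integral_real_indicator[of "{max a c<..min b d}" lborel]
    by (simp add: indicator_inter_arith[symmetric])
qed

text \<open>The intervals may overlap, since two simple processes to be compared have unrelated
  grids. With the left end points in order, products of increments over separated intervals have
  mean zero, and only the squared increment over the common part survives.\<close>

lemma increment_covariance:
  assumes "0 \<le> a" "a < b" "0 \<le> c" "c < d"
    and "\<xi> \<in> borel_measurable (F a)" "\<And>w. w \<in> space M \<Longrightarrow> \<bar>\<xi> w\<bar> \<le> C"
    and "\<eta> \<in> borel_measurable (F c)" "\<And>w. w \<in> space M \<Longrightarrow> \<bar>\<eta> w\<bar> \<le> D"
  shows "has_bochner_integral N (\<lambda>w. (\<xi> w * (W b w - W a w)) * (\<eta> w * (W d w - W c w)))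
    ((\<integral>w. \<xi> w * \<eta> w \<partial>N) * overlap a b c d)"
proof -
  have ordered: "has_bochner_integral N (\<lambda>w. (\<xi> w * (W b w - W a w)) * (\<eta> w * (W d w - W c w)))
    ((\<integral>w. \<xi> w * \<eta> w \<partial>N) * overlap a b c d)"
    if "0 \<le> a" "a < b" "c < d" "a \<le> c"
      and \<xi>: "\<xi> \<in> borel_measurable (F a)" "\<And>w. w \<in> space M \<Longrightarrow> \<bar>\<xi> w\<bar> \<le> C"
      and \<eta> [measurable]: "\<eta> \<in> borel_measurable (F c)" "\<And>w. w \<in> space M \<Longrightarrow> \<bar>\<eta> w\<bar> \<le> D"
    for a b c d \<xi> \<eta> C D
  proof -
    have "0 \<le> c" using that by simp
    have [measurable]: "\<xi> \<in> borel_measurable (F c)" using \<xi>(1) \<open>a \<le> c\<close> by (rule measurable_F_mono)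
    then have \<xi>\<eta> [measurable]: "(\<lambda>w. \<xi> w * \<eta> w) \<in> borel_measurable (F c)" by measurable
    have bd: "\<bar>\<xi> w * \<eta> w\<bar> \<le> C * D" if "w \<in> space M" for w
      unfolding abs_mult using \<xi>(2) \<eta>(2) that by (intro mult_mono) (auto intro: order.trans[OF abs_ge_zero])
    have int: "integrable N (\<lambda>w. (\<xi> w * \<eta> w) * X w)" if "integrable N X" for X
      using measurable_F_N[OF \<xi>\<eta>] bd that by (rule integrable_bounded_times)
    have W: "W r \<in> borel_measurable (F c')" if "0 \<le> r" "r \<le> c'" for r c'
      using W_measurable_F that .
    have inc: "integrable N (\<lambda>w. W t w - W s w)" if "0 \<le> s" "s \<le> t" for s t
      using increment_moments(1)[of s t] that by (cases "s = t") (auto simp: has_bochner_integral_iff)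
    have early: "has_bochner_integral N (\<lambda>w. ((\<xi> w * \<eta> w) * (W t w - W s w)) * (W t' w - W s' w)) 0"
      if "0 \<le> s" "s \<le> t" "t \<le> s'" "s' \<le> t'" "c \<le> s'" for s t s' t'
    proof (rule has_bochner_integral_times_increment)
      have "(\<lambda>w. \<xi> w * \<eta> w) \<in> borel_measurable (F s')" using measurable_F_mono[OF \<xi>\<eta>] that by simp
      then show "(\<lambda>w. \<xi> w * \<eta> w * (W t w - W s w)) \<in> borel_measurable (F s')"
        by (rule borel_measurable_times[OF _ borel_measurable_diff]) (use that in \<open>auto intro: W\<close>)
      show "integrable N (\<lambda>w. \<xi> w * \<eta> w * (W t w - W s w))"
        using that by (intro int inc)
    qed (use that in auto)
    show ?thesis
    proof (cases "b \<le> c")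
      case True
      then have "overlap a b c d = 0" using that by (auto simp: overlap_def)
      then show ?thesis
        using early[of a b c d] that True by (simp add: ac_simps)
    next
      case False
      \<comment> \<open>The common part is \<open>{c<..m}\<close>. The increment from
        \<open>a\<close> to \<open>b\<close> splits at \<open>c\<close> and \<open>m\<close>, and
        its middle part times \<open>W d - W c\<close> splits once more at \<open>m\<close>. In the
        last of the four products, \<open>W b - W m\<close> is zero or starts at
        \<open>d\<close>.\<close>
      define m where "m = min b d"
      have m: "c < m" "m \<le> b" "m \<le> d" "m = b \<or> m = d" using False that by (auto simp: m_def)
      have "overlap a b c d = m - c" using m that by (auto simp: overlap_def m_def)
      have 1: "has_bochner_integral N (\<lambda>w. ((\<xi> w * \<eta> w) * (W c w - W a w)) * (W d w - W c w)) 0"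
        using that by (intro early) auto
      have 2: "has_bochner_integral N (\<lambda>w. (\<xi> w * \<eta> w) * (W m w - W c w)\<^sup>2) ((\<integral>w. \<xi> w * \<eta> w \<partial>N) * (m - c))"
        using int[of "\<lambda>_. 1"] m \<open>0 \<le> c\<close>
        by (intro has_bochner_integral_times_increment_square) auto
      have 3: "has_bochner_integral N (\<lambda>w. ((\<xi> w * \<eta> w) * (W m w - W c w)) * (W d w - W m w)) 0"
        using m \<open>0 \<le> c\<close> by (intro early) auto
      have 4: "has_bochner_integral N (\<lambda>w. ((\<xi> w * \<eta> w) * (W d w - W c w)) * (W b w - W m w)) 0"
        using m(4)
      proof
        assume "m = d"
        then show ?thesis using m \<open>0 \<le> c\<close> by (intro early) auto
      qed (simp add: has_bochner_integral_zero)
      have "has_bochner_integral N (\<lambda>w. ((\<xi> w * \<eta> w) * (W c w - W a w)) * (W d w - W c w)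
         + (\<xi> w * \<eta> w) * (W m w - W c w)\<^sup>2 + ((\<xi> w * \<eta> w) * (W m w - W c w)) * (W d w - W m w)
         + ((\<xi> w * \<eta> w) * (W d w - W c w)) * (W b w - W m w))
         (0 + (\<integral>w. \<xi> w * \<eta> w \<partial>N) * (m - c) + 0 + 0)"
        by (intro has_bochner_integral_add 1 2 3 4)
      moreover have "((\<xi> w * \<eta> w) * (W c w - W a w)) * (W d w - W c w)
         + (\<xi> w * \<eta> w) * (W m w - W c w)\<^sup>2 + ((\<xi> w * \<eta> w) * (W m w - W c w)) * (W d w - W m w)
         + ((\<xi> w * \<eta> w) * (W d w - W c w)) * (W b w - W m w)
         = (\<xi> w * (W b w - W a w)) * (\<eta> w * (W d w - W c w))" for w
        by algebra
      ultimately show ?thesis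
        using \<open>overlap a b c d = m - c\<close> by simp
    qed
  qed
  show ?thesis
  proof (cases "a \<le> c")
    case True
    then show ?thesis using assms by (intro ordered) auto
  next
    case False
    have "overlap a b c d = overlap c d a b" by (simp add: overlap_def min.commute max.commute)
    then show ?thesis
      using ordered[of c d a b \<eta> D \<xi> C] assms False by (simp add: mult.commute)
  qed
qed

text \<open>Both sides reduce to the double sum of the means of \<open>\<xi> i * \<xi> j\<close>
  times the overlap lengths. The index set is unordered and the intervals may overlap, so a
  difference of two simple processes is itself an instance.\<close>

lemma ito_isometry:
  assumes "finite I"
    and ab: "\<And>i. i \<in> I \<Longrightarrow> 0 \<le> a i" "\<And>i. i \<in> I \<Longrightarrow> a i < b i" "\<And>i. i \<in> I \<Longrightarrow> b i \<le> T"
    and \<xi>: "\<And>i. i \<in> I \<Longrightarrow> \<xi> i \<in> borel_measurable (F (a i))"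
      "\<And>i w. i \<in> I \<Longrightarrow> w \<in> space M \<Longrightarrow> \<bar>\<xi> i w\<bar> \<le> C i"
  shows "(\<integral>\<^sup>+w. ennreal ((\<Sum>i\<in>I. \<xi> i w * (W (b i) w - W (a i) w))\<^sup>2) \<partial>N) =
    (\<integral>\<^sup>+w. (\<integral>\<^sup>+r\<in>{0..T}. ennreal ((\<Sum>i\<in>I. \<xi> i w * indicator {a i<..b i} r)\<^sup>2) \<partial>lborel) \<partial>N)"
proof -
  let ?o = "\<lambda>i j. overlap (a i) (b i) (a j) (b j)"
  let ?S = "\<lambda>w. \<Sum>i\<in>I. \<Sum>j\<in>I. \<xi> i w * \<xi> j w * ?o i j"
  let ?V = "\<lambda>w r. \<Sum>i\<in>I. \<xi> i w * indicator {a i<..b i} r"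
  have "has_bochner_integral N (\<lambda>w. (\<Sum>i\<in>I. \<xi> i w * (W (b i) w - W (a i) w))\<^sup>2)
      (\<Sum>i\<in>I. \<Sum>j\<in>I. (\<integral>w. \<xi> i w * \<xi> j w \<partial>N) * ?o i j)"
    unfolding power2_eq_square sum_product
    using ab \<xi> by (intro has_bochner_integral_sum increment_covariance) auto
  then have lhs: "(\<integral>\<^sup>+w. ennreal ((\<Sum>i\<in>I. \<xi> i w * (W (b i) w - W (a i) w))\<^sup>2) \<partial>N) =
      ennreal (\<Sum>i\<in>I. \<Sum>j\<in>I. (\<integral>w. \<xi> i w * \<xi> j w \<partial>N) * ?o i j)"
    by (auto simp: has_bochner_integral_iff nn_integral_eq_integral)
  have inner: "(\<integral>\<^sup>+r\<in>{0..T}. ennreal ((?V w r)\<^sup>2) \<partial>lborel) =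
      ennreal (?S w)" 
    and nonneg: "0 \<le> (?S w)" for w
  proof -
    have "has_bochner_integral lborel (\<lambda>r. \<Sum>i\<in>I. \<Sum>j\<in>I. \<xi> i w * \<xi> j w * (indicator {a i<..b i} r * indicator {a j<..b j} r))
        (?S w)"
      by (intro has_bochner_integral_sum has_bochner_integral_mult_right has_bochner_integral_overlap)
    moreover have "(\<Sum>i\<in>I. \<Sum>j\<in>I. \<xi> i w * \<xi> j w * (indicator {a i<..b i} r * indicator {a j<..b j} r)) =
        (?V w r)\<^sup>2" for r
      unfolding power2_eq_square sum_product by (simp add: ac_simps)
    ultimately have h: "has_bochner_integral lborel (\<lambda>r. (?V w r)\<^sup>2)
        (?S w)" by simp
    have "(?V w r) = 0" if "r \<notin> {0..T}" for r
    proof (rule sum.neutral, rule ballI)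
      fix i assume "i \<in> I"
      then have "r \<notin> {a i<..b i}" using ab[of i] that by auto
      then show "\<xi> i w * indicator {a i<..b i} r = 0" by simp
    qed
    then have "(\<integral>\<^sup>+r\<in>{0..T}. ennreal ((?V w r)\<^sup>2) \<partial>lborel) =
        (\<integral>\<^sup>+r. ennreal ((?V w r)\<^sup>2) \<partial>lborel)"
      by (intro nn_integral_cong) (auto split: split_indicator)
    also have "\<dots> = ennreal (?S w)"
      using h by (auto simp: has_bochner_integral_iff nn_integral_eq_integral)
    finally show "(\<integral>\<^sup>+r\<in>{0..T}. ennreal ((?V w r)\<^sup>2) \<partial>lborel) =
      ennreal (?S w)" .
    show "0 \<le> (?S w)"
      using h integral_nonneg_AE[of "\<lambda>r. (?V w r)\<^sup>2" lborel]
      by (simp add: has_bochner_integral_iff)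
  qed
  have "integrable N (\<lambda>w. \<xi> i w * \<xi> j w)" if "i \<in> I" "j \<in> I" for i j
  proof (rule integrable_bounded_times)
    show "integrable N (\<xi> j)"
      using \<xi>[OF \<open>j \<in> I\<close>] by (intro N.integrable_const_bound[of _ "C j"]) (auto intro: measurable_F_N)
  qed (use \<xi>[OF \<open>i \<in> I\<close>] in \<open>auto intro: measurable_F_N\<close>)
  then have "has_bochner_integral N (\<lambda>w. ?S w)
      (\<Sum>i\<in>I. \<Sum>j\<in>I. (\<integral>w. \<xi> i w * \<xi> j w \<partial>N) * ?o i j)"
    by (intro has_bochner_integral_sum has_bochner_integral_mult_left) (auto simp: has_bochner_integral_iff)
  then have "(\<integral>\<^sup>+w. ennreal (?S w) \<partial>N) =
      ennreal (\<Sum>i\<in>I. \<Sum>j\<in>I. (\<integral>w. \<xi> i w * \<xi> j w \<partial>N) * ?o i j)"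
    using nonneg by (auto simp: has_bochner_integral_iff nn_integral_eq_integral)
  then show ?thesis
    unfolding lhs inner by simp
qed

section \<open>Sampling a control at random times\<close>

text \<open>A control is constrained for \<open>r \<ge> 0\<close> only; \<open>max 0\<close>
  replaces its arbitrary values at negative times, so that Fubini and translations on the whole line
  apply.\<close>

lemma control_measurable:
  assumes "\<alpha> \<in> controls M W l u"
  shows "(\<lambda>p. \<alpha> (max 0 (fst p)) (snd p)) \<in> borel_measurable (lborel \<Otimes>\<^sub>M N)"
proof -
  have "(\<lambda>p. max 0 (fst p)) \<in> lborel \<Otimes>\<^sub>M N \<rightarrow>\<^sub>M (borel :: real measure)"
    by measurable
  then have "(\<lambda>p. (max 0 (fst p), snd p)) \<in> lborel \<Otimes>\<^sub>M N \<rightarrow>\<^sub>M restrict_space borel {0 :: real..} \<Otimes>\<^sub>M N"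
    by (intro measurable_Pair measurable_restrict_space2) auto
  moreover have "(\<lambda>(r, w). \<alpha> r w) \<in> borel_measurable (restrict_space borel {0..} \<Otimes>\<^sub>M N)"
    using assms by (simp add: controls_def)
  ultimately show ?thesis
    by (auto dest: measurable_compose)
qed

lemma control_range: "\<alpha> \<in> controls M W l u \<Longrightarrow> 0 \<le> r \<Longrightarrow> w \<in> space M \<Longrightarrow> \<alpha> r w \<in> {l..u}"
  by (auto simp: controls_def)

abbreviation shift_error :: "(real \<Rightarrow> 'a \<Rightarrow> real) \<Rightarrow> real \<Rightarrow> ennreal" where
  "shift_error A q \<equiv> \<integral>\<^sup>+w. \<integral>\<^sup>+p. ennreal \<bar>A (p + q) w - A p w\<bar> \<partial>lborel \<partial>N"

lemma measurable_uncurried: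
  assumes "(\<lambda>p. A (fst p) (snd p)) \<in> borel_measurable (lborel \<Otimes>\<^sub>M N)" "f \<in> K \<rightarrow>\<^sub>M lborel" "g \<in> K \<rightarrow>\<^sub>M N"
  shows "(\<lambda>x. A (f x) (g x)) \<in> borel_measurable K"
  using measurable_compose[OF measurable_Pair[OF assms(2,3)] assms(1)] by simp

text \<open>Translations are continuous path by path, and dominated convergence averages this over
  \<open>N\<close>. As that is a statement about sequences, the threshold \<open>d\<close> is
  obtained by contradiction from a sequence of bad shifts.\<close>

lemma translation_expectation_small:
  assumes A [measurable]: "(\<lambda>p. A (fst p) (snd p)) \<in> borel_measurable (lborel \<Otimes>\<^sub>M N)"
    and bound: "\<And>r w. w \<in> space M \<Longrightarrow> \<bar>A r w\<bar> \<le> C * indicator {0<..\<tau>} r"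
    and "0 < e"
  obtains d :: real where "0 < d"
    "\<And>q. 0 < q \<Longrightarrow> q \<le> d \<Longrightarrow> shift_error A q \<le> ennreal e"
proof -
  define D where "D q w = (\<integral>p. \<bar>A (p + q) w - A p w\<bar> \<partial>lborel)" for q w
  have Dm: "D q \<in> borel_measurable N" for q
  proof -
    have "(\<lambda>(w, p). \<bar>A (p + q) w - A p w\<bar>) \<in> borel_measurable (N \<Otimes>\<^sub>M lborel)"
      unfolding split_beta by (intro borel_measurable_abs borel_measurable_diff measurable_uncurried[OF A]) auto
    then show ?thesis
      unfolding D_def[abs_def] by (intro lborel.borel_measurable_lebesgue_integral) simp
  qed
  have int: "integrable lborel (\<lambda>p. A p w)" if "w \<in> space M" for w
  proof (rule Bochner_Integration.integrable_bound)
    show "integrable lborel (\<lambda>p. C * indicat_real {0<..\<tau>} p)"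
      by (cases "0 \<le> \<tau>") auto
    show "(\<lambda>p. A p w) \<in> borel_measurable lborel"
      using measurable_compose[OF measurable_Pair2' A, of w] that by simp
    show "AE p in lborel. norm (A p w) \<le> norm (C * indicat_real {0<..\<tau>} p)"
      using bound[OF that] by (intro AE_I2) (smt (verit) real_norm_def)
  qed
  note sh = integrable_translate[OF int]
  have nn: "(\<integral>\<^sup>+p. ennreal \<bar>A (p + q) w - A p w\<bar> \<partial>lborel) = ennreal (D q w)" if "w \<in> space M" for q w
    unfolding D_def using int[OF that] sh[OF that] by (intro nn_integral_eq_integral) auto
  let ?B = "2 * (\<integral>p. C * indicat_real {0<..\<tau>} p \<partial>lborel)"
  have D_bound: "\<bar>D q w\<bar> \<le> ?B" if "w \<in> space M" for q w
  proof -
    have i: "integrable lborel (\<lambda>p. C * indicat_real {0<..\<tau>} p)" by (cases "0 \<le> \<tau>") auto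
    have "(\<integral>p. \<bar>A (p + q) w\<bar> \<partial>lborel) = (\<integral>p. \<bar>A p w\<bar> \<partial>lborel)"
      by (rule integral_translate)
    moreover have "D q w \<le> (\<integral>p. \<bar>A (p + q) w\<bar> + \<bar>A p w\<bar> \<partial>lborel)"
      unfolding D_def using int[OF that] sh[OF that] by (intro integral_mono) auto
    moreover have "(\<integral>p. \<bar>A p w\<bar> \<partial>lborel) \<le> (\<integral>p. C * indicat_real {0<..\<tau>} p \<partial>lborel)"
      using int[OF that] i bound[OF that] by (intro integral_mono) auto
    moreover have "0 \<le> D q w" by (simp add: D_def)
    ultimately show ?thesis using int[OF that] sh[OF that] by simp
  qed
  have D0: "0 \<le> D q w" for q w by (simp add: D_def)
  have iD: "integrable N (D q)" for q
    using Dm D_bound by (intro N.integrable_const_bound[of _ ?B]) auto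
  have lim: "(\<lambda>n. \<integral>w. D (q n) w \<partial>N) \<longlonglongrightarrow> 0" if "q \<longlonglongrightarrow> 0" for q
  proof -
    have "(\<lambda>n. \<integral>w. D (q n) w \<partial>N) \<longlonglongrightarrow> (\<integral>w. 0 \<partial>N)"
    proof (rule integral_dominated_convergence)
      show "AE w in N. (\<lambda>n. D (q n) w) \<longlonglongrightarrow> 0"
        unfolding D_def using int that by (intro AE_I2 translation_tendsto_L1) auto
      show "AE w in N. norm (D (q n) w) \<le> ?B" for n
        using D_bound by (intro AE_I2) auto
    qed (use Dm in auto)
    then show ?thesis by simp
  qed
  have "\<exists>d>0. \<forall>q. 0 < q \<and> q \<le> d \<longrightarrow> (\<integral>w. D q w \<partial>N) \<le> e"
  proof (rule ccontr)
    assume "\<not> ?thesis"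
    then have "\<exists>q. 0 < q \<and> q \<le> inverse (real (Suc n)) \<and> e < (\<integral>w. D q w \<partial>N)" for n
      by (metis not_le inverse_positive_iff_positive of_nat_0_less_iff zero_less_Suc)
    then obtain q where q: "\<And>n. 0 < q n \<and> q n \<le> inverse (real (Suc n)) \<and> e < (\<integral>w. D (q n) w \<partial>N)"
      by metis
    have "q \<longlonglongrightarrow> 0"
    proof (rule tendsto_sandwich[OF _ _ tendsto_const LIMSEQ_inverse_real_of_nat])
      show "\<forall>\<^sub>F n in sequentially. 0 \<le> q n" using q by (auto intro!: always_eventually less_imp_le)
      show "\<forall>\<^sub>F n in sequentially. q n \<le> inverse (real (Suc n))" using q by (auto intro!: always_eventually)
    qed
    from LIMSEQ_D[OF lim[OF this] \<open>0 < e\<close>] obtain n where "\<bar>\<integral>w. D (q n) w \<partial>N\<bar> < e" by auto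
    with q[of n] show False by linarith
  qed
  then obtain d where d: "0 < d" "\<And>q. 0 < q \<Longrightarrow> q \<le> d \<Longrightarrow> (\<integral>w. D q w \<partial>N) \<le> e" by auto
  show thesis
  proof (rule that[OF d(1)])
    fix q :: real assume q: "0 < q" "q \<le> d"
    have "shift_error A q = (\<integral>\<^sup>+w. ennreal (D q w) \<partial>N)"
      using nn by (intro nn_integral_cong) auto
    also have "\<dots> = ennreal (\<integral>w. D q w \<partial>N)"
      using iD D0 by (intro nn_integral_eq_integral AE_I2)
    also have "\<dots> \<le> ennreal e" using d(2)[OF q] by (rule ennreal_leI)
    finally show "shift_error A q \<le> ennreal e" .
  qed
qed

text \<open>Averaging over the offset \<open>s\<close> of the grid replaces the comparison of \<open>\<alpha>\<close> with its value at the
  preceding grid point by a comparison of \<open>\<alpha>\<close> with its translates.  This works for measurable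
  adapted processes, without passing to a progressively measurable modification.\<close>

lemma sampling_offset:
  assumes A [measurable]: "(\<lambda>p. A (fst p) (snd p)) \<in> borel_measurable (lborel \<Otimes>\<^sub>M N)"
    and "0 < h" "0 < e"
    and small: "\<And>q. 0 < q \<Longrightarrow> q \<le> h \<Longrightarrow> shift_error A q \<le> ennreal e"
  obtains s where "0 < s" "s < h"
    "(\<Sum>j<n. \<integral>\<^sup>+w. \<integral>\<^sup>+q. ennreal \<bar>A (s + real j * h + q) w - A (s + real j * h) w\<bar> * indicator {0<..h} q \<partial>lborel \<partial>N)
      \<le> ennreal (2 * e)"
proof -
  \<comment> \<open>\<open>B p\<close> will be the expected error made on the cell
    \<open>(p, p + h]\<close> by using the value of \<open>A\<close> at its left end.\<close>
  define H where "H p q w = ennreal \<bar>A (p + q) w - A p w\<bar> * indicator {0<..h} q" for p q w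
  define B where "B p = (\<integral>\<^sup>+w. \<integral>\<^sup>+q. H p q w \<partial>lborel \<partial>N)" for p
  have Hm: "(\<lambda>x. H (fst (fst x)) (snd x) (snd (fst x))) \<in> borel_measurable ((borel \<Otimes>\<^sub>M N) \<Otimes>\<^sub>M lborel)"
    unfolding H_def
    by (intro borel_measurable_times_ennreal measurable_compose[OF _ measurable_ennreal] borel_measurable_abs borel_measurable_diff measurable_uncurried[OF A])
       auto
  have Bm: "B \<in> borel_measurable borel"
  proof -
    have "(\<lambda>x. \<integral>\<^sup>+q. H (fst x) q (snd x) \<partial>lborel) \<in> borel_measurable (borel \<Otimes>\<^sub>M N)"
      using lborel.borel_measurable_nn_integral[of "\<lambda>x q. H (fst x) q (snd x)" "borel \<Otimes>\<^sub>M N"] Hm by (simp add: split_beta)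
    then show ?thesis
      unfolding B_def[abs_def] using N.borel_measurable_nn_integral[of "\<lambda>p w. \<integral>\<^sup>+q. H p q w \<partial>lborel" borel] by (simp add: split_beta)
  qed
  have "(\<integral>\<^sup>+p. B p \<partial>lborel) = (\<integral>\<^sup>+q. (\<integral>\<^sup>+w. \<integral>\<^sup>+p. H p q w \<partial>lborel \<partial>N) \<partial>lborel)"
  proof -
    \<comment> \<open>Three exchanges of integrals put the shift \<open>q\<close> outermost, where
      \<open>small\<close> applies to each \<open>q\<close> in \<open>(0, h]\<close>.\<close>
    interpret LN: pair_sigma_finite lborel N ..
    have 1: "(\<integral>\<^sup>+p. B p \<partial>lborel) = (\<integral>\<^sup>+w. \<integral>\<^sup>+p. \<integral>\<^sup>+q. H p q w \<partial>lborel \<partial>lborel \<partial>N)"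
      unfolding B_def
    proof (rule LN.Fubini'[symmetric, where f = "\<lambda>p w. \<integral>\<^sup>+q. H p q w \<partial>lborel"])
      show "(\<lambda>(p, w). \<integral>\<^sup>+q. H p q w \<partial>lborel) \<in> borel_measurable (lborel \<Otimes>\<^sub>M N)"
        using lborel.borel_measurable_nn_integral[of "\<lambda>x q. H (fst x) q (snd x)" "lborel \<Otimes>\<^sub>M N"] Hm
        by (simp add: split_beta)
    qed
    have 2: "(\<integral>\<^sup>+p. \<integral>\<^sup>+q. H p q w \<partial>lborel \<partial>lborel) = (\<integral>\<^sup>+q. \<integral>\<^sup>+p. H p q w \<partial>lborel \<partial>lborel)" if "w \<in> space M" for w
    proof (rule lborel_pair.Fubini'[symmetric])
      have "(\<lambda>x. ((fst x, w), snd x)) \<in> lborel \<Otimes>\<^sub>M lborel \<rightarrow>\<^sub>M (borel \<Otimes>\<^sub>M N) \<Otimes>\<^sub>M lborel"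
        using that by (intro measurable_Pair) auto
      from measurable_compose[OF this Hm] show "(\<lambda>(p, q). H p q w) \<in> borel_measurable (lborel \<Otimes>\<^sub>M lborel)"
        by (simp add: split_beta)
    qed
    have 3: "(\<integral>\<^sup>+w. \<integral>\<^sup>+q. \<integral>\<^sup>+p. H p q w \<partial>lborel \<partial>lborel \<partial>N) = (\<integral>\<^sup>+q. \<integral>\<^sup>+w. \<integral>\<^sup>+p. H p q w \<partial>lborel \<partial>N \<partial>lborel)"
    proof (rule LN.Fubini')
      have "(\<lambda>x. ((snd x, snd (fst x)), fst (fst x))) \<in> (lborel \<Otimes>\<^sub>M N) \<Otimes>\<^sub>M lborel \<rightarrow>\<^sub>M (borel \<Otimes>\<^sub>M N) \<Otimes>\<^sub>M lborel"
        by (intro measurable_Pair) auto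
      from measurable_compose[OF this Hm]
      show "(\<lambda>(q, w). \<integral>\<^sup>+p. H p q w \<partial>lborel) \<in> borel_measurable (lborel \<Otimes>\<^sub>M N)"
        using lborel.borel_measurable_nn_integral[of "\<lambda>x p. H p (fst x) (snd x)" "lborel \<Otimes>\<^sub>M N"] by (simp add: split_beta)
    qed
    have "(\<integral>\<^sup>+p. B p \<partial>lborel) = (\<integral>\<^sup>+w. \<integral>\<^sup>+q. \<integral>\<^sup>+p. H p q w \<partial>lborel \<partial>lborel \<partial>N)"
      unfolding 1 by (rule nn_integral_cong) (simp add: 2)
    then show ?thesis unfolding 3 .
  qed
  also have "\<dots> \<le> (\<integral>\<^sup>+q. ennreal e * indicator {0<..h} q \<partial>lborel)"
  proof (rule nn_integral_mono)
    fix q :: real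
    show "(\<integral>\<^sup>+w. \<integral>\<^sup>+p. H p q w \<partial>lborel \<partial>N) \<le> ennreal e * indicator {0<..h} q"
      using small[of q] by (cases "q \<in> {0<..h}") (auto simp: H_def)
  qed
  also have "\<dots> = ennreal (e * h)"
    using \<open>0 < h\<close> \<open>0 < e\<close> by (subst nn_integral_cmult_indicator) (auto simp: ennreal_mult)
  finally have total: "(\<integral>\<^sup>+p. B p \<partial>lborel) \<le> ennreal (e * h)" .
  \<comment> \<open>Averaged over offsets in \<open>(0, h)\<close> the grid sum is at most
    \<open>e\<close>; the factor 2 leaves room for a contradiction.\<close>
  have "\<exists>s. 0 < s \<and> s < h \<and> (\<Sum>j<n. B (s + real j * h)) \<le> ennreal (2 * e)"
  proof (rule ccontr)
    assume "\<not> ?thesis"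
    then have "ennreal (2 * e) * indicator {0<..<h} s \<le> (\<Sum>j<n. B (s + real j * h)) * indicator {0<..<h} s" for s
      by (auto split: split_indicator simp: not_le intro: less_imp_le)
    then have "(\<integral>\<^sup>+s. ennreal (2 * e) * indicator {0<..<h} s \<partial>lborel) \<le> ennreal (e * h)"
      by (intro order.trans[OF nn_integral_mono order.trans[OF nn_integral_grid_le[OF Bm \<open>0 < h\<close>, of n] total]])
    then have "ennreal (2 * e * h) \<le> ennreal (e * h)"
      using \<open>0 < h\<close> \<open>0 < e\<close> by (subst (asm) nn_integral_cmult_indicator) (auto simp: ennreal_mult)
    then show False using \<open>0 < h\<close> \<open>0 < e\<close> by (simp add: ennreal_le_iff)
  qed
  then show thesis using that unfolding B_def H_def by blast
qed

text \<open>The control is frozen at the points \<open>s + j * h\<close>. Its values at left end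
  points are adapted and stay in \<open>[l, u]\<close>. As values lie in \<open>[0, u]\<close>,
  squared errors are at most \<open>u\<close> times absolute ones, so the L1 estimate for
  translations is enough.\<close>

lemma simple_approximation:
  assumes \<alpha>: "\<alpha> \<in> controls M W l u" and "0 \<le> l" "l \<le> u" "0 < \<tau>" "0 < e"
  shows "\<exists>n s \<xi>. simple_process M W \<tau> n s \<xi> \<and> (\<forall>i<n. \<forall>w\<in>space M. \<xi> i w \<in> {l..u}) \<and>
    (\<integral>\<^sup>+w. sq_error \<tau> \<alpha> n s \<xi> w \<partial>N) \<le> ennreal e"
proof -
  have "0 \<le> u" using assms by simp
  define A where "A r w = indicator {0<..\<tau>} r * \<alpha> (max 0 r) w" for r w
  \<comment> \<open>Half of \<open>e\<close> is spent before the first sample, where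
    \<open>u\<^sup>2 * s \<le> u\<^sup>2 * h \<le> e / 2\<close>, the other half on the cells, where
    \<open>u * (2 * e') \<le> e / 2\<close>.\<close>
  define e' where "e' = e / (4 * (u + 1))"
  have "0 < e'" using \<open>0 < e\<close> \<open>0 \<le> u\<close> by (simp add: e'_def)
  have Am [measurable]: "(\<lambda>p. A (fst p) (snd p)) \<in> borel_measurable (lborel \<Otimes>\<^sub>M N)"
  proof -
    have "(\<lambda>p. indicat_real {0<..\<tau>} (fst p)) \<in> borel_measurable (lborel \<Otimes>\<^sub>M N)" by measurable
    then show ?thesis
      unfolding A_def using control_measurable[OF \<alpha>] by (rule borel_measurable_times)
  qed
  have A_bound: "\<bar>A r w\<bar> \<le> u * indicator {0<..\<tau>} r" if "w \<in> space M" for r w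
    using control_range[OF \<alpha>, of "max 0 r" w] that \<open>0 \<le> l\<close> by (auto simp: A_def split: split_indicator)
  obtain d where d: "0 < d"
    "\<And>q. 0 < q \<Longrightarrow> q \<le> d \<Longrightarrow> shift_error A q \<le> ennreal e'"
    using translation_expectation_small[OF Am A_bound \<open>0 < e'\<close>] by blast
  define d' where "d' = min d (e / (2 * (u\<^sup>2 + 1)))"
  have "0 < d'" using d(1) \<open>0 < e\<close> by (simp add: d'_def add_nonneg_pos)
  obtain m :: nat where m: "\<tau> / d' < real m" using reals_Archimedean2 by blast
  moreover have "0 < \<tau> / d'" using \<open>0 < \<tau>\<close> \<open>0 < d'\<close> by simp
  ultimately have "0 < real m" by linarith
  then have "0 < m" by simp
  define h where "h = \<tau> / real m"
  have h: "0 < h" "real m * h = \<tau>" using \<open>0 < m\<close> \<open>0 < \<tau>\<close> by (simp_all add: h_def)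
  have "h < d'" using m \<open>0 < d'\<close> \<open>0 < m\<close> by (simp add: h_def field_simps)
  then have "h \<le> d" and h_small: "u\<^sup>2 * h \<le> e / 2"
  proof -
    show "h \<le> d" using \<open>h < d'\<close> by (simp add: d'_def)
    have "u\<^sup>2 * h \<le> (u\<^sup>2 + 1) * (e / (2 * (u\<^sup>2 + 1)))"
      using \<open>h < d'\<close> h(1) by (intro mult_mono) (auto simp: d'_def)
    also have "\<dots> = e / 2"
    proof -
      have cancel: "c * (e / (2 * c)) = e / 2" if "0 < c" for c using that by simp
      show ?thesis by (rule cancel) (simp add: add_nonneg_pos)
    qed
    finally show "u\<^sup>2 * h \<le> e / 2" .
  qed
  obtain s where s: "0 < s" "s < h"
    "(\<Sum>j<m. \<integral>\<^sup>+w. \<integral>\<^sup>+q. ennreal \<bar>A (s + real j * h + q) w - A (s + real j * h) w\<bar> * indicator {0<..h} q \<partial>lborel \<partial>N)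
      \<le> ennreal (2 * e')"
    using sampling_offset[OF Am h(1) \<open>0 < e'\<close> d(2)[OF _ order.trans[OF _ \<open>h \<le> d\<close>]], of m] by blast
  let ?p = "\<lambda>j::nat. s + real j * h"
  have p: "0 < ?p j" for j using s h by (simp add: add_pos_nonneg)
  have p_less: "?p j < \<tau>" if "j < m" for j
  proof -
    have "real (Suc j) * h \<le> real m * h" using that h(1) by (intro mult_right_mono) auto
    then show ?thesis using s(2) h(2) by (simp add: algebra_simps)
  qed
  \<comment> \<open>Index 0 is the stretch before the first sample, with value \<open>l\<close>;
    index \<open>Suc j\<close> starts at sample \<open>j\<close>. The last cell ends at \<tau> and
    is shorter than \<open>h\<close>.\<close>
  define pt where "pt i = (case i of 0 \<Rightarrow> 0 | Suc j \<Rightarrow> if j < m then ?p j else \<tau>)" for i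
  define \<xi> where "\<xi> i = (case i of 0 \<Rightarrow> (\<lambda>_. l) | Suc j \<Rightarrow> \<alpha> (?p j))" for i
  have pt_Suc: "pt (Suc j) = ?p j" if "j < m" for j using that by (simp add: pt_def)
  have pt_le: "pt (Suc (Suc j)) \<le> ?p j + h" if "j < m" for j
  proof (cases "Suc j < m")
    case False
    then have "Suc j = m" using that by simp
    then have "\<tau> = real j * h + h" using h(2) by (auto simp: algebra_simps)
    then show ?thesis using False s by (simp add: pt_def)
  qed (simp add: pt_def algebra_simps)
  have range: "\<xi> i w \<in> {l..u}" if "w \<in> space M" for i w
  proof (cases i)
    case (Suc j)
    show ?thesis
      using control_range[OF \<alpha> less_imp_le[OF p[of j]] that] by (simp add: Suc \<xi>_def)
  qed (use assms in \<open>simp add: \<xi>_def\<close>)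
  have sp: "simple_process M W \<tau> (Suc m) pt \<xi>"
    unfolding simple_process_def
  proof (intro conjI allI impI)
    show "pt 0 = 0" "pt (Suc m) = \<tau>" by (simp_all add: pt_def)
    fix i assume "i < Suc m"
    then show "pt i < pt (Suc i)"
      using p_less p[of 0] h \<open>0 < m\<close> by (cases i) (auto simp: pt_def algebra_simps)
    show "\<xi> i \<in> borel_measurable (F (pt i))"
      using \<open>i < Suc m\<close> \<alpha> p less_imp_le[OF p] by (cases i) (auto simp: \<xi>_def pt_def controls_def)
  next
    show "\<exists>C. \<forall>i<Suc m. \<forall>w\<in>space M. \<bar>\<xi> i w\<bar> \<le> C"
    proof (intro exI[of _ u] allI impI ballI)
      fix i w assume "w \<in> space M"
      then show "\<bar>\<xi> i w\<bar> \<le> u"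
        using range[of w i] \<open>0 \<le> l\<close> by auto
    qed
  qed
  let ?D = "\<lambda>j w q. ennreal \<bar>A (?p j + q) w - A (?p j) w\<bar> * indicator {0<..h} q"
  have Ar [measurable]: "(\<lambda>r. A r w) \<in> borel_measurable borel" if "w \<in> space M" for w
    using measurable_compose[OF measurable_Pair2' Am, of w] that by simp
  have inner: "sq_error \<tau> \<alpha> (Suc m) pt \<xi> w \<le>
      ennreal (u\<^sup>2 * s) + (\<Sum>j<m. ennreal u * (\<integral>\<^sup>+q. ?D j w q \<partial>lborel))" if w: "w \<in> space M" for w
  proof -
    note [measurable] = Ar[OF w]
    let ?v = "\<lambda>r. simple_value (Suc m) pt \<xi> r w"
    let ?K = "\<lambda>j r. ennreal \<bar>A r w - A (?p j) w\<bar> * indicator {0<..h} (r - ?p j)"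
    have le: "ennreal ((\<alpha> r w - ?v r)\<^sup>2) * indicator {0..\<tau>} r \<le>
        ennreal (u\<^sup>2) * indicator {0..s} r + (\<Sum>j<m. ennreal u * ?K j r)" for r
    proof -
      have sq: "(x - y)\<^sup>2 \<le> u\<^sup>2" if "x \<in> {0..u}" "y \<in> {0..u}" for x y :: real
        using that by (intro power2_le_iff_abs_le[THEN iffD2]) (auto simp: abs_le_iff)
      have range0: "\<alpha> q w \<in> {0..u}" if "0 \<le> q" for q
        using control_range[OF \<alpha> that w] \<open>0 \<le> l\<close> by auto
      consider "r \<notin> {0..\<tau>}" | "r = 0" | "r \<in> {0<..\<tau>}" by fastforce
      then show ?thesis
      proof cases
        \<comment> \<open>At \<open>r = 0\<close> a simple process vanishes, as its intervals are
          open on the left.\<close>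
        case 2
        then show ?thesis
          using simple_value_outside[OF sp, of 0 w] sq[OF range0[of 0], of 0] \<open>0 \<le> u\<close> s(1) \<open>0 < \<tau>\<close>
          by (auto intro!: add_increasing2 ennreal_leI sum_nonneg)
      next
        case 3
        obtain i where i: "i < Suc m" "r \<in> {pt i<..pt (Suc i)}"
          using simple_process_cover[OF sp 3] by blast
        have v: "?v r = \<xi> i w" using simple_value_eq[OF sp i] .
        show ?thesis
        proof (cases i)
          case 0
          then have "r \<le> s" "0 < r" using i pt_Suc[OF \<open>0 < m\<close>] by (auto simp: pt_def)
          moreover have "l \<in> {0..u}" using assms by simp
          ultimately show ?thesis
            using sq[OF range0[of r], of l] 0 v 3 by (auto intro!: add_increasing2 ennreal_leI sum_nonneg simp: \<xi>_def)
        next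
          case (Suc j)
          then have j: "j < m" "?p j < r" "r \<le> ?p j + h"
            using i pt_Suc[of j] pt_le[of j] by auto
          have "A r w = \<alpha> r w" "A (?p j) w = \<alpha> (?p j) w"
            using 3 p[of j] p_less[OF j(1)] by (auto simp: A_def)
          then have "(\<alpha> r w - ?v r)\<^sup>2 = \<bar>A r w - A (?p j) w\<bar> * \<bar>A r w - A (?p j) w\<bar>"
            using v Suc by (simp add: \<xi>_def power2_eq_square)
          also have "\<dots> \<le> u * \<bar>A r w - A (?p j) w\<bar>"
            using range0[of r] range0[of "?p j"] 3 p[of j] \<open>A r w = \<alpha> r w\<close> \<open>A (?p j) w = \<alpha> (?p j) w\<close>
            by (intro mult_right_mono) auto
          finally have "ennreal ((\<alpha> r w - ?v r)\<^sup>2) \<le> ennreal u * ?K j r"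
            using j \<open>0 \<le> u\<close> by (simp add: ennreal_mult[symmetric] ennreal_leI)
          also have "\<dots> \<le> (\<Sum>j<m. ennreal u * ?K j r)"
            using j(1) by (intro member_le_sum) auto
          finally show ?thesis
            using 3 by (simp add: add_increasing)
        qed
      qed simp
    qed
    have shift: "(\<integral>\<^sup>+r. ?K j r \<partial>lborel) = (\<integral>\<^sup>+q. ?D j w q \<partial>lborel)" for j
      by (subst nn_integral_real_affine[of _ 1 "?p j"]) auto
    have "sq_error \<tau> \<alpha> (Suc m) pt \<xi> w \<le>
        (\<integral>\<^sup>+r. ennreal (u\<^sup>2) * indicator {0..s} r + (\<Sum>j<m. ennreal u * ?K j r) \<partial>lborel)"
      using le by (intro nn_integral_mono)
    also have "\<dots> = (\<integral>\<^sup>+r. ennreal (u\<^sup>2) * indicator {0..s} r \<partial>lborel) + (\<integral>\<^sup>+r. (\<Sum>j<m. ennreal u * ?K j r) \<partial>lborel)"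
      by (rule nn_integral_add) measurable
    also have "(\<integral>\<^sup>+r. ennreal (u\<^sup>2) * indicator {0..s} r \<partial>lborel) = ennreal (u\<^sup>2 * s)"
      using s(1) by (subst nn_integral_cmult_indicator) (auto simp: ennreal_mult)
    also have "(\<integral>\<^sup>+r. (\<Sum>j<m. ennreal u * ?K j r) \<partial>lborel) = (\<Sum>j<m. ennreal u * (\<integral>\<^sup>+r. ?K j r \<partial>lborel))"
      by (subst nn_integral_sum) (auto simp: nn_integral_cmult)
    finally show ?thesis unfolding shift .
  qed
  have Dm: "(\<lambda>w. \<integral>\<^sup>+q. ?D j w q \<partial>lborel) \<in> borel_measurable N" for j
  proof -
    have "(\<lambda>(w, q). ?D j w q) \<in> borel_measurable (N \<Otimes>\<^sub>M lborel)"
      unfolding split_beta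
      by (intro borel_measurable_times_ennreal measurable_compose[OF _ measurable_ennreal] borel_measurable_abs borel_measurable_diff measurable_uncurried[OF Am])
         auto
    then show ?thesis by (rule lborel.borel_measurable_nn_integral)
  qed
  have "(\<integral>\<^sup>+w. sq_error \<tau> \<alpha> (Suc m) pt \<xi> w \<partial>N) \<le>
      (\<integral>\<^sup>+w. ennreal (u\<^sup>2 * s) + (\<Sum>j<m. ennreal u * (\<integral>\<^sup>+q. ?D j w q \<partial>lborel)) \<partial>N)"
    using inner by (intro nn_integral_mono) simp
  also have "\<dots> = (\<integral>\<^sup>+w. ennreal (u\<^sup>2 * s) \<partial>N) + (\<integral>\<^sup>+w. (\<Sum>j<m. ennreal u * (\<integral>\<^sup>+q. ?D j w q \<partial>lborel)) \<partial>N)"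
    using Dm by (intro nn_integral_add) auto
  also have "(\<integral>\<^sup>+w. ennreal (u\<^sup>2 * s) \<partial>N) = ennreal (u\<^sup>2 * s)"
    using N.emeasure_space_1 by simp
  also have "(\<integral>\<^sup>+w. (\<Sum>j<m. ennreal u * (\<integral>\<^sup>+q. ?D j w q \<partial>lborel)) \<partial>N) =
      ennreal u * (\<Sum>j<m. \<integral>\<^sup>+w. \<integral>\<^sup>+q. ?D j w q \<partial>lborel \<partial>N)"
    using Dm by (subst nn_integral_sum) (auto simp: nn_integral_cmult sum_distrib_left)
  also have "ennreal (u\<^sup>2 * s) + \<dots> \<le> ennreal (u\<^sup>2 * h) + ennreal u * ennreal (2 * e')"
    using s by (intro add_mono mult_left_mono ennreal_leI) auto
  also have "\<dots> = ennreal (u\<^sup>2 * h + u * (2 * e'))"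
    using \<open>0 \<le> u\<close> \<open>0 < e'\<close> h(1) by (simp add: ennreal_mult)
  also have "\<dots> \<le> ennreal e"
  proof (rule ennreal_leI)
    have "u * (2 * e') \<le> (u + 1) * (2 * e')" using \<open>0 < e'\<close> by (intro mult_right_mono) auto
    also have "\<dots> = e / 2" using \<open>0 \<le> u\<close> by (simp add: e'_def field_simps)
    finally show "u\<^sup>2 * h + u * (2 * e') \<le> e" using h_small by simp
  qed
  finally show ?thesis
    using sp range by blast
qed

section \<open>Existence and uniqueness of the Ito integral\<close>

lemma simple_process_measurable:
  assumes "simple_process M W b n s \<xi>" "i < n"
  shows "\<xi> i \<in> borel_measurable N"
  using assms by (auto simp: simple_process_def intro: measurable_F_N)

lemma simple_integral_measurable:
  assumes "simple_process M W b n s \<xi>"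
  shows "simple_integral W n s \<xi> \<in> borel_measurable N"
  unfolding simple_integral_def[abs_def]
  using simple_process_nonneg[OF assms]
  by (intro borel_measurable_sum borel_measurable_times simple_process_measurable[OF assms] increment_measurable) auto

text \<open>The disjoint union of the two index sets, with the sign of \<eta> reversed, makes the
  difference a single sum for \<open>ito_isometry\<close> in place of a common grid.\<close>

lemma simple_isometry:
  assumes 1: "simple_process M W b n s \<xi>" and 2: "simple_process M W b m t \<eta>"
  shows "sq_dist N (simple_integral W n s \<xi>) (simple_integral W m t \<eta>) =
    (\<integral>\<^sup>+w. (\<integral>\<^sup>+r\<in>{0..b}. ennreal ((simple_value n s \<xi> r w - simple_value m t \<eta> r w)\<^sup>2) \<partial>lborel) \<partial>N)"
proof -
  obtain C D where C: "\<And>i w. i < n \<Longrightarrow> w \<in> space M \<Longrightarrow> \<bar>\<xi> i w\<bar> \<le> C"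
    and D: "\<And>i w. i < m \<Longrightarrow> w \<in> space M \<Longrightarrow> \<bar>\<eta> i w\<bar> \<le> D"
    using 1 2 unfolding simple_process_def by metis
  let ?I = "{..<n} <+> {..<m}"
  let ?a = "case_sum s t" and ?b = "case_sum (\<lambda>i. s (Suc i)) (\<lambda>i. t (Suc i))"
  let ?\<zeta> = "case_sum \<xi> (\<lambda>i w. - \<eta> i w)"
  have "(\<integral>\<^sup>+w. ennreal ((\<Sum>i\<in>?I. ?\<zeta> i w * (W (?b i) w - W (?a i) w))\<^sup>2) \<partial>N) =
    (\<integral>\<^sup>+w. (\<integral>\<^sup>+r\<in>{0..b}. ennreal ((\<Sum>i\<in>?I. ?\<zeta> i w * indicator {?a i<..?b i} r)\<^sup>2) \<partial>lborel) \<partial>N)"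
  proof (rule ito_isometry[where C = "case_sum (\<lambda>_. C) (\<lambda>_. D)"])
    show "?\<zeta> i \<in> borel_measurable (F (?a i))" if "i \<in> ?I" for i
      using that 1 2 by (auto simp: simple_process_def)
    show "\<bar>?\<zeta> i w\<bar> \<le> case_sum (\<lambda>_. C) (\<lambda>_. D) i" if "i \<in> ?I" "w \<in> space M" for i w
      using that C D by auto
    show "0 \<le> ?a i" if "i \<in> ?I" for i
      using that simple_process_nonneg[OF 1] simple_process_nonneg[OF 2] by auto
    show "?a i < ?b i" if "i \<in> ?I" for i
      using that 1 2 by (auto simp: simple_process_def)
    show "?b i \<le> b" if "i \<in> ?I" for i
      using that simple_process_le[OF 1] simple_process_le[OF 2] by auto
  qed simp
  moreover have "(\<Sum>i\<in>?I. ?\<zeta> i w * (W (?b i) w - W (?a i) w)) = simple_integral W n s \<xi> w - simple_integral W m t \<eta> w" for w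
    by (simp add: sum.Plus simple_integral_def sum_negf)
  moreover have "(\<Sum>i\<in>?I. ?\<zeta> i w * indicator {?a i<..?b i} r) = simple_value n s \<xi> r w - simple_value m t \<eta> r w" for r w
    by (simp add: sum.Plus simple_value_def sum_negf del: sum_mult_indicator sum_indicator_mult)
  ultimately show ?thesis by simp
qed

lemma simple_error_measurable:
  assumes \<alpha>: "\<alpha> \<in> controls M W l u" and sp: "simple_process M W b n s \<xi>"
  shows "(\<lambda>w. \<integral>\<^sup>+r\<in>{0..b}. ennreal ((\<alpha> r w - simple_value n s \<xi> r w)\<^sup>2) \<partial>lborel) \<in> borel_measurable N"
proof -
  have "(\<lambda>x. \<xi> i (fst x)) \<in> borel_measurable (N \<Otimes>\<^sub>M lborel)" if "i < n" for i
    using measurable_compose[OF measurable_fst simple_process_measurable[OF sp that]] .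
  then have "(\<lambda>x. simple_value n s \<xi> (snd x) (fst x)) \<in> borel_measurable (N \<Otimes>\<^sub>M lborel)"
    unfolding simple_value_def by (intro borel_measurable_sum borel_measurable_times) auto
  moreover have "(\<lambda>x. \<alpha> (max 0 (snd x)) (fst x)) \<in> borel_measurable (N \<Otimes>\<^sub>M lborel)"
    by (rule measurable_uncurried[OF control_measurable[OF \<alpha>] measurable_snd measurable_fst])
  ultimately have "(\<lambda>(w, r). ennreal ((\<alpha> (max 0 r) w - simple_value n s \<xi> r w)\<^sup>2) * indicator {0..b} r) \<in> borel_measurable (N \<Otimes>\<^sub>M lborel)"
    unfolding split_beta
    by (intro borel_measurable_times_ennreal measurable_compose[OF _ measurable_ennreal] borel_measurable_power borel_measurable_diff) auto
  then have "(\<lambda>w. \<integral>\<^sup>+r\<in>{0..b}. ennreal ((\<alpha> (max 0 r) w - simple_value n s \<xi> r w)\<^sup>2) \<partial>lborel) \<in> borel_measurable N"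
    by (rule lborel.borel_measurable_nn_integral)
  moreover have "(\<integral>\<^sup>+r\<in>{0..b}. ennreal ((\<alpha> (max 0 r) w - simple_value n s \<xi> r w)\<^sup>2) \<partial>lborel) =
      sq_error b \<alpha> n s \<xi> w" for w
    by (intro nn_integral_cong) (auto split: split_indicator)
  ultimately show ?thesis by simp
qed

lemma simple_integral_distance:
  assumes \<alpha>: "\<alpha> \<in> controls M W l u"
    and 1: "simple_process M W b n s \<xi>" and 2: "simple_process M W b m t \<eta>"
  shows "sq_dist N (simple_integral W n s \<xi>) (simple_integral W m t \<eta>) \<le>
    2 * (\<integral>\<^sup>+w. sq_error b \<alpha> n s \<xi> w \<partial>N) +
    2 * (\<integral>\<^sup>+w. sq_error b \<alpha> m t \<eta> w \<partial>N)"
proof -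
  let ?e = "\<lambda>n s \<xi> w. \<integral>\<^sup>+r\<in>{0..b}. ennreal ((\<alpha> r w - simple_value n s \<xi> r w)\<^sup>2) \<partial>lborel"
  have v: "(\<lambda>r. simple_value n s \<xi> r w) \<in> borel_measurable lborel" for n s w and \<xi> :: "nat \<Rightarrow> 'a \<Rightarrow> real"
    unfolding simple_value_def by measurable
  have "(\<integral>\<^sup>+r\<in>{0..b}. ennreal ((simple_value n s \<xi> r w - simple_value m t \<eta> r w)\<^sup>2) \<partial>lborel) \<le>
      2 * ?e n s \<xi> w + 2 * ?e m t \<eta> w" if w: "w \<in> space M" for w
  proof -
    have a: "(\<lambda>r. \<alpha> (max 0 r) w) \<in> borel_measurable lborel"
      using measurable_compose[OF measurable_Pair2' control_measurable[OF \<alpha>], of w] w by simp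
    have "(\<integral>\<^sup>+r\<in>{0..b}. ennreal ((simple_value n s \<xi> r w - simple_value m t \<eta> r w)\<^sup>2) \<partial>lborel) \<le>
       2 * (\<integral>\<^sup>+r\<in>{0..b}. ennreal ((simple_value n s \<xi> r w - \<alpha> (max 0 r) w)\<^sup>2) \<partial>lborel) +
       2 * (\<integral>\<^sup>+r\<in>{0..b}. ennreal ((\<alpha> (max 0 r) w - simple_value m t \<eta> r w)\<^sup>2) \<partial>lborel)"
      by (intro nn_integral_square_triangle v a) auto
    also have "(\<integral>\<^sup>+r\<in>{0..b}. ennreal ((simple_value n s \<xi> r w - \<alpha> (max 0 r) w)\<^sup>2) \<partial>lborel) = ?e n s \<xi> w"
      by (intro nn_integral_cong) (auto split: split_indicator simp: power2_commute)
    also have "(\<integral>\<^sup>+r\<in>{0..b}. ennreal ((\<alpha> (max 0 r) w - simple_value m t \<eta> r w)\<^sup>2) \<partial>lborel) = ?e m t \<eta> w"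
      by (intro nn_integral_cong) (auto split: split_indicator)
    finally show ?thesis .
  qed
  then have "(\<integral>\<^sup>+w. (\<integral>\<^sup>+r\<in>{0..b}. ennreal ((simple_value n s \<xi> r w - simple_value m t \<eta> r w)\<^sup>2) \<partial>lborel) \<partial>N) \<le>
      (\<integral>\<^sup>+w. 2 * ?e n s \<xi> w + 2 * ?e m t \<eta> w \<partial>N)"
    by (intro nn_integral_mono) simp
  also have "\<dots> = 2 * (\<integral>\<^sup>+w. ?e n s \<xi> w \<partial>N) + 2 * (\<integral>\<^sup>+w. ?e m t \<eta> w \<partial>N)"
    using simple_error_measurable[OF \<alpha> 1] simple_error_measurable[OF \<alpha> 2]
    by (simp add: nn_integral_add nn_integral_cmult)
  finally show ?thesis
    unfolding simple_isometry[OF 1 2] .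
qed

text \<open>More than \<open>has_ito_integral\<close> is asserted: the approximating integrands take
  values in \<open>[l, u]\<close>, on which the comparison with \<open>nisio\<close>
  depends.\<close>

theorem ito_integral_exists:
  assumes \<alpha>: "\<alpha> \<in> controls M W l u" and "0 \<le> l" "l \<le> u" "0 < \<tau>"
  shows "\<exists>I n s \<xi>. I \<in> borel_measurable N \<and>
     (\<forall>k. simple_process M W \<tau> (n k) (s k) (\<xi> k) \<and> (\<forall>i<n k. \<forall>w\<in>space M. \<xi> k i w \<in> {l..u})) \<and>
     (\<lambda>k. \<integral>\<^sup>+w. sq_error \<tau> \<alpha> (n k) (s k) (\<xi> k) w \<partial>N) \<longlonglongrightarrow> 0 \<and>
     (\<lambda>k. sq_dist N I (simple_integral W (n k) (s k) (\<xi> k))) \<longlonglongrightarrow> 0"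
proof -
  \<comment> \<open>Errors \<open>(1 / 4) ^ k\<close> yield the rate required by
    \<open>L2_limit_of_fast_Cauchy\<close> with \<open>C = 2\<close>, since \<open>2 * (1 / 4) ^ m +
    2 * (1 / 4) ^ k \<le> (2 * (1 / 2) ^ k)\<^sup>2\<close> for \<open>k \<le> m\<close>.\<close>
  let ?P = "\<lambda>k n s \<xi>. simple_process M W \<tau> n s \<xi> \<and> (\<forall>i<n. \<forall>w\<in>space M. \<xi> i w \<in> {l..u}) \<and>
    (\<integral>\<^sup>+w. sq_error \<tau> \<alpha> n s \<xi> w \<partial>N) \<le> ennreal ((1 / 4) ^ k)"
  have "\<forall>k. \<exists>n s \<xi>. ?P k n s \<xi>"
    using assms by (intro allI simple_approximation) auto
  from choice[OF this] obtain n where "\<forall>k. \<exists>s \<xi>. ?P k (n k) s \<xi>" ..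
  from choice[OF this] obtain s where "\<forall>k. \<exists>\<xi>. ?P k (n k) (s k) \<xi>" ..
  from choice[OF this] obtain \<xi> where P: "\<forall>k. ?P k (n k) (s k) (\<xi> k)" ..
  have sp: "simple_process M W \<tau> (n k) (s k) (\<xi> k)"
    and range: "\<forall>i<n k. \<forall>w\<in>space M. \<xi> k i w \<in> {l..u}"
    and err: "(\<integral>\<^sup>+w. sq_error \<tau> \<alpha> (n k) (s k) (\<xi> k) w \<partial>N) \<le> ennreal ((1 / 4) ^ k)" for k
    using spec[OF P, of k] by auto
  let ?Y = "\<lambda>k. simple_integral W (n k) (s k) (\<xi> k)"
  have "sq_dist N (?Y m) (?Y k) \<le> ennreal ((2 * (1 / 2) ^ k)\<^sup>2)" if "k \<le> m" for k m
  proof -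
    have "sq_dist N (?Y m) (?Y k) \<le> 2 * ennreal ((1 / 4) ^ m) + 2 * ennreal ((1 / 4) ^ k)"
      by (rule order.trans[OF simple_integral_distance[OF \<alpha> sp sp]]) (intro add_mono mult_left_mono err; simp)
    also have "\<dots> = ennreal (2 * (1 / 4) ^ m + 2 * (1 / 4) ^ k)"
      by (simp add: ennreal_mult)
    also have "\<dots> \<le> ennreal (4 * (1 / 4) ^ k)"
      using that power_decreasing[of k m "1 / 4 :: real"] by (intro ennreal_leI) simp
    also have "4 * (1 / 4) ^ k = (2 * (1 / 2) ^ k :: real)\<^sup>2"
      by (simp add: power_mult_distrib power2_eq_square flip: power_mult_distrib)
    finally show ?thesis .
  qed
  then obtain I where I: "I \<in> borel_measurable N" "(\<lambda>k. sq_dist N I (?Y k)) \<longlonglongrightarrow> 0"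
    using N.L2_limit_of_fast_Cauchy[of ?Y 2] simple_integral_measurable[OF sp] by auto
  have lim: "(\<lambda>k. ennreal ((1 / 4) ^ k)) \<longlonglongrightarrow> 0"
    unfolding ennreal_0[symmetric] by (intro tendsto_ennrealI LIMSEQ_realpow_zero) auto
  have err_lim: "(\<lambda>k. \<integral>\<^sup>+w. sq_error \<tau> \<alpha> (n k) (s k) (\<xi> k) w \<partial>N) \<longlonglongrightarrow> 0"
    by (rule tendsto_sandwich[OF always_eventually[OF allI[OF zero_le]] always_eventually[OF allI[OF err]] tendsto_const lim])
  show ?thesis
    by (rule exI[of _ I], rule exI[of _ n], rule exI[of _ s], rule exI[of _ \<xi>]) (intro conjI allI I sp range err_lim)
qed

text \<open>Two approximating sequences have close integrals by the isometry, both integrands being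
  close to \<alpha>. Means of functions of \<open>ito_integral\<close> thereby do not depend on the
  version picked by \<open>SOME\<close>.\<close>

theorem ito_integral_unique:
  assumes \<alpha>: "\<alpha> \<in> controls M W l u"
    and I: "has_ito_integral M W b \<alpha> I" and J: "has_ito_integral M W b \<alpha> J"
  shows "AE w in N. I w = J w"
proof -
  let ?err = "\<lambda>n s \<xi>. \<integral>\<^sup>+w. sq_error b \<alpha> n s \<xi> w \<partial>N"
  obtain n s \<xi> where 1: "\<And>k. simple_process M W b (n k) (s k) (\<xi> k)"
    and lim1: "(\<lambda>k. ?err (n k) (s k) (\<xi> k)) \<longlonglongrightarrow> 0"
      "(\<lambda>k. sq_dist N I (simple_integral W (n k) (s k) (\<xi> k))) \<longlonglongrightarrow> 0"
    using I unfolding has_ito_integral_def by blast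
  obtain m t \<eta> where 2: "\<And>k. simple_process M W b (m k) (t k) (\<eta> k)"
    and lim2: "(\<lambda>k. ?err (m k) (t k) (\<eta> k)) \<longlonglongrightarrow> 0"
      "(\<lambda>k. sq_dist N J (simple_integral W (m k) (t k) (\<eta> k))) \<longlonglongrightarrow> 0"
    using J unfolding has_ito_integral_def by blast
  have Im [measurable]: "I \<in> borel_measurable N" "J \<in> borel_measurable N"
    using I J by (auto simp: has_ito_integral_def)
  let ?Y = "\<lambda>k. simple_integral W (n k) (s k) (\<xi> k)" and ?Z = "\<lambda>k. simple_integral W (m k) (t k) (\<eta> k)"
  let ?e = "\<lambda>k. 2 * ?err (n k) (s k) (\<xi> k) + 2 * ?err (m k) (t k) (\<eta> k)"
  note Ym = simple_integral_measurable[OF 1] and Zm = simple_integral_measurable[OF 2]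
  have tri: "sq_dist N f h \<le> 2 * sq_dist N f g + 2 * sq_dist N g h"
    if "f \<in> borel_measurable N" "g \<in> borel_measurable N" "h \<in> borel_measurable N" for f g h
  proof -
    have "(\<integral>\<^sup>+w. ennreal (k w) * indicator (space N) w \<partial>N) = (\<integral>\<^sup>+w. ennreal (k w) \<partial>N)" for k
      by (intro nn_integral_cong) simp
    then show ?thesis using nn_integral_square_triangle[OF that sets.top] by simp
  qed
  have "sq_dist N I J \<le>
      2 * sq_dist N I (?Y k) +
      2 * (2 * (?e k) + 2 * sq_dist N J (?Z k))" for k
  proof -
    have "sq_dist N (?Y k) J \<le>
        2 * (?e k) + 2 * sq_dist N (?Z k) J"
      by (rule order.trans[OF tri[OF Ym[of k] Zm[of k] Im(2)]])
        (intro add_mono mult_left_mono simple_integral_distance[OF \<alpha> 1 2] order.refl; simp)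
    also have "sq_dist N (?Z k) J = sq_dist N J (?Z k)"
      by (simp add: power2_commute)
    finally show ?thesis
      by (intro order.trans[OF tri[OF Im(1) Ym[of k] Im(2)]] add_left_mono mult_left_mono) auto
  qed
  moreover have "(\<lambda>k. 2 * sq_dist N I (?Y k) +
      2 * (2 * (?e k) + 2 * sq_dist N J (?Z k)))
      \<longlonglongrightarrow> 2 * 0 + 2 * (2 * (2 * 0 + 2 * 0) + 2 * 0)"
    by (intro tendsto_add ennreal_tendsto_cmult lim1 lim2) auto
  ultimately have "sq_dist N I J \<le> 2 * 0 + 2 * (2 * (2 * 0 + 2 * 0) + 2 * 0)"
    by (intro LIMSEQ_le_const) auto
  then have "sq_dist N I J = 0" by simp
  then have "AE w in N. ennreal ((I w - J w)\<^sup>2) = 0"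
    by (subst (asm) nn_integral_0_iff_AE) auto
  then show ?thesis
    by eventually_elim simp
qed

end

section \<open>The value function as a semigroup\<close>

locale volatility_control = brownian_motion M W + volatility_band l u
  for M :: "'a measure" and W l u
begin

interpretation N: prob_space N
  by (rule prob_space_completion)

section \<open>The semigroup lies below the cost of every control\<close>

lemma partial_simple_integral:
  assumes sp: "simple_process M W b n s \<xi>" and "k \<le> n"
  shows "(\<lambda>w. x + (\<Sum>i<k. \<xi> i w * (W (s (Suc i)) w - W (s i) w))) \<in> borel_measurable (F (s k))" (is ?m)
    and "integrable N (\<lambda>w. x + (\<Sum>i<k. \<xi> i w * (W (s (Suc i)) w - W (s i) w)))" (is ?i)
proof -
  obtain C where C: "\<And>i w. i < n \<Longrightarrow> w \<in> space M \<Longrightarrow> \<bar>\<xi> i w\<bar> \<le> C"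
    using sp unfolding simple_process_def by metis
  have "\<xi> i \<in> borel_measurable (F (s k))" "W (s (Suc i)) \<in> borel_measurable (F (s k))" "W (s i) \<in> borel_measurable (F (s k))"
    if "i < k" for i
  proof -
    have "\<xi> i \<in> borel_measurable (F (s i))" using sp that \<open>k \<le> n\<close> by (auto simp: simple_process_def)
    then show "\<xi> i \<in> borel_measurable (F (s k))"
      using simple_process_mono[OF sp, of i k] that \<open>k \<le> n\<close> by (auto intro: measurable_F_mono)
    show "W (s (Suc i)) \<in> borel_measurable (F (s k))" "W (s i) \<in> borel_measurable (F (s k))"
      using simple_process_mono[OF sp] simple_process_nonneg[OF sp] that \<open>k \<le> n\<close> by (auto intro!: W_measurable_F)
  qed
  then show ?m
    by (intro borel_measurable_add borel_measurable_sum borel_measurable_times borel_measurable_diff) auto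
  have "integrable N (\<lambda>w. \<xi> i w * (W (s (Suc i)) w - W (s i) w))" if "i < k" for i
  proof (rule integrable_bounded_times[of _ C])
    show "\<xi> i \<in> borel_measurable N" using simple_process_measurable[OF sp] that \<open>k \<le> n\<close> by simp
    show "integrable N (\<lambda>w. W (s (Suc i)) w - W (s i) w)"
      using increment_moments(1)[of "s i" "s (Suc i)"] simple_process_nonneg[OF sp, of i]
        simple_process_strict_mono[OF sp, of i "Suc i"] that \<open>k \<le> n\<close> by (auto simp: has_bochner_integral_iff)
  qed (use C that \<open>k \<le> n\<close> in auto)
  then show ?i by (auto intro!: Bochner_Integration.integrable_add Bochner_Integration.integrable_sum)
qed

text \<open>Along the grid of the process, the backward values \<open>g k\<close> at the states
  \<open>X k\<close> have increasing means: whatever volatility is used, its Gaussian average is at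
  least the minimised one. The chain leads from a value of \<open>steps\<close> to the cost.\<close>

lemma nisio_le_simple:
  assumes f: "L-lipschitz_on UNIV f" and sp: "simple_process M W \<tau> n s \<xi>"
    and range: "\<And>i w. i < n \<Longrightarrow> w \<in> space M \<Longrightarrow> \<xi> i w \<in> {l..u}"
  shows "nisio f \<tau> x \<le> (\<integral>w. f (x + simple_integral W n s \<xi> w) \<partial>N)"
proof -
  define X where "X k w = x + (\<Sum>i<k. \<xi> i w * (W (s (Suc i)) w - W (s i) w))" for k w
  have X: "X k \<in> borel_measurable (F (s k))" "integrable N (X k)" if "k \<le> n" for k
    using partial_simple_integral[OF sp that, of x] unfolding X_def[abs_def] by auto
  define gap where "gap i = s (Suc i) - s i" for i
  define g where "g k = steps (map gap [k..<n]) f" for k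
  have g: "L-lipschitz_on UNIV (g k)" for k
    unfolding g_def using f by (rule steps_lipschitz)
  have mono: "(\<integral>w. g k (X k w) \<partial>N) \<le> (\<integral>w. g (Suc k) (X (Suc k) w) \<partial>N)" if "k < n" for k
  proof -
    have k: "0 \<le> s k" "s k < s (Suc k)"
      using simple_process_nonneg[OF sp, of k] simple_process_strict_mono[OF sp, of k "Suc k"] that by auto
    have \<xi>: "\<xi> k \<in> borel_measurable (F (s k))" using sp that by (auto simp: simple_process_def)
    have bd: "\<bar>\<xi> k w\<bar> \<le> u" if "w \<in> space M" for w
      using range[OF \<open>k < n\<close> that] l_nonneg by auto
    note E = expectation_lipschitz_step[OF g[of "Suc k"] k X[OF less_imp_le[OF that]] \<xi> bd]
    have gk: "g k = step (gap k) (g (Suc k))"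
      using that by (simp add: g_def upt_conv_Cons)
    have "(\<integral>w. g k (X k w) \<partial>N) \<le> (\<integral>w. heat (\<xi> k w * sqrt (s (Suc k) - s k)) (g (Suc k)) (X k w) \<partial>N)"
    proof (rule integral_mono)
      show "integrable N (\<lambda>w. g k (X k w))"
        using g X(2)[OF less_imp_le[OF that]] by (rule N.integrable_lipschitz)
      show "g k (X k w) \<le> heat (\<xi> k w * sqrt (s (Suc k) - s k)) (g (Suc k)) (X k w)" if "w \<in> space N" for w
        unfolding gk gap_def using step_le_heat[OF g range[OF \<open>k < n\<close>]] that by simp
    qed (rule E(3))
    also have "\<dots> = (\<integral>w. g (Suc k) (X k w + \<xi> k w * (W (s (Suc k)) w - W (s k) w)) \<partial>N)"
      using E(2) by simp
    also have "\<dots> = (\<integral>w. g (Suc k) (X (Suc k) w) \<partial>N)"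
      by (simp add: X_def add.assoc)
    finally show ?thesis .
  qed
  have chain: "(\<integral>w. g 0 (X 0 w) \<partial>N) \<le> (\<integral>w. g k (X k w) \<partial>N)" if "k \<le> n" for k
    using that
  proof (induction k)
    case (Suc k)
    then show ?case using mono[of k] by simp
  qed simp
  have "map gap [0..<n] \<in> partitions \<tau>"
  proof -
    have "sum_list (map gap [0..<n]) = (\<Sum>i<n. s (Suc i) - s i)"
      by (simp add: interv_sum_list_conv_sum_set_nat gap_def atLeast0LessThan)
    also have "\<dots> = \<tau>" using sp by (simp add: sum_lessThan_telescope simple_process_def)
    finally show ?thesis using sp by (auto simp: partitions_def gap_def simple_process_def)
  qed
  then have "nisio f \<tau> x \<le> g 0 x"
    unfolding g_def by (rule nisio_le[OF f])
  also have "g 0 x = (\<integral>w. g 0 (X 0 w) \<partial>N)"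
    using N.prob_space by (simp add: X_def)
  also have "\<dots> \<le> (\<integral>w. g n (X n w) \<partial>N)" by (rule chain) simp
  also have "\<dots> = (\<integral>w. f (x + simple_integral W n s \<xi> w) \<partial>N)"
    by (simp add: g_def X_def simple_integral_def)
  finally show ?thesis .
qed

lemma ito_integral_AE_eq:
  assumes \<alpha>: "\<alpha> \<in> controls M W l u" and I: "has_ito_integral M W b \<alpha> I"
  shows "AE w in N. ito_integral M W b \<alpha> w = I w"
    and "ito_integral M W b \<alpha> \<in> borel_measurable N"
proof -
  have h: "has_ito_integral M W b \<alpha> (ito_integral M W b \<alpha>)"
    unfolding ito_integral_def using someI[of "has_ito_integral M W b \<alpha>" I, OF I] .
  then show "AE w in N. ito_integral M W b \<alpha> w = I w"
    using ito_integral_unique[OF \<alpha>] I by blast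
  show "ito_integral M W b \<alpha> \<in> borel_measurable N"
    using h by (simp add: has_ito_integral_def)
qed

lemma expectation_ito_integral:
  assumes f: "L-lipschitz_on UNIV (f :: real \<Rightarrow> real)" and \<alpha>: "\<alpha> \<in> controls M W l u" and I: "has_ito_integral M W b \<alpha> I"
  shows "(\<integral>w. f (x + ito_integral M W b \<alpha> w) \<partial>N) = (\<integral>w. f (x + I w) \<partial>N)"
proof (rule integral_cong_AE)
  note [measurable] = borel_measurable_lipschitz[OF f] ito_integral_AE_eq(2)[OF \<alpha> I]
  have [measurable]: "I \<in> borel_measurable N" using I by (simp add: has_ito_integral_def)
  show "(\<lambda>w. f (x + ito_integral M W b \<alpha> w)) \<in> borel_measurable N" "(\<lambda>w. f (x + I w)) \<in> borel_measurable N"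
    by measurable
  show "AE w in N. f (x + ito_integral M W b \<alpha> w) = f (x + I w)"
    using ito_integral_AE_eq(1)[OF \<alpha> I] by eventually_elim simp
qed

lemma nisio_le_control:
  assumes f: "L-lipschitz_on UNIV f" and \<alpha>: "\<alpha> \<in> controls M W l u" and "0 < \<tau>"
  shows "nisio f \<tau> x \<le> (\<integral>w. f (x + ito_integral M W \<tau> \<alpha> w) \<partial>N)"
proof -
  obtain I n s \<xi> where I [measurable]: "I \<in> borel_measurable N"
    and sp: "\<And>k. simple_process M W \<tau> (n k) (s k) (\<xi> k)"
    and range: "\<And>k. \<forall>i<n k. \<forall>w\<in>space M. \<xi> k i w \<in> {l..u}"
    and err: "(\<lambda>k. \<integral>\<^sup>+w. sq_error \<tau> \<alpha> (n k) (s k) (\<xi> k) w \<partial>N) \<longlonglongrightarrow> 0"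
    and lim: "(\<lambda>k. sq_dist N I (simple_integral W (n k) (s k) (\<xi> k))) \<longlonglongrightarrow> 0"
    using ito_integral_exists[OF \<alpha> l_nonneg l_le_u \<open>0 < \<tau>\<close>] by blast
  have has: "has_ito_integral M W \<tau> \<alpha> I"
    unfolding has_ito_integral_def
    by (rule conjI[OF I], rule exI[of _ n], rule exI[of _ s], rule exI[of _ \<xi>]) (intro conjI allI sp err lim)
  have L: "0 \<le> L" using f by (rule lipschitz_on_nonneg)
  have "nisio f \<tau> x \<le> (\<integral>w. f (x + I w) \<partial>N) + e" if "0 < e" for e
  proof -
    \<comment> \<open>\<open>L1_le_of_L2_le\<close> turns the mean-square distance \<delta> into the
      L1 distance \<open>2 * \<delta>\<close>, which \<open>f\<close> enlarges by the factor
      \<open>L\<close>.\<close>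
    define \<delta> where "\<delta> = e / (2 * (L + 1))"
    have "0 < \<delta>" using \<open>0 < e\<close> L by (simp add: \<delta>_def)
    have "L * (2 * \<delta>) \<le> (L + 1) * (2 * \<delta>)" using \<open>0 < \<delta>\<close> by (intro mult_right_mono) auto
    also have "\<dots> = e" using L by (simp add: \<delta>_def field_simps)
    finally have Le: "L * (2 * \<delta>) \<le> e" .
    have "\<forall>\<^sub>F k in sequentially. sq_dist N I (simple_integral W (n k) (s k) (\<xi> k)) < ennreal (\<delta>\<^sup>2)"
      using order_tendstoD(2)[OF lim, of "ennreal (\<delta>\<^sup>2)"] \<open>0 < \<delta>\<close> by simp
    then obtain k where k: "sq_dist N I (simple_integral W (n k) (s k) (\<xi> k)) < ennreal (\<delta>\<^sup>2)"
      by (auto simp: eventually_sequentially)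
    let ?Y = "simple_integral W (n k) (s k) (\<xi> k)"
    note [measurable] = simple_integral_measurable[OF sp[of k]]
    note d = N.L1_le_of_L2_le[of "\<lambda>w. I w - ?Y w", OF _ \<open>0 < \<delta>\<close> less_imp_le[OF k]]
    have di: "integrable N (\<lambda>w. I w - ?Y w)" by (rule d) measurable
    have dl: "(\<integral>w. \<bar>I w - ?Y w\<bar> \<partial>N) \<le> 2 * \<delta>" by (rule d) measurable
    have Y: "integrable N (\<lambda>w. x + ?Y w)"
      using partial_simple_integral(2)[OF sp[of k] order.refl, of x] by (simp add: simple_integral_def[abs_def])
    have Iint: "integrable N (\<lambda>w. x + I w)"
      using Bochner_Integration.integrable_add[OF Y di] by simp
    have "nisio f \<tau> x \<le> (\<integral>w. f (x + ?Y w) \<partial>N)"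
      using range[of k] by (intro nisio_le_simple[OF f sp]) auto
    also have "\<dots> \<le> (\<integral>w. f (x + I w) + L * \<bar>I w - ?Y w\<bar> \<partial>N)"
    proof (rule integral_mono)
      show "integrable N (\<lambda>w. f (x + ?Y w))" using N.integrable_lipschitz[OF f Y] .
      show "integrable N (\<lambda>w. f (x + I w) + L * \<bar>I w - ?Y w\<bar>)"
        using N.integrable_lipschitz[OF f Iint] di by auto
      show "f (x + ?Y w) \<le> f (x + I w) + L * \<bar>I w - ?Y w\<bar>" for w
        using lipschitz_on_real_D[OF f, of "x + ?Y w" "x + I w"] by (simp add: abs_minus_commute)
    qed
    also have "\<dots> = (\<integral>w. f (x + I w) \<partial>N) + L * (\<integral>w. \<bar>I w - ?Y w\<bar> \<partial>N)"
      using N.integrable_lipschitz[OF f Iint] di by simp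
    also have "\<dots> \<le> (\<integral>w. f (x + I w) \<partial>N) + e"
      using mult_left_mono[OF dl L] Le by simp
    finally show ?thesis .
  qed
  then show ?thesis
    unfolding expectation_ito_integral[OF f \<alpha> has] by (rule field_le_epsilon)
qed

section \<open>Controls that follow a partition\<close>

lemma has_ito_integral_simple:
  assumes sp: "simple_process M W b n s \<xi>"
    and \<alpha>: "\<And>r w. r \<in> {0<..b} \<Longrightarrow> \<alpha> r w = simple_value n s \<xi> r w"
  shows "has_ito_integral M W b \<alpha> (simple_integral W n s \<xi>)"
proof -
  have zero: "sq_error b \<alpha> n s \<xi> w = 0" for w
  proof -
    \<comment> \<open>The values at \<open>r = 0\<close> may differ, because simple processes vanish
      there while controls stay in \<open>[l, u]\<close>; a single time is negligible.\<close>
    have "sq_error b \<alpha> n s \<xi> w = (\<integral>\<^sup>+r. 0 \<partial>(lborel :: real measure))"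
      using AE_lborel_singleton[of "0 :: real"]
      by (intro nn_integral_cong_AE, eventually_elim) (auto simp: \<alpha> split: split_indicator)
    then show ?thesis by simp
  qed
  show ?thesis
    unfolding has_ito_integral_def
    by (rule conjI[OF simple_integral_measurable[OF sp]], rule exI[of _ "\<lambda>_. n"], rule exI[of _ "\<lambda>_. s"], rule exI[of _ "\<lambda>_. \<xi>"])
      (simp add: sp zero)
qed

lemma simple_process_control:
  assumes sp: "simple_process M W \<tau> n s \<xi>"
    and range: "\<And>i w. i < n \<Longrightarrow> w \<in> space M \<Longrightarrow> \<xi> i w \<in> {l..u}"
  obtains \<alpha> where "\<alpha> \<in> controls M W l u" "has_ito_integral M W \<tau> \<alpha> (simple_integral W n s \<xi>)"
proof -
  \<comment> \<open>Outside \<open>(0, \<tau>]\<close> the value is \<open>l\<close>, since 0 may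
    fail to lie in \<open>[l, u]\<close>.\<close>
  define \<alpha> where "\<alpha> r w = (if r \<in> {0<..\<tau>} then simple_value n s \<xi> r w else l)" for r w
  have \<alpha>_eq: "\<alpha> r = \<xi> i" if "i < n" "r \<in> {s i<..s (Suc i)}" for r i
  proof -
    have "r \<in> {0<..\<tau>}"
      using simple_process_nonneg[OF sp, of i] simple_process_le[OF sp, of "Suc i"] that by auto
    then show ?thesis using simple_value_eq[OF sp that] by (auto simp: \<alpha>_def)
  qed
  have cases: "(\<exists>i<n. r \<in> {s i<..s (Suc i)} \<and> \<alpha> r = \<xi> i) \<or> \<alpha> r = (\<lambda>_. l)" for r
  proof (cases "r \<in> {0<..\<tau>}")
    case True
    then show ?thesis using simple_process_cover[OF sp True] \<alpha>_eq by metis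
  next
    case False
    then show ?thesis by (auto simp: \<alpha>_def fun_eq_iff)
  qed
  have control: "\<alpha> \<in> controls M W l u"
    unfolding controls_def mem_Collect_eq
  proof (intro conjI allI impI ballI)
    let ?R = "restrict_space borel {0 :: real..} \<Otimes>\<^sub>M N"
    have fst_m [measurable]: "fst \<in> ?R \<rightarrow>\<^sub>M borel"
      by (rule measurable_compose[OF measurable_fst measurable_restrict_space1[OF measurable_ident_sets[OF refl]]])
    have "(\<lambda>p. \<xi> i (snd p)) \<in> borel_measurable ?R" if "i < n" for i
      using measurable_compose[OF measurable_snd simple_process_measurable[OF sp that]] .
    then have "(\<lambda>p. simple_value n s \<xi> (fst p) (snd p)) \<in> borel_measurable ?R"
      unfolding simple_value_def by (intro borel_measurable_sum borel_measurable_times) auto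
    then have "(\<lambda>p. if fst p \<in> {0<..\<tau>} then simple_value n s \<xi> (fst p) (snd p) else l) \<in> borel_measurable ?R"
      by (intro measurable_If) auto
    then show "(\<lambda>(r, w). \<alpha> r w) \<in> borel_measurable ?R"
      by (simp add: \<alpha>_def split_beta)
    fix r :: real assume "0 \<le> r"
    show "\<alpha> r \<in> borel_measurable (F r)"
      using cases[of r]
    proof (elim disjE exE conjE)
      fix i assume "i < n" "r \<in> {s i<..s (Suc i)}" "\<alpha> r = \<xi> i"
      moreover have "\<xi> i \<in> borel_measurable (F (s i))" using sp \<open>i < n\<close> by (auto simp: simple_process_def)
      ultimately show ?thesis by (auto intro: measurable_F_mono)
    qed simp
    show "\<alpha> r w \<in> {l..u}" if "w \<in> space M" for w
      using cases[of r] range that l_le_u by auto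
  qed
  have "\<alpha> r w = simple_value n s \<xi> r w" if "r \<in> {0<..\<tau>}" for r w
    using that by (simp add: \<alpha>_def)
  then show thesis by (rule that[OF control has_ito_integral_simple[OF sp]])
qed

text \<open>The selectors form a feedback law: on each interval the volatility is a function of the
  state at its left end and nearly minimises the step. Each step loses at most \<delta>, and the
  losses add up along the partition.\<close>

lemma control_le_steps:
  assumes f: "L-lipschitz_on UNIV f" and hs: "hs \<in> partitions \<tau>" and "0 < \<epsilon>"
  obtains \<alpha> where "\<alpha> \<in> controls M W l u"
    "(\<integral>w. f (x + ito_integral M W \<tau> \<alpha> w) \<partial>N) \<le> steps hs f x + \<epsilon>"
proof -
  define n where "n = length hs"
  \<comment> \<open>The total loss is \<open>n * \<delta>\<close>; the summand 1 covers the empty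
    partition.\<close>
  define \<delta> where "\<delta> = \<epsilon> / (real n + 1)"
  have "0 < \<delta>" using \<open>0 < \<epsilon>\<close> by (simp add: \<delta>_def)
  define s where "s i = sum_list (take i hs)" for i
  have s0: "s 0 = 0" and sn: "s n = \<tau>" using hs by (auto simp: s_def n_def partitions_def)
  have gap: "s (Suc i) = s i + hs ! i" if "i < n" for i
    using that by (simp add: s_def n_def take_Suc_conv_app_nth)
  have pos: "0 < hs ! i" if "i < n" for i
    using that hs by (auto simp: partitions_def n_def)
  define g where "g k = steps (drop k hs) f" for k
  have g: "L-lipschitz_on UNIV (g k)" for k
    unfolding g_def using f by (rule steps_lipschitz)
  have g_step: "g k = step (hs ! k) (g (Suc k))" if "k < n" for k
    using that by (simp add: g_def n_def Cons_nth_drop_Suc[symmetric])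
  have "\<forall>k. \<exists>sel. sel \<in> borel_measurable borel \<and> (\<forall>y. sel y \<in> {l..u}) \<and>
      (\<forall>y. heat (sel y * sqrt (hs ! k)) (g (Suc k)) y \<le> step (hs ! k) (g (Suc k)) y + \<delta>)"
    using step_selector[OF g \<open>0 < \<delta>\<close>] by metis
  from choice[OF this] obtain sel where sel_m: "\<And>k. sel k \<in> borel_measurable borel"
    and sel_range: "\<And>k y. sel k y \<in> {l..u}"
    and sel: "\<And>k y. heat (sel k y * sqrt (hs ! k)) (g (Suc k)) y \<le> step (hs ! k) (g (Suc k)) y + \<delta>"
    by auto
  \<comment> \<open>State and control are built together: the control on interval \<open>k\<close>
    is the selector evaluated at the state reached so far, which makes it adapted.\<close>
  define X where "X = rec_nat (\<lambda>w. x) (\<lambda>k Y w. Y w + sel k (Y w) * (W (s (Suc k)) w - W (s k) w))"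
  have X0: "X 0 w = x" and XS: "X (Suc k) w = X k w + sel k (X k w) * (W (s (Suc k)) w - W (s k) w)" for k w
    by (simp_all add: X_def)
  define \<xi> where "\<xi> k w = sel k (X k w)" for k w
  have s_nonneg: "0 \<le> s k" if "k \<le> n" for k
    using that
  proof (induction k)
    case (Suc k)
    then show ?case using gap[of k] pos[of k] by simp
  qed (simp add: s0)
  have bd: "\<bar>\<xi> k w\<bar> \<le> u" for k w
    using sel_range[of k "X k w"] l_nonneg by (auto simp: \<xi>_def)
  have X: "X k \<in> borel_measurable (F (s k)) \<and> integrable N (X k)" if "k \<le> n" for k
    using that
  proof (induction k)
    case 0
    have "X 0 = (\<lambda>_. x)" by (simp add: X0 fun_eq_iff)
    then show ?case by simp
  next
    case (Suc k)
    then have k: "0 \<le> s k" "s k < s (Suc k)" using s_nonneg[of k] gap[of k] pos[of k] by auto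
    from Suc have Xk: "X k \<in> borel_measurable (F (s k))" "integrable N (X k)" by auto
    have \<xi>k: "\<xi> k \<in> borel_measurable (F (s k))"
      unfolding \<xi>_def using measurable_compose[OF Xk(1) sel_m] .
    have XS': "X (Suc k) = (\<lambda>w. X k w + \<xi> k w * (W (s (Suc k)) w - W (s k) w))"
      by (simp add: XS \<xi>_def fun_eq_iff)
    have "integrable N (X (Suc k))"
      unfolding XS' using expectation_lipschitz_step(1)[OF g[of 0] k Xk \<xi>k bd] .
    moreover have "X (Suc k) \<in> borel_measurable (F (s (Suc k)))"
      unfolding XS' using measurable_F_mono[OF Xk(1)] measurable_F_mono[OF \<xi>k] k
      by (intro borel_measurable_add borel_measurable_times borel_measurable_diff W_measurable_F) auto
    ultimately show ?case by simp
  qed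
  have \<xi>_m: "\<xi> k \<in> borel_measurable (F (s k))" if "k \<le> n" for k
    unfolding \<xi>_def using measurable_compose[OF conjunct1[OF X[OF that]] sel_m] .
  have sp: "simple_process M W \<tau> n s \<xi>"
    unfolding simple_process_def using s0 sn gap pos \<xi>_m bd by (auto intro!: exI[of _ u])
  obtain \<alpha> where \<alpha>: "\<alpha> \<in> controls M W l u" "has_ito_integral M W \<tau> \<alpha> (simple_integral W n s \<xi>)"
    using simple_process_control[OF sp] sel_range unfolding \<xi>_def by metis
  have X_sum: "X k w = x + (\<Sum>i<k. \<xi> i w * (W (s (Suc i)) w - W (s i) w))" for k w
    by (induction k) (simp_all add: X0 XS \<xi>_def)
  have chain: "(\<integral>w. g k (X k w) \<partial>N) \<le> steps hs f x + real k * \<delta>" if "k \<le> n" for k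
    using that
  proof (induction k)
    case 0
    then show ?case using N.prob_space by (simp add: X0 g_def)
  next
    case (Suc k)
    then have k: "0 \<le> s k" "s k < s (Suc k)" "k < n" using s_nonneg[of k] gap[of k] pos[of k] by auto
    have Xk: "X k \<in> borel_measurable (F (s k))" "integrable N (X k)" using X[of k] k by auto
    note E = expectation_lipschitz_step[OF g[of "Suc k"] k(1,2) Xk \<xi>_m[OF less_imp_le[OF k(3)]] bd]
    have "(\<integral>w. g (Suc k) (X (Suc k) w) \<partial>N) = (\<integral>w. heat (\<xi> k w * sqrt (s (Suc k) - s k)) (g (Suc k)) (X k w) \<partial>N)"
      using E(2) by (simp add: XS \<xi>_def)
    also have "\<dots> \<le> (\<integral>w. g k (X k w) + \<delta> \<partial>N)"
    proof (rule integral_mono[OF E(3)])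
      show "integrable N (\<lambda>w. g k (X k w) + \<delta>)"
        using N.integrable_lipschitz[OF g Xk(2)] by simp
      show "heat (\<xi> k w * sqrt (s (Suc k) - s k)) (g (Suc k)) (X k w) \<le> g k (X k w) + \<delta>" for w
        unfolding g_step[OF k(3)] \<xi>_def using sel[of k "X k w"] gap[OF k(3)] by simp
    qed
    also have "\<dots> = (\<integral>w. g k (X k w) \<partial>N) + \<delta>"
      using N.integrable_lipschitz[OF g Xk(2)] N.prob_space by simp
    also have "\<dots> \<le> steps hs f x + real (Suc k) * \<delta>"
      using Suc by (simp add: algebra_simps)
    finally show ?case .
  qed
  have "(\<integral>w. f (x + ito_integral M W \<tau> \<alpha> w) \<partial>N) = (\<integral>w. g n (X n w) \<partial>N)"
    unfolding expectation_ito_integral[OF f \<alpha>] by (simp add: X_sum simple_integral_def g_def n_def)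
  also have "\<dots> \<le> steps hs f x + real n * \<delta>" by (rule chain) simp
  also have "real n * \<delta> \<le> \<epsilon>"
    using \<open>0 < \<epsilon>\<close> by (simp add: \<delta>_def field_simps)
  finally show thesis using that \<alpha>(1) by simp
qed

section \<open>The value function is the Nisio semigroup\<close>

lemma constant_control: "(\<lambda>_ _. l) \<in> controls M W l u"
  using l_le_u by (auto simp: controls_def)

theorem u_lower_eq_nisio:
  assumes f: "L-lipschitz_on UNIV f" and "t \<le> T"
  shows "u_lower M W l u f T t x = nisio f (T - t) x"
proof (cases "t = T")
  case True
  \<comment> \<open>At \<open>t = T\<close> no time is left, whereas the existence theorem is for
    positive durations; the simple process without intervals shows that the integral is a version of
    0.\<close>
  have "has_ito_integral M W 0 \<alpha> (\<lambda>_. 0)" for \<alpha>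
    using has_ito_integral_simple[of 0 0 "\<lambda>_. 0" "\<lambda>_ _. 0" \<alpha>]
    by (simp add: simple_process_def simple_integral_def[abs_def])
  then have "(\<integral>w. f (x + ito_integral M W 0 \<alpha> w) \<partial>N) = f x" if "\<alpha> \<in> controls M W l u" for \<alpha>
    using expectation_ito_integral[OF f that, of 0 "\<lambda>_. 0" x] N.prob_space by simp
  then show ?thesis
    using True constant_control by (simp add: u_lower_def cong: INF_cong) (auto intro: cINF_const)
next
  case False
  then have \<tau>: "0 < T - t" using assms by simp
  let ?J = "\<lambda>\<alpha>. \<integral>w. f (x + ito_integral M W (T - t) \<alpha> w) \<partial>N"
  \<comment> \<open>This bound serves twice: for one of the inequalities, and as the lower bound
    that makes the infimum over controls effective in the other.\<close>
  have ge: "nisio f (T - t) x \<le> ?J \<alpha>" if "\<alpha> \<in> controls M W l u" for \<alpha>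
    using nisio_le_control[OF f that \<tau>] .
  show ?thesis
    unfolding u_lower_def
  proof (rule antisym)
    show "nisio f (T - t) x \<le> (INF \<alpha>\<in>controls M W l u. ?J \<alpha>)"
      using constant_control ge by (intro cINF_greatest) auto
    show "(INF \<alpha>\<in>controls M W l u. ?J \<alpha>) \<le> nisio f (T - t) x"
    proof (rule le_nisio)
      fix hs assume hs: "hs \<in> partitions (T - t)"
      show "(INF \<alpha>\<in>controls M W l u. ?J \<alpha>) \<le> steps hs f x"
      proof (rule field_le_epsilon)
        fix e :: real assume "0 < e"
        obtain \<alpha> where \<alpha>: "\<alpha> \<in> controls M W l u" "?J \<alpha> \<le> steps hs f x + e"
          using control_le_steps[OF f hs \<open>0 < e\<close>] by blast
        have "(INF \<alpha>\<in>controls M W l u. ?J \<alpha>) \<le> ?J \<alpha>"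
          using ge \<alpha>(1) by (intro cINF_lower bdd_belowI2)
        with \<alpha>(2) show "(INF \<alpha>\<in>controls M W l u. ?J \<alpha>) \<le> steps hs f x + e" by simp
      qed
    qed (use \<tau> in simp)
  qed
qed

end

theorem theorem5p3:
  fixes M :: "'a measure" and W :: "real \<Rightarrow> 'a \<Rightarrow> real"
    and T \<sigma>\<^sub>l \<sigma>\<^sub>u :: real and \<Phi> :: "real \<Rightarrow> real"
  assumes "brownian_motion M W"
    and "T > 0"
    and "0 \<le> \<sigma>\<^sub>l" and "\<sigma>\<^sub>l \<le> \<sigma>\<^sub>u"
    and "\<exists>L. L-lipschitz_on UNIV \<Phi>"
  shows "viscosity_solution T (G_lower \<sigma>\<^sub>l \<sigma>\<^sub>u) \<Phi> (u_lower M W \<sigma>\<^sub>l \<sigma>\<^sub>u \<Phi> T)"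
proof -
  interpret volatility_control M W \<sigma>\<^sub>l \<sigma>\<^sub>u
    using assms by (simp add: volatility_control_def volatility_band_def)
  obtain L where "L-lipschitz_on UNIV \<Phi>"
    using assms by blast
  then show ?thesis
    using u_lower_eq_nisio \<open>T > 0\<close> by (intro viscosity_solution_nisio) auto
qed

end
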